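(* Let $p$ and $q$ be prime integers with $p\ne q$ and $k$ a positive integer, and let $\Delta\subset\mathbb{R}^d$ be a Gorenstein simplex of dimension $d$ whose $\delta$-polynomial is $1+t^{k}+t^{2k}+\cdots+t^{(pq-1)k}$. Suppose that $\Delta$ is not a lattice pyramid over any lower-dimensional lattice simplex. Then one of the following holds, where in each case the finite abelian group $\Lambda_\Delta$ is generated by the single indicated element, up to permutation of the coordinates: (1) $d=pqk-1$, and $\Lambda_\Delta$ is generated by $(1/(pq),\ldots,1/(pq))\in(\mathbb{R}/\mathbb{Z})^{pqk}$; (2) $d=pqk+pk-1$, and $\Lambda_\Delta$ is generated by $\big(\underbrace{1/p,\ldots,1/p}_{pk},\underbrace{1/q,\ldots,1/q}_{pqk}\big)\in(\mathbb{R}/\mathbb{Z})^{p(q+1)k}$; (3) $d=pqk+qk-1$, and $\Lambda_\Delta$ is generated by $\big(\underbrace{1/q,\ldots,1/q}_{qk},\underbrace{1/p,\ldots,1/p}_{pqk}\big)\in(\mathbb{R}/\mathbb{Z})^{(p+1)qk}$; (4) $d=pqk+(p-1)k-1$, and $\Lambda_\Delta$ is generated by $\big(\underbrace{1/q,\ldots,1/q}_{(pq-1)k},\underbrace{1/(pq),\ldots,1/(pq)}_{pk}\big)\in(\mathbb{R}/\mathbb{Z})^{(pq+p-1)k}$; (5) $d=pqk+(q-1)k-1$, and $\Lambda_\Delta$ is generated by $\big(\underbrace{1/p,\ldots,1/p}_{(pq-1)k},\underbrace{1/(pq),\ldots,1/(pq)}_{qk}\big)\in(\mathbb{R}/\mathbb{Z})^{(pq+q-1)k}$.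 In particular, $\Delta$ is unimodularly equivalent to one of $\Delta(A_1)$, $\Delta(A_2)$, $\Delta(A_3)$, $\Delta(B_1,C_1)$, $\Delta(B_2,C_2)$, where $$A_1=(\underbrace{1,\ldots,1}_{pqk-2},pq),\quad A_2=(\underbrace{1,\ldots,1}_{pk-1},\underbrace{p,\ldots,p}_{(pq-1)k-1},pq),\quad A_3=(\underbrace{1,\ldots,1}_{qk-1},\underbrace{q,\ldots,q}_{(pq-1)k-1},pq),$$ $$B_1=(\underbrace{1,\ldots,1}_{pk-1},p),\quad C_1=(\underbrace{q,\ldots,q}_{pk},\underbrace{1,\ldots,1}_{pqk-2},q),$$ $$B_2=(\underbrace{1,\ldots,1}_{qk-1},q),\quad C_2=(\underbrace{p,\ldots,p}_{qk},\underbrace{1,\ldots,1}_{pqk-2},p).$$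
   Context: A lattice polytope is a convex polytope in $\mathbb{R}^d$ all of whose vertices lie in $\mathbb{Z}^d$; a lattice simplex is a lattice polytope that is a simplex. For a $d$-dimensional lattice polytope $\mathcal{P}\subset\mathbb{R}^d$, its $\delta$-polynomial ($h^*$-polynomial) $\delta(\mathcal{P},t)$ is defined by $(1-t)^{d+1}\left(1+\sum_{n\ge1}|n\mathcal{P}\cap\mathbb{Z}^d|\,t^n\right)=\delta(\mathcal{P},t)$. Two $d$-dimensional lattice polytopes $\mathcal{P},\mathcal{Q}\subset\mathbb{R}^d$ are unimodularly equivalent if $\mathcal{Q}=f_U(\mathcal{P})+\mathbf{w}$ for some $\mathbf{w}\in\mathbb{Z}^d$ and some $U\in\mathbb{Z}^{d\times d}$ with $\det U=\pm1$, where $f_U(\mathbf{v})=\mathbf{v}U$. A $d$-dimensional lattice polytope is reflexive if the origin is in its interior and its dual polytope is again a lattice polytope; $\mathcal{P}$ is Gorenstein if for some positive integer $r$ the polytope $r\mathcal{P}$ is unimodularly equivalent to a reflexive polytope (equivalently, $\delta(\mathcal{P},t)=\delta_0+\cdots+\delta_st^s$ with $\delta_s\ne0$ is palindromic). For a $d$-dimensional lattice simplex $\Delta\subset\mathbb{R}^d$ with vertices $\mathbf{v}_0,\ldots,\mathbf{v}_d$, set $\Lambda_\Delta=\{(\lambda_0,\ldots,\lambda_d)\in(\mathbb{R}/\mathbb{Z})^{d+1}:\sum_{i=0}^d\lambda_i(\mathbf{v}_i,1)\in\mathbb{Z}^{d+1}\}$, a finite abelian group under componentwise addition; permuting coordinates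 corresponds to reordering the vertices. The lattice pyramid over a $d$-dimensional lattice polytope $\mathcal{P}$ is $\mathrm{Pyr}(\mathcal{P})=\mathrm{conv}(\mathcal{P}\times\{0\},(0,\ldots,0,1))\subset\mathbb{R}^{d+1}$. A lattice simplex is called a lattice pyramid (over a lower-dimensional lattice simplex) if it is, up to unimodular equivalence, obtained by successively taking lattice pyramids; equivalently, there is $i\in\{0,\ldots,d\}$ with $\lambda_i=0$ for all $(\lambda_0,\ldots,\lambda_d)\in\Lambda_\Delta$. Write $\mathbf{e}_1,\ldots,\mathbf{e}_d$ for the standard basis of $\mathbb{R}^d$. For a sequence $A=(a_1,\ldots,a_d)$ of integers, $\Delta(A)\subset\mathbb{R}^d$ is the convex hull of the origin, $\mathbf{e}_1,\ldots,\mathbf{e}_{d-1}$ and $(a_d-a_1,\ldots,a_d-a_{d-1},a_d)$. For sequences $B=(b_1,\ldots,b_s)$ and $C=(c_1,\ldots,c_d)$ of integers with $1\le s<d$, $\Delta(B,C)\subset\mathbb{R}^d$ is the convex hull of the origin, the vectors $\mathbf{e}_i$ for $i\in\{1,\ldots,d-1\}\setminus\{s\}$, the vector $(b_s-b_1,\ldots,b_s-b_{s-1},b_s,0,\ldots,0)$, and the vector $(c_d-c_1,\ldots,c_d-c_{d-1},c_d)$. *)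

theory Defs
  imports
    "HOL-Analysis.Analysis"
    "HOL-Computational_Algebra.Polynomial_FPS"
    "HOL-Computational_Algebra.Primes"
    "HOL-Algebra.Generated_Groups"
begin

text \<open>
  The dimension is \<open>d = CARD('n)\<close>. The order on the index type \<open>'n\<close> only serves to number the
  coordinates \<open>1, \<dots>, d\<close>. For \<open>m \<le> d\<close>, the space of dimension \<open>m\<close> is identified with the span of the
  first \<open>m\<close> standard basis vectors, that is, a vector is padded with zeros.
\<close>

definition std_basis :: "nat \<Rightarrow> real ^ 'n::{finite,linorder}" where
  "std_basis i = axis (sorted_list_of_set (UNIV :: 'n set) ! (i - 1)) 1"

definition coord_space :: "nat \<Rightarrow> (real ^ 'n::{finite,linorder}) set" where
  "coord_space m = span (std_basis ` {1..m})"

definition int_lattice :: "(real ^ 'n) set" where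
  "int_lattice = {x. \<forall>i. x $ i \<in> \<int>}"

definition vertices :: "(real ^ 'n) set \<Rightarrow> (real ^ 'n) set" where
  "vertices P = {v. v extreme_point_of P}"

definition lattice_polytope :: "(real ^ 'n) set \<Rightarrow> bool" where
  "lattice_polytope P \<longleftrightarrow> polytope P \<and> vertices P \<subseteq> int_lattice"

definition lattice_simplex :: "nat \<Rightarrow> (real ^ 'n) set \<Rightarrow> bool" where
  "lattice_simplex m P \<longleftrightarrow> int m simplex P \<and> lattice_polytope P"

definition unimodular_equiv :: "(real ^ 'n) set \<Rightarrow> (real ^ 'n) set \<Rightarrow> bool" where
  "unimodular_equiv P Q \<longleftrightarrow>
     (\<exists>(U :: int ^ 'n ^ 'n) w. (det U = 1 \<or> det U = - 1) \<and> w \<in> int_lattice \<and>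
        Q = (\<lambda>v. v v* (\<chi> i j. real_of_int (U $ i $ j)) + w) ` P)"

text \<open>
  Meant for \<open>P\<close> of full dimension \<open>CARD('n)\<close>, hence the fixed exponent \<open>CARD('n) + 1\<close>.
\<close>

definition delta_series :: "(real ^ 'n) set \<Rightarrow> int fps" where
  "delta_series P = (1 - fps_X) ^ (CARD('n) + 1) *
     Abs_fps (\<lambda>n. if n = 0 then 1 else int (card ((\<lambda>x. real n *\<^sub>R x) ` P \<inter> int_lattice)))"

definition is_delta_poly :: "(real ^ 'n) set \<Rightarrow> int poly \<Rightarrow> bool" where
  "is_delta_poly P f \<longleftrightarrow> fps_of_poly f = delta_series P"

definition dual_polytope :: "(real ^ 'n) set \<Rightarrow> (real ^ 'n) set" where
  "dual_polytope P = {y. \<forall>x\<in>P. x \<bullet> y \<le> 1}"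

definition reflexive_polytope :: "(real ^ 'n) set \<Rightarrow> bool" where
  "reflexive_polytope P \<longleftrightarrow> lattice_polytope P \<and> aff_dim P = int CARD('n) \<and>
     0 \<in> interior P \<and> lattice_polytope (dual_polytope P)"

definition gorenstein :: "(real ^ 'n) set \<Rightarrow> bool" where
  "gorenstein P \<longleftrightarrow> lattice_polytope P \<and> aff_dim P = int CARD('n) \<and>
     (\<exists>r::nat. r > 0 \<and> (\<exists>Q. reflexive_polytope Q \<and> unimodular_equiv ((\<lambda>x. real r *\<^sub>R x) ` P) Q))"

text \<open>
  Both are meant for \<open>P \<subseteq> coord_space m\<close>: the apex \<open>(0, \<dots>, 0, 1)\<close> is then the next standard basis
  vector, and \<open>iterated_pyr m r P\<close> lies in \<open>coord_space (m + r)\<close>.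
\<close>

definition pyr :: "nat \<Rightarrow> (real ^ 'n::{finite,linorder}) set \<Rightarrow> (real ^ 'n::{finite,linorder}) set" where
  "pyr m P = convex hull (P \<union> {std_basis (m + 1)})"

primrec iterated_pyr :: "nat \<Rightarrow> nat \<Rightarrow> (real ^ 'n::{finite,linorder}) set \<Rightarrow> (real ^ 'n::{finite,linorder}) set" where
  "iterated_pyr m 0 P = P"
| "iterated_pyr m (Suc r) P = pyr (m + r) (iterated_pyr m r P)"

definition is_lattice_pyramid :: "(real ^ 'n::{finite,linorder}) set \<Rightarrow> bool" where
  "is_lattice_pyramid P \<longleftrightarrow>
     (\<exists>m < CARD('n). \<exists>Q. Q \<subseteq> coord_space m \<and> lattice_simplex m Q \<and>
        unimodular_equiv P (iterated_pyr m (CARD('n) - m) Q))"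

quotient_type real_mod_int = real / "\<lambda>x y :: real. x - y \<in> \<int>"
proof (rule equivpI)
  show "reflp (\<lambda>x y :: real. x - y \<in> \<int>)"
    by (simp add: reflp_def)
  show "symp (\<lambda>x y :: real. x - y \<in> \<int>)"
    by (metis (mono_tags, lifting) Ints_minus minus_diff_eq sympI)
  show "transp (\<lambda>x y :: real. x - y \<in> \<int>)"
  proof (rule transpI)
    fix x y z :: real
    assume "x - y \<in> \<int>" "y - z \<in> \<int>"
    then have "(x - y) + (y - z) \<in> \<int>" by (rule Ints_add)
    then show "x - z \<in> \<int>" by simp
  qed
qed

lift_definition residue_class :: "real \<Rightarrow> real_mod_int" is "\<lambda>x. x" .

instantiation real_mod_int :: ab_group_add
begin

lift_definition zero_real_mod_int :: real_mod_int is 0 .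

lift_definition plus_real_mod_int :: "real_mod_int \<Rightarrow> real_mod_int \<Rightarrow> real_mod_int" is "(+)"
proof -
  fix a b c d :: real
  assume "a - b \<in> \<int>" "c - d \<in> \<int>"
  then have "(a - b) + (c - d) \<in> \<int>" by (rule Ints_add)
  then show "a + c - (b + d) \<in> \<int>" by (simp add: algebra_simps)
qed

lift_definition uminus_real_mod_int :: "real_mod_int \<Rightarrow> real_mod_int" is uminus
proof -
  fix a b :: real
  assume "a - b \<in> \<int>"
  then have "- (a - b) \<in> \<int>" by (rule Ints_minus)
  then show "- a - - b \<in> \<int>" by simp
qed

lift_definition minus_real_mod_int :: "real_mod_int \<Rightarrow> real_mod_int \<Rightarrow> real_mod_int" is "(-)"
proof -
  fix a b c d :: real
  assume "a - b \<in> \<int>" "c - d \<in> \<int>"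
  then have "(a - b) - (c - d) \<in> \<int>" by (rule Ints_diff)
  then show "a - c - (b - d) \<in> \<int>" by (simp add: algebra_simps)
qed

instance
  by standard (transfer, simp)+

end

text \<open>
  The group \<open>\<Lambda>\<close> of the simplex with vertices \<open>v 0, \<dots>, v d\<close>, as a group of lists of length \<open>d + 1\<close>.
  Since the vertices are lattice points, membership does not depend on the representatives \<open>r i\<close>.
\<close>

definition Lambda_group :: "(nat \<Rightarrow> real ^ 'n) \<Rightarrow> real_mod_int list monoid" where
  "Lambda_group v =
     \<lparr>carrier = {xs. length xs = CARD('n) + 1 \<and>
        (\<exists>r. (\<forall>i \<le> CARD('n). xs ! i = residue_class (r i)) \<and>
             (\<Sum>i \<le> CARD('n). r i *\<^sub>R (v i, 1 :: real)) \<in> int_lattice \<times> \<int>)},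
      mult = map2 (+),
      one = replicate (CARD('n) + 1) 0\<rparr>"

definition Lambda_generated_up_to_perm :: "(nat \<Rightarrow> real ^ 'n) \<Rightarrow> real_mod_int list \<Rightarrow> bool" where
  "Lambda_generated_up_to_perm v g \<longleftrightarrow>
     (\<exists>g'. mset g' = mset g \<and> g' \<in> carrier (Lambda_group v) \<and>
        generate (Lambda_group v) {g'} = carrier (Lambda_group v))"

text \<open>
  For \<open>A = (a\<^sub>1, \<dots>, a\<^sub>l)\<close> this is \<open>(a\<^sub>l - a\<^sub>1, \<dots>, a\<^sub>l - a\<^sub>l\<^sub>-\<^sub>1, a\<^sub>l, 0, \<dots>, 0)\<close>.
\<close>

definition seq_vertex :: "int list \<Rightarrow> real ^ 'n::{finite,linorder}" where
  "seq_vertex A =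
     (\<Sum>i = 1..<length A. real_of_int (last A - A ! (i - 1)) *\<^sub>R std_basis i)
       + real_of_int (last A) *\<^sub>R std_basis (length A)"

text \<open>
  \<open>\<Delta>(A)\<close> and \<open>\<Delta>(B, C)\<close>, for \<open>length A = d\<close> and for \<open>1 \<le> length B < length C = d\<close>, respectively.
\<close>

definition simplex_A :: "int list \<Rightarrow> (real ^ 'n::{finite,linorder}) set" where
  "simplex_A A = convex hull ({0} \<union> std_basis ` {1..CARD('n) - 1} \<union> {seq_vertex A})"

definition simplex_BC :: "int list \<Rightarrow> int list \<Rightarrow> (real ^ 'n::{finite,linorder}) set" where
  "simplex_BC B C = convex hull
     ({0} \<union> std_basis ` ({1..CARD('n) - 1} - {length B}) \<union> {seq_vertex B, seq_vertex C})"

end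

theory Submission
  imports Defs "HOL-Number_Theory.Cong" "HOL-Combinatorics.Permutations"
begin

text \<open>
  Let \<open>v 0, \<dots>, v d\<close> be the vertices of the simplex. Everything is read off from the group \<open>L\<close> of real
  coefficient vectors \<open>r\<close> for which \<open>\<Sum> r i *\<^sub>R (v i, 1)\<close> is integral (\<open>coeff_lattice v\<close>). It contains the
  integer vectors, and \<open>L\<close> modulo the integer vectors is the group \<open>\<Lambda>\<close> of the simplex. The height of a
  class is the sum of the fractional parts of its coordinates.

  Heights and the \<open>\<delta>\<close>-polynomial. A lattice point of the \<open>n\<close>-th dilate has unique nonnegative coefficients
  with sum \<open>n\<close>. Splitting each of them into its integral and fractional part shows that the Ehrhart series is
  \<open>(\<Sum>x\<in>\<Lambda>. t ^ height x) / (1 - t) ^ (d + 1)\<close> (\<open>delta_series_simplex\<close>). For the given \<open>\<delta>\<close>-polynomial,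
  the height is therefore a bijection from \<open>\<Lambda>\<close> onto \<open>{0, k, \<dots>, (p q - 1) k}\<close>.

  Mixed radix structure. Heights are subadditive. Let \<open>H\<close> be a subgroup with heights exactly
  \<open>0, k, \<dots>, (s - 1) k\<close>, let \<open>z\<close> be the element of height \<open>s k\<close>, and let \<open>t\<close> be the order of \<open>z\<close> modulo \<open>H\<close>.
  Going through the elements \<open>a + j z\<close> with \<open>a \<in> H\<close> and \<open>j < t\<close> in the order of the expected height
  \<open>height a + j s k\<close>, subadditivity bounds the actual height by the expected one, and all smaller values are
  already taken. So the two are equal: no carry occurs in any coordinate, and \<open>H + \<langle>z\<rangle>\<close> is again a subgroup
  with an initial segment of heights (\<open>radix_step\<close>). Starting from the zero subgroup, \<open>p q\<close> is the product
  of the orders \<open>t\<close> of the steps, so there are at most two of them.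

  Coordinates. Absence of carries forces the digits: if \<open>t x\<close> is an integer and \<open>(t - 1) frac x < 1\<close>, then
  \<open>frac x\<close> is \<open>0\<close> or \<open>1 / t\<close>. If the simplex is not a lattice pyramid, no coordinate vanishes on \<open>\<Lambda>\<close>. With one
  step, all coordinates of the generator are \<open>1 / (p q)\<close>. With two steps of orders \<open>p\<close> and \<open>q\<close>, the first element
  is \<open>1 / p\<close> on a set \<open>S\<close> of \<open>p k\<close> coordinates and \<open>0\<close> elsewhere, and the second one is \<open>1 / q\<close> off \<open>S\<close> and either
  \<open>0\<close> on all of \<open>S\<close> or \<open>1 / (p q)\<close> on all of \<open>S\<close>; heights then count the coordinates. Together with the exchange
  of \<open>p\<close> and \<open>q\<close> these are the five cases (\<open>generator_classification\<close>).

  Back to geometry. The affine map between two simplices that matches their vertices maps lattice points to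
  lattice points in both directions when the two coefficient lattices coincide, so \<open>\<Lambda>\<close> determines the simplex up to
  unimodular equivalence (\<open>unimodular_equiv_if_coeff_lattice_eq\<close>). It remains to compute the coefficient
  lattices of the model simplices. That a coordinate vanishing on \<open>\<Lambda>\<close> yields a lattice pyramid is proved by
  completing a primitive integral functional to lattice coordinates with the Euclidean algorithm
  (\<open>lattice_pyramid_if_integral_coefficient\<close>).
\<close>

section \<open>Sums of fractional parts\<close>

definition frac_height :: "nat \<Rightarrow> (nat \<Rightarrow> real) \<Rightarrow> real" where
  "frac_height d r = (\<Sum>i\<le>d. frac (r i))"

text \<open>
  Working with real vectors instead of classes modulo \<open>\<int>\<close> keeps fractional parts directly accessible.
\<close>

definition cyclic_mod_int :: "nat \<Rightarrow> (nat \<Rightarrow> real) \<Rightarrow> (nat \<Rightarrow> real) set" where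
  "cyclic_mod_int d g = {r. \<exists>j::int. \<forall>i\<le>d. r i - of_int j * g i \<in> \<int>}"

lemma frac_add_le: "frac (x + y) \<le> frac x + frac (y :: real)"
  by (simp add: frac_add)

lemma frac_of_nat_mult_le: "frac (real j * x) \<le> real j * frac x"
proof (induction j)
  case (Suc j)
  have "frac (real (Suc j) * x) = frac (real j * x + x)" by (simp add: algebra_simps)
  also have "\<dots> \<le> real j * frac x + frac x" using frac_add_le Suc by (meson add_right_mono order_trans)
  finally show ?case by (simp add: algebra_simps)
qed simp

lemma frac_cong_int: "x - y \<in> \<int> \<Longrightarrow> frac x = frac (y :: real)"
  by (metis diff_add_cancel frac_add_int_left)

lemma frac_height_cong:
  assumes "\<And>i. i \<le> d \<Longrightarrow> r i - s i \<in> \<int>"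
  shows "frac_height d r = frac_height d s"
  unfolding frac_height_def by (rule sum.cong) (auto intro!: frac_cong_int assms)

lemma frac_height_add_mult_le:
  "frac_height d (\<lambda>i. a i + real j * z i) \<le> frac_height d a + real j * frac_height d z"
  unfolding frac_height_def sum_distrib_left sum.distrib [symmetric]
  by (intro sum_mono) (meson frac_add_le frac_of_nat_mult_le add_left_mono order_trans)

text \<open>
  Each coordinate satisfies the inequality \<open>\<le>\<close>, so equality of the sums forces equality in every
  coordinate. This turns a statement about heights into the absence of carries.
\<close>

lemma frac_add_mult_eq_of_height_eq:
  assumes "frac_height d (\<lambda>i. a i + real j * z i) = frac_height d a + real j * frac_height d z"
    and "i \<le> d"
  shows "frac (a i + real j * z i) = frac (a i) + real j * frac (z i)"
proof -
  have "(\<Sum>i\<le>d. frac (a i + real j * z i)) = (\<Sum>i\<le>d. frac (a i) + real j * frac (z i))"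
    using assms(1) by (simp add: frac_height_def sum_distrib_left sum.distrib)
  then show ?thesis
    using sum_mono_inv[of "\<lambda>i. frac (a i + real j * z i)" "{..d}" "\<lambda>i. frac (a i) + real j * frac (z i)" i]
      assms(2) by (meson atMost_iff finite_atMost frac_add_le frac_of_nat_mult_le add_left_mono order_trans)
qed

text \<open>
  The integer \<open>n * frac x\<close> is less than \<open>t / (t - 1)\<close>, which is at most \<open>2\<close>. The two parameters are
  needed for coordinates in \<open>1 / (p q)\<close> that are constrained by only \<open>q\<close> steps.
\<close>

lemma frac_eq_unit_fraction:
  fixes x :: real
  assumes "real n * x \<in> \<int>" and "(real t - 1) * (real n * frac x) < real t" and "t \<ge> 2" and "n > 0"
  shows "frac x = 0 \<or> frac x = 1 / real n"
proof -
  have "real n * frac x = real n * x - real n * of_int \<lfloor>x\<rfloor>" by (simp add: frac_def algebra_simps)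
  also have "\<dots> \<in> \<int>" using assms(1) by simp
  finally obtain m :: int where m: "real n * frac x = of_int m" by (elim Ints_cases)
  have "of_int m \<ge> (0::real)" by (simp add: m[symmetric])
  then have m0: "m \<ge> 0" by simp
  have "m < 2"
  proof (rule ccontr)
    assume "\<not> m < 2"
    then have "(2::real) \<le> of_int m" by simp
    then have "(real t - 1) * 2 \<le> (real t - 1) * of_int m"
      using assms(3) by (intro mult_left_mono) auto
    then show False using assms(2,3) by (simp add: m)
  qed
  then have "m = 0 \<or> m = 1" using m0 by auto
  then show ?thesis using m assms(4) by (auto simp: field_simps)
qed

lemma image_mset_two_values:
  assumes "S \<subseteq> {..d::nat}" "\<And>i. i \<in> S \<Longrightarrow> g i = a" "\<And>i. i \<le> d \<Longrightarrow> i \<notin> S \<Longrightarrow> g i = b"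
  shows "image_mset g (mset_set {..d}) = replicate_mset (card S) a + replicate_mset (d + 1 - card S) b"
proof -
  have fin: "finite S" using assms(1) finite_subset by blast
  have "mset_set {..d} = mset_set S + mset_set ({..d} - S)"
    using assms(1) fin by (subst mset_set_Union [symmetric]) (auto simp: Un_absorb1)
  moreover have "image_mset g (mset_set S) = replicate_mset (card S) a"
  proof -
    have "image_mset g (mset_set S) = image_mset (\<lambda>_. a) (mset_set S)"
      using assms(2) fin by (intro image_mset_cong) auto
    then show ?thesis by (simp add: image_mset_const_eq)
  qed
  moreover have "image_mset g (mset_set ({..d} - S)) = replicate_mset (d + 1 - card S) b"
  proof -
    have "image_mset g (mset_set ({..d} - S)) = image_mset (\<lambda>_. b) (mset_set ({..d} - S))"
      using assms(3) by (intro image_mset_cong) auto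
    also have "\<dots> = replicate_mset (card ({..d} - S)) b" by (simp add: image_mset_const_eq)
    also have "card ({..d} - S) = d + 1 - card S" using assms(1) fin by (simp add: card_Diff_subset)
    finally show ?thesis .
  qed
  ultimately show ?thesis by simp
qed

lemma frac_height_two_values:
  assumes "S \<subseteq> {..d::nat}" "\<And>i. i \<in> S \<Longrightarrow> frac (r i) = a" "\<And>i. i \<le> d \<Longrightarrow> i \<notin> S \<Longrightarrow> frac (r i) = b"
  shows "frac_height d r = real (card S) * a + real (d + 1 - card S) * b"
proof -
  have fin: "finite S" using assms(1) finite_subset by blast
  have "frac_height d r = (\<Sum>i\<in>S. frac (r i)) + (\<Sum>i\<in>{..d} - S. frac (r i))"
    unfolding frac_height_def using assms(1) by (simp add: sum.subset_diff)
  also have "(\<Sum>i\<in>S. frac (r i)) = real (card S) * a" using assms(2) by simp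
  also have "(\<Sum>i\<in>{..d} - S. frac (r i)) = real (card ({..d} - S)) * b" using assms(3) by simp
  also have "card ({..d} - S) = d + 1 - card S" using assms(1) fin by (simp add: card_Diff_subset)
  finally show ?thesis .
qed

lemma cyclic_mod_intI: "(\<And>i. i \<le> d \<Longrightarrow> r i - of_int j * g i \<in> \<int>) \<Longrightarrow> r \<in> cyclic_mod_int d g"
  unfolding cyclic_mod_int_def by blast

section \<open>Groups whose heights form an arithmetic progression\<close>

text \<open>
  What the \<open>\<delta>\<close>-polynomial says about the coefficient lattice: modulo integer vectors, \<open>L\<close> is a group on
  which the height is injective with values \<open>0, k, \<dots>, (N - 1) k\<close>.
\<close>

locale height_graded =
  fixes d N k :: nat and L :: "(nat \<Rightarrow> real) set"
  assumes k_pos: "k > 0"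
    and int_mem: "(\<And>i. i \<le> d \<Longrightarrow> r i \<in> \<int>) \<Longrightarrow> r \<in> L"
    and diff_mem: "r \<in> L \<Longrightarrow> s \<in> L \<Longrightarrow> (\<lambda>i. r i - s i) \<in> L"
    and height_values: "r \<in> L \<Longrightarrow> \<exists>j<N. frac_height d r = real (j * k)"
    and height_attained: "j < N \<Longrightarrow> \<exists>r\<in>L. frac_height d r = real (j * k)"
    and height_inj: "r \<in> L \<Longrightarrow> s \<in> L \<Longrightarrow> frac_height d r = frac_height d s \<Longrightarrow> i \<le> d \<Longrightarrow> r i - s i \<in> \<int>"
begin

definition initial_subgroup :: "nat \<Rightarrow> (nat \<Rightarrow> real) set \<Rightarrow> bool" where
  "initial_subgroup s H \<longleftrightarrow> H \<subseteq> L \<and> (\<forall>r. (\<forall>i\<le>d. r i \<in> \<int>) \<longrightarrow> r \<in> H) \<and>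
     (\<forall>a\<in>H. \<forall>b\<in>H. (\<lambda>i. a i - b i) \<in> H) \<and> frac_height d ` H = (\<lambda>j. real (j * k)) ` {..<s}"

lemma initial_subgroupD:
  assumes H: "initial_subgroup s H"
  shows "a \<in> H \<Longrightarrow> a \<in> L" and "(\<And>i. i \<le> d \<Longrightarrow> r i \<in> \<int>) \<Longrightarrow> r \<in> H"
    and "a \<in> H \<Longrightarrow> b \<in> H \<Longrightarrow> (\<lambda>i. a i - b i) \<in> H"
    and "a \<in> H \<Longrightarrow> \<exists>j<s. frac_height d a = real (j * k)"
    and "j < s \<Longrightarrow> \<exists>a\<in>H. frac_height d a = real (j * k)"
proof -
  have eq: "frac_height d ` H = (\<lambda>j. real (j * k)) ` {..<s}"
    using H by (simp add: initial_subgroup_def)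
  show "a \<in> H \<Longrightarrow> a \<in> L" "(\<And>i. i \<le> d \<Longrightarrow> r i \<in> \<int>) \<Longrightarrow> r \<in> H"
    "a \<in> H \<Longrightarrow> b \<in> H \<Longrightarrow> (\<lambda>i. a i - b i) \<in> H"
    using H by (auto simp: initial_subgroup_def)
  show "\<exists>j<s. frac_height d a = real (j * k)" if "a \<in> H"
  proof -
    have "frac_height d a \<in> (\<lambda>j. real (j * k)) ` {..<s}" using that eq by blast
    then show ?thesis by blast
  qed
  show "\<exists>a\<in>H. frac_height d a = real (j * k)" if "j < s"
  proof -
    have "real (j * k) \<in> frac_height d ` H" using that eq by blast
    then show ?thesis by force
  qed
qed

lemma initial_subgroup_self: "initial_subgroup N L"
proof -
  have "frac_height d ` L = (\<lambda>j. real (j * k)) ` {..<N}"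
  proof (intro equalityI subsetI)
    fix h assume "h \<in> frac_height d ` L"
    then show "h \<in> (\<lambda>j. real (j * k)) ` {..<N}" using height_values by blast
  next
    fix h assume "h \<in> (\<lambda>j. real (j * k)) ` {..<N}"
    then show "h \<in> frac_height d ` L" using height_attained by force
  qed
  then show ?thesis using int_mem diff_mem unfolding initial_subgroup_def by auto
qed

lemma add_closed:
  assumes "initial_subgroup s H" "a \<in> H" "b \<in> H"
  shows "(\<lambda>i. a i + b i) \<in> H"
proof -
  have "(\<lambda>i. 0 - b i) \<in> H"
    using initial_subgroupD(3)[OF assms(1), of "\<lambda>_. 0" b] initial_subgroupD(2)[OF assms(1), of "\<lambda>_. 0"] assms by simp
  from initial_subgroupD(3)[OF assms(1) assms(2) this] show ?thesis by simp
qed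

lemma mult_closed:
  assumes "initial_subgroup s H" "a \<in> H"
  shows "(\<lambda>i. real j * a i) \<in> H"
proof (induction j)
  case 0
  then show ?case using initial_subgroupD(2)[OF assms(1), of "\<lambda>_. 0"] by simp
next
  case (Suc j)
  from add_closed[OF assms(1) Suc assms(2)] show ?case by (simp add: algebra_simps)
qed

lemma initial_subgroup_ints: 
  assumes "N > 0" shows "initial_subgroup 1 {r. \<forall>i\<le>d. r i \<in> \<int>}"
proof -
  have "frac_height d r = 0" if "\<forall>i\<le>d. r i \<in> \<int>" for r
    using that by (auto simp: frac_height_def intro!: sum.neutral)
  then have "frac_height d ` {r. \<forall>i\<le>d. r i \<in> \<int>} = {0}"
    by (auto simp: image_iff intro!: exI[of _ "\<lambda>_. 0"])
  then show ?thesis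
    unfolding initial_subgroup_def by (auto intro: int_mem)
qed

lemma initial_subgroup_le: assumes "initial_subgroup s H" shows "s \<le> N"
proof -
  have "s - 1 < N" if pos: "s > 0"
  proof -
    obtain a where "a \<in> H" "frac_height d a = real ((s - 1) * k)"
      using initial_subgroupD(5)[OF assms, of "s - 1"] pos by auto
    with initial_subgroupD(1)[OF assms] height_values show ?thesis
      using k_pos by (metis mult_cancel2 of_nat_eq_iff bot_nat_0.not_eq_extremum)
  qed
  then show ?thesis by linarith
qed

lemma initial_subgroup_full: assumes "initial_subgroup N H" shows "H = L"
proof
  show "H \<subseteq> L" using initial_subgroupD(1)[OF assms] by blast
  show "L \<subseteq> H"
  proof
    fix r assume r: "r \<in> L"
    obtain a where a: "a \<in> H" "frac_height d r = frac_height d a"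
      using height_values[OF r] initial_subgroupD(5)[OF assms] by metis
    have "(\<lambda>i. r i - a i) \<in> H"
      using height_inj[OF r initial_subgroupD(1)[OF assms a(1)] a(2)] by (intro initial_subgroupD(2)[OF assms]) auto
    from add_closed[OF assms this a(1)] show "r \<in> H" by simp
  qed
qed

text \<open>
  One digit of the mixed radix expansion. The expected height of \<open>a + j z\<close> is \<open>n k\<close> with
  \<open>n = j s + m\<close>, where \<open>m k\<close> is the height of \<open>a\<close>. By induction on \<open>n\<close> it is attained: a smaller
  height \<open>n' k\<close> already belongs to the element of index \<open>n'\<close>, and by injectivity of the height the two
  elements would agree modulo integer vectors, contrary to the minimality of \<open>t\<close>.
\<close>

lemma radix_step:
  assumes H: "initial_subgroup s H" and "s < N"
  obtains z t where "z \<in> L" "frac_height d z = real (s * k)" "t \<ge> 2" "(\<lambda>i. real t * z i) \<in> H"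
    "\<And>a j i. a \<in> H \<Longrightarrow> j < t \<Longrightarrow> i \<le> d \<Longrightarrow> frac (a i + real j * z i) = frac (a i) + real j * frac (z i)"
    "initial_subgroup (t * s) {\<lambda>i. a i + real j * z i | a j. a \<in> H \<and> j < t}"
proof -
  note L = initial_subgroup_self
  obtain z where z: "z \<in> L" "frac_height d z = real (s * k)"
    using height_attained[OF \<open>s < N\<close>] by blast
  have zH: "z \<notin> H"
    using initial_subgroupD(4)[OF H, of z] k_pos z(2) by (metis less_irrefl mult_cancel2 of_nat_eq_iff bot_nat_0.not_eq_extremum)
  have s0: "s > 0" using initial_subgroupD(2)[OF H, of "\<lambda>_. 0"] initial_subgroupD(4)[OF H, of "\<lambda>_. 0"] by fastforce
  have ex: "\<exists>t>0. (\<lambda>i. real t * z i) \<in> H"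
  proof -
    \<comment> \<open>pigeonhole: the multiples of \<open>z\<close> have only \<open>N\<close> possible heights\<close>
    have "card ((\<lambda>j. frac_height d (\<lambda>i. real j * z i)) ` {..N}) \<le> card ((\<lambda>j. real (j * k)) ` {..<N})"
      using height_values[OF mult_closed[OF L z(1)]] by (intro card_mono) auto
    also have "\<dots> \<le> card {..<N}" by (rule card_image_le) simp
    finally have "\<not> inj_on (\<lambda>j. frac_height d (\<lambda>i. real j * z i)) {..N}"
      using card_image by fastforce
    then obtain j l where jl: "j < l" "frac_height d (\<lambda>i. real l * z i) = frac_height d (\<lambda>i. real j * z i)"
      unfolding inj_on_def by (metis linorder_neqE_nat)
    have "(\<lambda>i. real (l - j) * z i) \<in> H"
      using height_inj[OF mult_closed[OF L z(1)] mult_closed[OF L z(1)] jl(2)] jl(1)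
      by (intro initial_subgroupD(2)[OF H]) (auto simp: of_nat_diff left_diff_distrib)
    then show ?thesis using jl(1) by (intro exI[of _ "l - j"]) auto
  qed
  define t where "t = (LEAST t. t > 0 \<and> (\<lambda>i. real t * z i) \<in> H)"
  have t: "t > 0" "(\<lambda>i. real t * z i) \<in> H"
    using LeastI_ex[OF ex] unfolding t_def by auto
  have tmin: "j = 0" if "j < t" "(\<lambda>i. real j * z i) \<in> H" for j
    using not_less_Least[of j "\<lambda>t. t > 0 \<and> (\<lambda>i. real t * z i) \<in> H"] that unfolding t_def by auto
  have t2: "t \<ge> 2" using t zH by (cases "t = 1") auto
  have mem: "(\<lambda>i. a i + real j * z i) \<in> L" if "a \<in> H" for a j
    by (intro add_closed[OF L] mult_closed[OF L] z(1) initial_subgroupD(1)[OF H that])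
  have heights: "frac_height d (\<lambda>i. a i + real j * z i) = real (n * k)"
    if "a \<in> H" "j < t" "frac_height d a = real (m * k)" "m < s" "n = j * s + m" for n a j m
    using that
  proof (induction n arbitrary: a j m rule: less_induct)
    case (less n)
    have "frac_height d (\<lambda>i. a i + real j * z i) \<le> real (n * k)"
      using frac_height_add_mult_le[of d a j z] less.prems z(2) by (simp add: algebra_simps)
    moreover obtain n' where n': "n' < N" "frac_height d (\<lambda>i. a i + real j * z i) = real (n' * k)"
      using height_values[OF mem[OF less.prems(1)]] by blast
    ultimately have "n' \<le> n" using k_pos by simp
    moreover have False if "n' < n"
    proof -
      define j' m' where "j' = n' div s" and "m' = n' mod s"
      have n'_eq: "n' = j' * s + m'" and "m' < s" using s0 by (auto simp: j'_def m'_def)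
      have "j' * s < (j + 1) * s" using that n'_eq less.prems(4,5) by simp
      then have "j' \<le> j" by (metis Suc_eq_plus1 less_Suc_eq_le mult_less_cancel2)
      obtain a' where a': "a' \<in> H" "frac_height d a' = real (m' * k)"
        using initial_subgroupD(5)[OF H \<open>m' < s\<close>] by blast
      have "frac_height d (\<lambda>i. a' i + real j' * z i) = real (n' * k)"
        using less.IH[OF that a'(1) _ a'(2) \<open>m' < s\<close> n'_eq] \<open>j' \<le> j\<close> less.prems(2) by simp
      with n' have eq: "frac_height d (\<lambda>i. a i + real j * z i) = frac_height d (\<lambda>i. a' i + real j' * z i)" by simp
      have diff: "(a i + real j * z i) - (a' i + real j' * z i) \<in> \<int>" if "i \<le> d" for i
        by (rule height_inj[OF mem[OF less.prems(1)] mem[OF a'(1)] eq that])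
      have "(\<lambda>i. ((a i + real j * z i) - (a' i + real j' * z i)) - (a i - a' i)) \<in> H"
        using diff by (intro initial_subgroupD(3)[OF H] initial_subgroupD(2)[OF H, of "\<lambda>i. _ i - _ i"] less.prems a'(1)) auto
      then have "(\<lambda>i. real (j - j') * z i) \<in> H"
        using \<open>j' \<le> j\<close> by (simp add: of_nat_diff left_diff_distrib)
      then have "j = j'" using tmin[of "j - j'"] less.prems(2) \<open>j' \<le> j\<close> by auto
      with diff have "frac_height d a = frac_height d a'" by (intro frac_height_cong) auto
      then have "m = m'" using a'(2) less.prems(3) k_pos by (metis bot_nat_0.not_eq_extremum mult_cancel2 of_nat_eq_iff)
      then show False using n'_eq less.prems(5) \<open>j = j'\<close> that by simp
    qed
    ultimately show ?case using n'(2) by (metis le_neq_implies_less)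
  qed
  define H' where "H' = {\<lambda>i. a i + real j * z i | a j. a \<in> H \<and> j < t}"
  have H'I: "(\<lambda>i. a i + real j * z i) \<in> H'" if "a \<in> H" "j < t" for a j
    unfolding H'_def using that by blast
  have "initial_subgroup (t * s) H'"
    unfolding initial_subgroup_def
  proof (intro conjI allI impI ballI)
    show "H' \<subseteq> L" using mem by (auto simp: H'_def)
    show "r \<in> H'" if "\<forall>i\<le>d. r i \<in> \<int>" for r
    proof -
      have "r \<in> H" using that by (intro initial_subgroupD(2)[OF H]) auto
      then show ?thesis using H'I[of r 0] t(1) by simp
    qed
    show "(\<lambda>i. x i - y i) \<in> H'" if xy: "x \<in> H'" "y \<in> H'" for x y
    proof -
      obtain a j b l where x: "x = (\<lambda>i. a i + real j * z i)" "a \<in> H" "j < t"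
        and y: "y = (\<lambda>i. b i + real l * z i)" "b \<in> H" "l < t"
        using xy unfolding H'_def by blast
      note ab = initial_subgroupD(3)[OF H x(2) y(2)]
      show ?thesis
      proof (cases "l \<le> j")
        case True
        then have "(\<lambda>i. x i - y i) = (\<lambda>i. (a i - b i) + real (j - l) * z i)"
          by (auto simp: x y of_nat_diff algebra_simps)
        moreover have "j - l < t" using x(3) by simp
        ultimately show ?thesis using ab H'I by simp
      next
        case False
        \<comment> \<open>borrow: \<open>t * z\<close> lies in \<open>H\<close>\<close>
        then have "(\<lambda>i. x i - y i) = (\<lambda>i. ((a i - b i) - real t * z i) + real (t + j - l) * z i)"
        proof -
          have "real (t + j - l) = real t + real j - real l" using y(3) by simp
          then show ?thesis by (auto simp: x y algebra_simps)
        qed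
        moreover have "t + j - l < t" using x(3) False by simp
        ultimately show ?thesis using H'I[OF initial_subgroupD(3)[OF H ab t(2)]] by simp
      qed
    qed
    show "frac_height d ` H' = (\<lambda>j. real (j * k)) ` {..<t * s}"
    proof (intro equalityI subsetI)
      fix h assume "h \<in> frac_height d ` H'"
      then obtain a j where aj: "a \<in> H" "j < t" "h = frac_height d (\<lambda>i. a i + real j * z i)"
        unfolding H'_def by blast
      obtain m where m: "m < s" "frac_height d a = real (m * k)" using initial_subgroupD(4)[OF H aj(1)] by blast
      have "h = real ((j * s + m) * k)" using heights[OF aj(1,2) m(2,1) refl] aj(3) by simp
      moreover have "j * s + m < t * s"
      proof -
        have "j * s + m < (j + 1) * s" using m(1) by simp
        also have "\<dots> \<le> t * s" using aj(2) by (intro mult_right_mono) auto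
        finally show ?thesis .
      qed
      ultimately show "h \<in> (\<lambda>j. real (j * k)) ` {..<t * s}" by blast
    next
      fix h assume "h \<in> (\<lambda>j. real (j * k)) ` {..<t * s}"
      then obtain n where n: "n < t * s" "h = real (n * k)" by blast
      have "n div s < t" using n(1) s0 by (simp add: less_mult_imp_div_less)
      moreover obtain a where a: "a \<in> H" "frac_height d a = real ((n mod s) * k)"
        using initial_subgroupD(5)[OF H, of "n mod s"] s0 by auto
      ultimately have "frac_height d (\<lambda>i. a i + real (n div s) * z i) = h"
        using heights[of a "n div s" "n mod s" n] n s0 by simp
      then show "h \<in> frac_height d ` H'" using H'I[OF a(1) \<open>n div s < t\<close>] by blast
    qed
  qed
  moreover have "frac (a i + real j * z i) = frac (a i) + real j * frac (z i)" if asm: "a \<in> H" "j < t" "i \<le> d" for a j i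
  proof -
    obtain m where m: "m < s" "frac_height d a = real (m * k)" using initial_subgroupD(4)[OF H asm(1)] by blast
    show ?thesis
      using heights[OF asm(1,2) m(2,1) refl] m(2) z(2) asm(3)
      by (intro frac_add_mult_eq_of_height_eq[of d]) (auto simp: algebra_simps)
  qed
  ultimately show ?thesis using that[OF z t2 t(2)] unfolding H'_def by blast
qed

text \<open>
  Repeating the radix step multiplies \<open>s\<close> by integer factors until it reaches \<open>N\<close>.
\<close>

lemma initial_subgroup_dvd:
  assumes "initial_subgroup s H" shows "s dvd N"
  using assms
proof (induction "N - s" arbitrary: s H rule: less_induct)
  case less
  show ?case
  proof (cases "s = N")
    case False
    then have "s < N" using initial_subgroup_le[OF less.prems] by simp
    obtain t H' where "t \<ge> 2" "initial_subgroup (t * s) H'"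
      by (rule radix_step[OF less.prems \<open>s < N\<close>]) (rule that, assumption+)
    have "s > 0" using initial_subgroupD(2)[OF less.prems, of "\<lambda>_. 0"] initial_subgroupD(4)[OF less.prems, of "\<lambda>_. 0"] by fastforce
    have "1 * s < t * s" using \<open>t \<ge> 2\<close> \<open>s > 0\<close> by (intro mult_strict_right_mono) auto
    then have "N - t * s < N - s" using \<open>s < N\<close> by (intro diff_less_mono2) auto
    from less.hyps[OF this \<open>initial_subgroup (t * s) H'\<close>] show ?thesis by (rule dvd_mult_right)
  qed simp
qed

lemma cyclic_mod_int_subset:
  assumes "g \<in> L" shows "cyclic_mod_int d g \<subseteq> L"
proof
  fix r assume "r \<in> cyclic_mod_int d g"
  then obtain j :: int where j: "\<And>i. i \<le> d \<Longrightarrow> r i - of_int j * g i \<in> \<int>"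
    unfolding cyclic_mod_int_def by blast
  note L = initial_subgroup_self
  have "(\<lambda>i. of_int j * g i) \<in> L"
  proof (cases "j \<ge> 0")
    case True
    then show ?thesis using mult_closed[OF L assms, of "nat j"] by simp
  next
    case False
    then show ?thesis
      using diff_mem[OF int_mem mult_closed[OF L assms, of "nat (- j)"], of "\<lambda>_. 0"] by simp
  qed
  from add_closed[OF L int_mem[of "\<lambda>i. r i - of_int j * g i"] this] j show "r \<in> L" by simp
qed

text \<open>
  The radix step from the group of integer vectors. Since \<open>t - 1\<close> multiples of \<open>y\<close> add without carry, its
  nonzero fractional parts are \<open>1 / t\<close>, and their number is determined by the height \<open>k\<close>.
\<close>

lemma first_digit:
  assumes "N > 1"
  obtains y t where "y \<in> L" "t \<ge> 2" "t dvd N" "initial_subgroup t {r. \<exists>j<t. \<forall>i\<le>d. r i - real j * y i \<in> \<int>}"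
    "\<And>i. i \<le> d \<Longrightarrow> frac (y i) = 0 \<or> frac (y i) = 1 / real t"
    "card {i. i \<le> d \<and> frac (y i) \<noteq> 0} = t * k"
proof -
  let ?Z = "{r. \<forall>i\<le>d. r i \<in> \<int>}"
  have Z: "initial_subgroup 1 ?Z" by (rule initial_subgroup_ints) (use assms in simp)
  obtain y t where y: "y \<in> L" "frac_height d y = real (1 * k)" "t \<ge> 2" "(\<lambda>i. real t * y i) \<in> ?Z"
    "\<And>a j i. a \<in> ?Z \<Longrightarrow> j < t \<Longrightarrow> i \<le> d \<Longrightarrow> frac (a i + real j * y i) = frac (a i) + real j * frac (y i)"
    "initial_subgroup (t * 1) {\<lambda>i. a i + real j * y i | a j. a \<in> ?Z \<and> j < t}"
    by (rule radix_step[OF Z]) (use assms in simp, rule that, assumption+)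
  have eq: "{\<lambda>i. a i + real j * y i | a j. a \<in> ?Z \<and> j < t} = {r. \<exists>j<t. \<forall>i\<le>d. r i - real j * y i \<in> \<int>}"
  proof (intro equalityI subsetI)
    fix r assume "r \<in> {r. \<exists>j<t. \<forall>i\<le>d. r i - real j * y i \<in> \<int>}"
    then obtain j where "j < t" "\<forall>i\<le>d. r i - real j * y i \<in> \<int>" by blast
    then show "r \<in> {\<lambda>i. a i + real j * y i | a j. a \<in> ?Z \<and> j < t}"
      by (intro CollectI exI[of _ "\<lambda>i. r i - real j * y i"] exI[of _ j]) simp
  qed auto
  have digit: "frac (y i) = 0 \<or> frac (y i) = 1 / real t" if "i \<le> d" for i
  proof (rule frac_eq_unit_fraction)
    show "real t * y i \<in> \<int>" using y(4) that by simp
    have "(real t - 1) * frac (y i) < 1"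
      using y(5)[of "\<lambda>_. 0" "t - 1" i] that y(3) frac_lt_1[of "real (t - 1) * y i"] by (simp add: of_nat_diff)
    then have "real t * ((real t - 1) * frac (y i)) < real t * 1"
      using y(3) by (intro mult_strict_left_mono) auto
    then show "(real t - 1) * (real t * frac (y i)) < real t" by (simp add: mult_ac)
  qed (use y(3) in auto)
  define S where "S = {i. i \<le> d \<and> frac (y i) \<noteq> 0}"
  have "frac_height d y = real (card S) * (1 / real t) + real (d + 1 - card S) * 0"
    by (rule frac_height_two_values) (use digit in \<open>auto simp: S_def\<close>)
  then have "real (card S) = real (t * k)" using y(2,3) by (simp add: field_simps)
  then have "card S = t * k" by (simp only: of_nat_eq_iff)
  then show ?thesis
    using that[of y t] y(1,3) initial_subgroup_dvd[OF y(6)] y(6) digit unfolding eq S_def by simp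
qed

text \<open>
  The radix step after a first digit of order \<open>p\<close>; the order of the second digit must be \<open>q\<close>. Coordinates
  that vanish on \<open>y\<close> cannot vanish on \<open>z\<close> as well, since \<open>y\<close> and \<open>z\<close> generate the group and no coordinate
  vanishes on it. On the
  other coordinates, \<open>n\<close> is the same everywhere because \<open>q z\<close> is congruent to a single multiple \<open>m y\<close>,
  and \<open>n = 0\<close> exactly if \<open>m = 0\<close>.
\<close>

lemma second_digit:
  assumes pq: "prime p" "prime q" "p \<noteq> q" and N: "N = p * q"
    and H: "initial_subgroup p {r. \<exists>j<p. \<forall>i\<le>d. r i - real j * y i \<in> \<int>}"
    and y: "\<And>i. i \<le> d \<Longrightarrow> frac (y i) = 0 \<or> frac (y i) = 1 / real p"
    and full: "\<And>i. i \<le> d \<Longrightarrow> \<exists>r\<in>L. r i \<notin> \<int>"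
  obtains z n where "z \<in> L" "frac_height d z = real (p * k)" "n = 0 \<or> n = (1::nat)"
    "\<And>i. i \<le> d \<Longrightarrow> frac (y i) \<noteq> 0 \<Longrightarrow> frac (z i) = real n / real (p * q)"
    "\<And>i. i \<le> d \<Longrightarrow> frac (y i) = 0 \<Longrightarrow> frac (z i) = 1 / real q"
    "\<And>r. r \<in> L \<Longrightarrow> \<exists>j l. \<forall>i\<le>d. r i - (real j * y i + real l * z i) \<in> \<int>"
proof -
  let ?H = "{r. \<exists>j<p. \<forall>i\<le>d. r i - real j * y i \<in> \<int>}"
  have p2: "p \<ge> 2" and q2: "q \<ge> 2" using pq prime_ge_2_nat by auto
  have "p < N" using p2 q2 by (simp add: N)
  obtain z t where z: "z \<in> L" "frac_height d z = real (p * k)" "t \<ge> 2" "(\<lambda>i. real t * z i) \<in> ?H"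
    "\<And>a j i. a \<in> ?H \<Longrightarrow> j < t \<Longrightarrow> i \<le> d \<Longrightarrow> frac (a i + real j * z i) = frac (a i) + real j * frac (z i)"
    "initial_subgroup (t * p) {\<lambda>i. a i + real j * z i | a j. a \<in> ?H \<and> j < t}"
    by (rule radix_step[OF H \<open>p < N\<close>]) (rule that, assumption+)
  have "t * p dvd q * p" using initial_subgroup_dvd[OF z(6)] by (simp add: N mult.commute)
  then have "t dvd q" using p2 by simp
  then have tq: "t = q" using pq(2) z(3) by (metis One_nat_def not_less_eq_eq numeral_2_eq_2 prime_nat_iff order_refl)
  have L_eq: "{\<lambda>i. a i + real j * z i | a j. a \<in> ?H \<and> j < q} = L"
    using initial_subgroup_full z(6) by (simp add: tq N mult.commute)
  obtain m where m: "m < p" "\<And>i. i \<le> d \<Longrightarrow> real q * z i - real m * y i \<in> \<int>"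
    using z(4) by (auto simp: tq)
  have rep: "\<exists>j l. \<forall>i\<le>d. r i - (real j * y i + real l * z i) \<in> \<int>" if r: "r \<in> L" for r
  proof -
    obtain a j l where "r = (\<lambda>i. a i + real l * z i)" "\<forall>i\<le>d. a i - real j * y i \<in> \<int>"
      using r unfolding L_eq [symmetric] by blast
    then show ?thesis by (intro exI[of _ j] exI[of _ l]) (simp add: algebra_simps)
  qed
  \<comment> \<open>the largest first digit \<open>p - 1\<close> and the largest second digit \<open>q - 1\<close> still add without carry\<close>
  have carry: "(real p - 1) * frac (y i) + (real q - 1) * frac (z i) < 1" if i: "i \<le> d" for i
  proof -
    have mem: "(\<lambda>i. real (p - 1) * frac (y i)) \<in> ?H"
      using p2 by (intro CollectI exI[of _ "p - 1"]) (auto simp: frac_def algebra_simps)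
    have "0 \<le> real (p - 1) * frac (y i) \<and> real (p - 1) * frac (y i) < 1"
    proof (cases "frac (y i) = 0")
      case True
      show ?thesis by (simp only: True) simp
    next
      case False
      then have "frac (y i) = 1 / real p" using y[OF i] by blast
      then show ?thesis using p2 by (simp only:) (simp add: of_nat_diff field_simps)
    qed
    then have "frac (real (p - 1) * frac (y i)) = real (p - 1) * frac (y i)"
      by (simp only: frac_eq)
    with z(5)[OF mem _ i, of "q - 1"] show ?thesis
      using q2 p2 frac_lt_1[of "real (p - 1) * frac (y i) + real (q - 1) * z i"] by (simp add: tq of_nat_diff)
  qed
  have off: "frac (z i) = 1 / real q" if i: "i \<le> d" "frac (y i) = 0" for i
  proof -
    have yi: "y i \<in> \<int>" using i(2) by simp
    have "frac (z i) = 0 \<or> frac (z i) = 1 / real q"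
    proof (rule frac_eq_unit_fraction)
      have "real q * z i = (real q * z i - real m * y i) + real m * y i" by simp
      also have "\<dots> \<in> \<int>" using yi by (intro Ints_add[OF m(2)[OF i(1)]] Ints_mult) auto
      finally show "real q * z i \<in> \<int>" .
      have "real q * ((real q - 1) * frac (z i)) < real q * 1"
        using carry[OF i(1)] i(2) q2 by (intro mult_strict_left_mono) auto
      then show "(real q - 1) * (real q * frac (z i)) < real q" by (simp add: mult_ac)
    qed (use q2 in auto)
    moreover have False if zi: "frac (z i) = 0"
    proof -
      obtain r where r: "r \<in> L" "r i \<notin> \<int>" using full[OF i(1)] by blast
      obtain j l where "r i - (real j * y i + real l * z i) \<in> \<int>" using rep[OF r(1)] i(1) by blast
      moreover have "real j * y i + real l * z i \<in> \<int>" using zi yi by (intro Ints_add Ints_mult) auto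
      ultimately have "r i \<in> \<int>" using Ints_add by fastforce
      then show False using r(2) by simp
    qed
    ultimately show ?thesis by blast
  qed
  define n where "n = (if m = 0 then 0 else 1 :: nat)"
  have on: "frac (z i) = real n / real (p * q)" if i: "i \<le> d" "frac (y i) \<noteq> 0" for i
  proof -
    have yi: "frac (y i) = 1 / real p" using y i by blast
    have y_eq: "y i = of_int \<lfloor>y i\<rfloor> + 1 / real p" using yi by (simp add: frac_def)
    have z_eq: "z i = of_int \<lfloor>z i\<rfloor> + frac (z i)" by (simp add: frac_def)
    have int: "real q * frac (z i) - real m / real p \<in> \<int>"
    proof -
      have "real q * frac (z i) - real m / real p =
          (real q * z i - real m * y i) - of_int (int q * \<lfloor>z i\<rfloor>) + of_int (int m * \<lfloor>y i\<rfloor>)"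
        by (subst y_eq) (simp add: frac_def algebra_simps)
      also have "\<dots> \<in> \<int>" by (rule Ints_add[OF Ints_diff[OF m(2)[OF i(1)] Ints_of_int] Ints_of_int])
      finally show ?thesis .
    qed
    have cases: "frac (z i) = 0 \<or> frac (z i) = 1 / real (p * q)"
    proof (rule frac_eq_unit_fraction)
      have "real (p * q) * z i = real p * (real q * frac (z i) - real m / real p) + real m + of_int (int (p * q) * \<lfloor>z i\<rfloor>)"
        using p2 by (simp add: frac_def algebra_simps)
      also have "\<dots> \<in> \<int>" by (intro Ints_add[OF Ints_add[OF Ints_mult[OF Ints_of_nat int]]]) auto
      finally show "real (p * q) * z i \<in> \<int>" .
      have "real (p * q) * ((real p - 1) * (1 / real p) + (real q - 1) * frac (z i)) < real (p * q) * 1"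
        using carry[OF i(1)] yi p2 q2 by (intro mult_strict_left_mono) auto
      then have "real (p * q) * ((real p - 1) * (1 / real p)) + real (p * q) * ((real q - 1) * frac (z i)) < real (p * q)"
        by (simp only: distrib_left mult_1_right)
      moreover have "real (p * q) * ((real p - 1) * (1 / real p)) = real (p * q) - real q"
        using p2 by (simp add: field_simps)
      ultimately show "(real q - 1) * (real (p * q) * frac (z i)) < real q"
        by (simp add: mult_ac)
    qed (use p2 q2 in auto)
    have not_int: "real c / real p \<notin> \<int>" if "0 < c" "c < p" for c
    proof
      assume "real c / real p \<in> \<int>"
      then obtain u :: int where u: "real c / real p = of_int u" by (elim Ints_cases)
      have "0 < real c / real p" "real c / real p < 1" using that by auto
      then show False unfolding u by simp
    qed
    show ?thesis
    proof (cases "m = 0")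
      case True
      have "frac (z i) \<noteq> 1 / real (p * q)"
      proof
        assume "frac (z i) = 1 / real (p * q)"
        then have "real q * frac (z i) = 1 / real p" using q2 by simp
        then show False using int True not_int[of 1] p2 by simp
      qed
      then show ?thesis using cases True by (simp add: n_def)
    next
      case False
      have "frac (z i) \<noteq> 0"
      proof
        assume "frac (z i) = 0"
        then have "- (real m / real p) \<in> \<int>" using int by simp
        then show False using not_int[of m] False m(1) by simp
      qed
      then show ?thesis using cases False by (simp add: n_def)
    qed
  qed
  show ?thesis by (rule that[OF z(1,2) _ on off rep]) (auto simp: n_def)
qed

text \<open>
  If \<open>z\<close> vanishes on the support of \<open>y\<close>, then \<open>y + z\<close> generates by the Chinese remainder theorem.
  Otherwise \<open>y\<close> is congruent to \<open>q z\<close>, so \<open>z\<close> generates. The height \<open>p k\<close> of \<open>z\<close> determines the number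
  of coordinates off the support.
\<close>

lemma cyclic_of_two_digits:
  assumes pq: "prime p" "prime q" "p \<noteq> q" and N: "N = p * q"
    and yL: "y \<in> L"
    and H: "initial_subgroup p {r. \<exists>j<p. \<forall>i\<le>d. r i - real j * y i \<in> \<int>}"
    and y: "\<And>i. i \<le> d \<Longrightarrow> frac (y i) = 0 \<or> frac (y i) = 1 / real p"
    and card: "card {i. i \<le> d \<and> frac (y i) \<noteq> 0} = p * k"
    and full: "\<And>i. i \<le> d \<Longrightarrow> \<exists>r\<in>L. r i \<notin> \<int>"
  shows "\<exists>g. L = cyclic_mod_int d g \<and>
     (image_mset g (mset_set {..d}) = replicate_mset (p * k) (1 / real p) + replicate_mset (p * q * k) (1 / real q) \<or>
      image_mset g (mset_set {..d}) = replicate_mset (p * k) (1 / (real p * real q)) + replicate_mset ((p * q - 1) * k) (1 / real q))"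
proof -
  note L = initial_subgroup_self
  have p2: "p \<ge> 2" and q2: "q \<ge> 2" using pq prime_ge_2_nat by auto
  define S where "S = {i. i \<le> d \<and> frac (y i) \<noteq> 0}"
  have S: "S \<subseteq> {..d}" "card S = p * k" using card by (auto simp: S_def)
  have yS: "y i - 1 / real p \<in> \<int>" if "i \<in> S" for i
    using that y[of i] frac_unique_iff[of "y i" "1 / real p"] p2 by (auto simp: S_def)
  have y_off: "y i \<in> \<int>" if "i \<le> d" "i \<notin> S" for i using that by (simp add: S_def)
  obtain z n where z: "z \<in> L" "frac_height d z = real (p * k)" "n = 0 \<or> n = (1::nat)"
    "\<And>i. i \<le> d \<Longrightarrow> frac (y i) \<noteq> 0 \<Longrightarrow> frac (z i) = real n / real (p * q)"
    "\<And>i. i \<le> d \<Longrightarrow> frac (y i) = 0 \<Longrightarrow> frac (z i) = 1 / real q"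
    "\<And>r. r \<in> L \<Longrightarrow> \<exists>j l. \<forall>i\<le>d. r i - (real j * y i + real l * z i) \<in> \<int>"
    by (rule second_digit[OF pq N H y full]) (assumption | rule that)+
  have zS: "z i - real n / real (p * q) \<in> \<int>" if "i \<in> S" for i
    using that z(4)[of i] frac_unique_iff[of "z i" "real n / real (p * q)"] by (auto simp: S_def)
  have z_off: "z i - 1 / real q \<in> \<int>" if "i \<le> d" "i \<notin> S" for i
    using that z(5)[of i] frac_unique_iff[of "z i" "1 / real q"] by (auto simp: S_def)
  have "frac_height d z = real (card S) * (real n / real (p * q)) + real (d + 1 - card S) * (1 / real q)"
    by (rule frac_height_two_values[OF S(1)]) (use z(4,5) in \<open>auto simp: S_def\<close>)
  then have "real (p * k) * real q = real (n * k) + real (d + 1 - p * k)"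
    using z(2) p2 q2 unfolding S(2) by (simp add: field_simps)
  then have count: "p * q * k = n * k + (d + 1 - p * k)"
    by (metis of_nat_add of_nat_mult of_nat_eq_iff mult.assoc mult.commute)
  from z(3) show ?thesis
  proof
    assume n: "n = 0"
    define g where "g i = (if i \<in> S then 1 / real p else 1 / real q)" for i
    have "(\<lambda>i. y i + z i) \<in> L" by (rule add_closed[OF L yL z(1)])
    moreover have gyz: "g i - (y i + z i) \<in> \<int>" if "i \<le> d" for i
    proof (cases "i \<in> S")
      case True
      have "g i - (y i + z i) = - (y i - 1 / real p) - z i" using True by (simp add: g_def)
      also have "\<dots> \<in> \<int>" using zS[OF True] n by (intro Ints_diff[OF Ints_minus[OF yS[OF True]]]) simp
      finally show ?thesis .
    next
      case False
      have "g i - (y i + z i) = - (z i - 1 / real q) - y i" using False by (simp add: g_def)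
      also have "\<dots> \<in> \<int>" by (rule Ints_diff[OF Ints_minus[OF z_off[OF that False]] y_off[OF that False]])
      finally show ?thesis .
    qed
    ultimately have "g \<in> L"
      using add_closed[OF L int_mem[of "\<lambda>i. g i - (y i + z i)"], of "\<lambda>i. y i + z i"] by simp
    moreover have "L \<subseteq> cyclic_mod_int d g"
    proof
      fix r assume "r \<in> L"
      then obtain j l where jl: "\<forall>i\<le>d. r i - (real j * y i + real l * z i) \<in> \<int>" using z(6) by blast
      have "coprime p q" using pq primes_coprime by blast
      then obtain c where "[c = j] (mod p)" "[c = l] (mod q)"
        using binary_chinese_remainder_nat by blast
      then have "int p dvd int c - int j" "int q dvd int c - int l"
        by (simp_all add: cong_iff_dvd_diff flip: cong_int_iff)
      then obtain u w where u: "int c - int j = int p * u" and w: "int c - int l = int q * w" by (auto elim!: dvdE)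
      have u': "real c - real j = real p * of_int u" and w': "real c - real l = real q * of_int w"
        using u w by (metis of_int_diff of_int_mult of_int_of_nat_eq)+
      show "r \<in> cyclic_mod_int d g"
      proof (rule cyclic_mod_intI[of _ _ "int c"])
        fix i assume i: "i \<le> d"
        have "real j * y i + real l * z i - real c * g i \<in> \<int>"
        proof (cases "i \<in> S")
          case True
          have "real j * y i + real l * z i - real c * g i = real j * (y i - 1 / real p) + real l * z i - of_int u"
            using True p2 u' by (simp add: g_def field_simps)
          also have "\<dots> \<in> \<int>" using zS[OF True] n
            by (intro Ints_diff[OF Ints_add[OF Ints_mult[OF Ints_of_nat yS[OF True]] Ints_mult[OF Ints_of_nat]] Ints_of_int]) simp
          finally show ?thesis .
        next
          case False
          have "real j * y i + real l * z i - real c * g i = real j * y i + real l * (z i - 1 / real q) - of_int w"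
            using False q2 w' by (simp add: g_def field_simps)
          also have "\<dots> \<in> \<int>"
            by (rule Ints_diff[OF Ints_add[OF Ints_mult[OF Ints_of_nat y_off[OF i False]]
                  Ints_mult[OF Ints_of_nat z_off[OF i False]]] Ints_of_int])
          finally show ?thesis .
        qed
        then have "(r i - (real j * y i + real l * z i)) + (real j * y i + real l * z i - real c * g i) \<in> \<int>"
          using jl i by (intro Ints_add) auto
        then show "r i - of_int (int c) * g i \<in> \<int>" by simp
      qed
    qed
    moreover have "image_mset g (mset_set {..d}) = replicate_mset (p * k) (1 / real p) + replicate_mset (p * q * k) (1 / real q)"
      using image_mset_two_values[OF S(1), of g "1 / real p" "1 / real q"] S(2) count n by (simp add: g_def)
    ultimately show ?thesis using cyclic_mod_int_subset by blast
  next
    assume n: "n = 1"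
    define g where "g i = (if i \<in> S then 1 / (real p * real q) else 1 / real q)" for i
    have gz: "g i - z i \<in> \<int>" if "i \<le> d" for i
    proof -
      have "- (z i - g i) \<in> \<int>" using that zS[of i] z_off[of i] n by (intro Ints_minus) (auto simp: g_def)
      then show ?thesis by simp
    qed
    then have "g \<in> L"
      using add_closed[OF L int_mem[of "\<lambda>i. g i - z i"] z(1)] by simp
    moreover have "L \<subseteq> cyclic_mod_int d g"
    proof
      fix r assume "r \<in> L"
      then obtain j l where jl: "\<forall>i\<le>d. r i - (real j * y i + real l * z i) \<in> \<int>" using z(6) by blast
      show "r \<in> cyclic_mod_int d g"
      proof (rule cyclic_mod_intI[of _ _ "int (j * q + l)"])
        fix i assume i: "i \<le> d"
        have "y i - real q * g i \<in> \<int>"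
        proof (cases "i \<in> S")
          case True then show ?thesis using yS q2 by (simp add: g_def)
        next
          case False then show ?thesis using y_off[OF i] q2 by (simp add: g_def)
        qed
        then have "(r i - (real j * y i + real l * z i)) + real j * (y i - real q * g i) - real l * (g i - z i) \<in> \<int>"
          using jl i by (intro Ints_diff[OF Ints_add[OF _ Ints_mult[OF Ints_of_nat]] Ints_mult[OF Ints_of_nat gz]]) auto
        also have "(r i - (real j * y i + real l * z i)) + real j * (y i - real q * g i) - real l * (g i - z i)
          = r i - of_int (int (j * q + l)) * g i" by (simp add: algebra_simps)
        finally show "r i - of_int (int (j * q + l)) * g i \<in> \<int>" .
      qed
    qed
    moreover have "d + 1 - p * k = (p * q - 1) * k" using count n by (simp add: diff_mult_distrib)
    then have "image_mset g (mset_set {..d}) = replicate_mset (p * k) (1 / (real p * real q)) + replicate_mset ((p * q - 1) * k) (1 / real q)"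
      using image_mset_two_values[OF S(1), of g "1 / (real p * real q)" "1 / real q"] S(2) by (simp add: g_def)
    ultimately show ?thesis using cyclic_mod_int_subset by blast
  qed
qed

text \<open>
  The order of the first digit divides \<open>p * q\<close>; it is \<open>p * q\<close>, or one of the primes and then
  there is a second digit.
\<close>

lemma generator_classification:
  assumes pq: "prime p" "prime q" "p \<noteq> q" and N: "N = p * q"
    and full: "\<And>i. i \<le> d \<Longrightarrow> \<exists>r\<in>L. r i \<notin> \<int>"
  obtains g where "L = cyclic_mod_int d g"
    "image_mset g (mset_set {..d}) = replicate_mset (p * q * k) (1 / (real p * real q)) \<or>
     image_mset g (mset_set {..d}) = replicate_mset (p * k) (1 / real p) + replicate_mset (p * q * k) (1 / real q) \<or>
     image_mset g (mset_set {..d}) = replicate_mset (q * k) (1 / real q) + replicate_mset (p * q * k) (1 / real p) \<or>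
     image_mset g (mset_set {..d}) = replicate_mset (p * k) (1 / (real p * real q)) + replicate_mset ((p * q - 1) * k) (1 / real q) \<or>
     image_mset g (mset_set {..d}) = replicate_mset (q * k) (1 / (real p * real q)) + replicate_mset ((p * q - 1) * k) (1 / real p)"
proof -
  have p2: "p \<ge> 2" and q2: "q \<ge> 2" using pq prime_ge_2_nat by auto
  have "1 < p * q" using mult_le_mono[OF p2 q2] by simp
  then have "N > 1" by (simp add: N)
  obtain y t where y: "y \<in> L" "t \<ge> 2" "t dvd N" "initial_subgroup t {r. \<exists>j<t. \<forall>i\<le>d. r i - real j * y i \<in> \<int>}"
    "\<And>i. i \<le> d \<Longrightarrow> frac (y i) = 0 \<or> frac (y i) = 1 / real t"
    "card {i. i \<le> d \<and> frac (y i) \<noteq> 0} = t * k"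
    by (rule first_digit[OF \<open>N > 1\<close>]) (rule that, assumption+)
  have "t = p \<or> t = q \<or> t = N"
  proof -
    obtain a b where ab: "t = a * b" "a dvd p" "b dvd q" using y(3) unfolding N by (metis division_decomp)
    have "a = 1 \<or> a = p" "b = 1 \<or> b = q" using ab pq by (auto simp: prime_nat_iff)
    then show ?thesis using ab y(2) N by auto
  qed
  then consider "t = N" | "t = p" | "t = q" by blast
  then show ?thesis
  proof cases
    case 1
    have L_eq: "L = {r. \<exists>j<N. \<forall>i\<le>d. r i - real j * y i \<in> \<int>}"
      using initial_subgroup_full y(4) unfolding 1 by blast
    define g where "g = (\<lambda>_::nat. 1 / (real p * real q))"
    have nz: "frac (y i) = 1 / (real p * real q)" if i: "i \<le> d" for i
    proof (rule ccontr)
      assume "frac (y i) \<noteq> 1 / (real p * real q)"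
      then have "y i \<in> \<int>" using y(5)[OF i] by (simp add: 1 N)
      moreover obtain r where r: "r \<in> L" "r i \<notin> \<int>" using full[OF i] by blast
      moreover obtain j where "r i - real j * y i \<in> \<int>" using r(1) i unfolding L_eq by blast
      ultimately have "(r i - real j * y i) + real j * y i \<in> \<int>" by (intro Ints_add Ints_mult) auto
      then show False using r(2) by simp
    qed
    have yg: "y i - g i \<in> \<int>" if "i \<le> d" for i
      using nz[OF that] frac_unique_iff[of "y i" "g i"] by (simp add: g_def)
    have "g \<in> L"
      using diff_mem[OF y(1) int_mem[of "\<lambda>i. y i - g i"]] yg by simp
    moreover have "L \<subseteq> cyclic_mod_int d g"
    proof
      fix r assume "r \<in> L"
      then obtain j where j: "\<forall>i\<le>d. r i - real j * y i \<in> \<int>" unfolding L_eq by blast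
      have "(r i - real j * y i) + real j * (y i - g i) \<in> \<int>" if "i \<le> d" for i
        using j yg that by (intro Ints_add Ints_mult) auto
      then show "r \<in> cyclic_mod_int d g"
        by (intro cyclic_mod_intI[of _ _ "int j"]) (simp add: algebra_simps)
    qed
    moreover have "frac (y i) \<noteq> 0" if "i \<le> d" for i unfolding nz[OF that] using p2 q2 by simp
    then have "{i. i \<le> d \<and> frac (y i) \<noteq> 0} = {..d}" by blast
    then have "d + 1 = p * q * k" using y(6) by (simp add: 1 N)
    then have "image_mset g (mset_set {..d}) = replicate_mset (p * q * k) (1 / (real p * real q))"
      by (simp add: g_def image_mset_const_eq)
    ultimately show ?thesis using cyclic_mod_int_subset that by blast
  next
    case 2
    from cyclic_of_two_digits[OF pq N y(1) y(4-6)[unfolded 2] full] that show ?thesis by blast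
  next
    case 3
    have N': "N = q * p" using N by (simp add: mult.commute)
    from cyclic_of_two_digits[OF pq(2,1) pq(3)[symmetric] N' y(1) y(4-6)[unfolded 3] full]
    obtain g where g: "L = cyclic_mod_int d g"
      "image_mset g (mset_set {..d}) = replicate_mset (q * k) (1 / real q) + replicate_mset (q * p * k) (1 / real p) \<or>
      image_mset g (mset_set {..d}) = replicate_mset (q * k) (1 / (real q * real p)) + replicate_mset ((q * p - 1) * k) (1 / real p)"
      by blast
    show ?thesis by (rule that[OF g(1)]) (use g(2) in \<open>auto simp: mult.commute\<close>)
  qed
qed

end

section \<open>Coefficient lattices and unimodular equivalence\<close>

lemma int_lattice_add: "x \<in> int_lattice \<Longrightarrow> y \<in> int_lattice \<Longrightarrow> x + y \<in> int_lattice"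
  and int_lattice_diff: "x \<in> int_lattice \<Longrightarrow> y \<in> int_lattice \<Longrightarrow> x - y \<in> int_lattice"
  and int_lattice_scale: "c \<in> \<int> \<Longrightarrow> x \<in> int_lattice \<Longrightarrow> c *\<^sub>R x \<in> int_lattice"
  and int_lattice_0: "0 \<in> int_lattice"
  and int_lattice_axis: "axis i 1 \<in> int_lattice"
  and int_lattice_nth: "x \<in> int_lattice \<Longrightarrow> x $ i \<in> \<int>"
  by (auto simp: int_lattice_def axis_def)

lemma int_lattice_sum: "(\<And>i. i \<in> A \<Longrightarrow> f i \<in> int_lattice) \<Longrightarrow> (\<Sum>i\<in>A. f i) \<in> int_lattice"
  by (induction A rule: infinite_finite_induct) (auto intro: int_lattice_add int_lattice_0)

definition lattice_automorphism :: "(real ^ 'n \<Rightarrow> real ^ 'n) \<Rightarrow> bool" where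
  "lattice_automorphism F \<longleftrightarrow> linear F \<and> F ` int_lattice = int_lattice"

lemma lattice_automorphismI:
  assumes "linear F" "\<And>x. x \<in> int_lattice \<Longrightarrow> F x \<in> int_lattice"
    "\<And>x. x \<in> int_lattice \<Longrightarrow> G x \<in> int_lattice" "\<And>x. F (G x) = x"
  shows "lattice_automorphism F"
proof -
  have "x \<in> F ` int_lattice" if "x \<in> int_lattice" for x
    using assms(3)[OF that] assms(4)[of x] by (metis imageI)
  then show ?thesis unfolding lattice_automorphism_def using assms(1,2) by blast
qed

lemma lattice_automorphism_comp:
  "lattice_automorphism F \<Longrightarrow> lattice_automorphism G \<Longrightarrow> lattice_automorphism (F \<circ> G)"
  unfolding lattice_automorphism_def by (metis image_comp linear_compose)

lemma linear_eq_vector_matrix: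
  fixes F :: "real ^ 'n \<Rightarrow> real ^ 'n"
  assumes "linear F"
  shows "F x = x v* (\<chi> i j. F (axis i 1) $ j)"
proof -
  have "F x = F (\<Sum>i\<in>UNIV. x $ i *\<^sub>R axis i 1)"
    by (simp add: basis_expansion scalar_mult_eq_scaleR [symmetric])
  also have "\<dots> = (\<Sum>i\<in>UNIV. x $ i *\<^sub>R F (axis i 1))"
    by (simp add: linear_sum[OF assms] linear_cmul[OF assms])
  finally show ?thesis
    by (auto simp: vec_eq_iff vector_matrix_mult_def mult.commute)
qed

text \<open>
  The rows of the matrix \<open>W\<close> are integral preimages of the standard basis vectors, so \<open>W ** U = mat 1\<close> and
  both determinants are units of \<open>\<int>\<close>.
\<close>

lemma lattice_automorphism_matrix:
  fixes F :: "real ^ 'n \<Rightarrow> real ^ 'n"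
  assumes "lattice_automorphism F"
  obtains U :: "int ^ 'n ^ 'n" where "det U = 1 \<or> det U = - 1"
    "\<And>x. F x = x v* (\<chi> i j. real_of_int (U $ i $ j))"
proof -
  have lin: "linear F" and im: "F ` int_lattice = int_lattice"
    using assms by (auto simp: lattice_automorphism_def)
  have "\<forall>i. \<exists>b. b \<in> int_lattice \<and> F b = axis i 1"
    using im int_lattice_axis by (metis imageE)
  then obtain b where b: "\<And>i. b i \<in> int_lattice" "\<And>i. F (b i) = axis i 1" by metis
  define U :: "int ^ 'n ^ 'n" where "U = (\<chi> i j. \<lfloor>F (axis i 1) $ j\<rfloor>)"
  define W :: "int ^ 'n ^ 'n" where "W = (\<chi> i j. \<lfloor>b i $ j\<rfloor>)"
  have U: "real_of_int (U $ i $ j) = F (axis i 1) $ j" for i j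
  proof -
    have "F (axis i 1) \<in> int_lattice" using im int_lattice_axis by blast
    then show ?thesis by (simp add: U_def int_lattice_nth)
  qed
  have W: "real_of_int (W $ i $ j) = b i $ j" for i j
    using b(1) by (simp add: W_def int_lattice_nth)
  have "(W ** U) $ i $ j = (mat 1 :: int ^ 'n ^ 'n) $ i $ j" for i j
  proof -
    have "real_of_int ((W ** U) $ i $ j) = F (b i) $ j"
      by (subst linear_eq_vector_matrix[OF lin])
        (simp add: matrix_matrix_mult_def vector_matrix_mult_def U W mult.commute)
    also have "\<dots> = real_of_int ((mat 1 :: int ^ 'n ^ 'n) $ i $ j)"
      by (auto simp: b mat_def axis_def)
    finally show ?thesis by (simp only: of_int_eq_iff)
  qed
  then have "W ** U = mat 1" by (simp add: vec_eq_iff)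
  then have "det W * det U = 1" by (metis det_I det_mul)
  then have "det U = 1 \<or> det U = - 1" by (metis mult.commute zmult_eq_1_iff)
  moreover have "F x = x v* (\<chi> i j. real_of_int (U $ i $ j))" for x
    using linear_eq_vector_matrix[OF lin, of x] by (simp add: U)
  ultimately show ?thesis using that by blast
qed

lemma lattice_automorphism_unimodular_equiv:
  fixes F :: "real ^ 'n \<Rightarrow> real ^ 'n"
  assumes "lattice_automorphism F" "w \<in> int_lattice"
  shows "unimodular_equiv P ((\<lambda>x. F x + w) ` P)"
proof -
  obtain U :: "int ^ 'n ^ 'n" where U: "det U = 1 \<or> det U = - 1"
    "\<And>x. F x = x v* (\<chi> i j. real_of_int (U $ i $ j))"
    using lattice_automorphism_matrix[OF assms(1)] by blast
  show ?thesis
    unfolding unimodular_equiv_def U(2)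
    by (rule exI[of _ U], rule exI[of _ w]) (simp add: U(1) assms(2))
qed

text \<open>
  The group \<open>\<Lambda>\<close> of the simplex with vertices \<open>v 0, \<dots>, v d\<close> is the quotient of this group by the integer
  vectors. Values outside \<open>{..d}\<close> are unconstrained.
\<close>

definition coeff_lattice :: "(nat \<Rightarrow> real ^ 'n) \<Rightarrow> (nat \<Rightarrow> real) set" where
  "coeff_lattice v = {r. (\<Sum>i\<le>CARD('n). r i *\<^sub>R v i) \<in> int_lattice \<and> (\<Sum>i\<le>CARD('n). r i) \<in> \<int>}"

text \<open>
  Affine independence of an indexed family, so that repeated members count as dependent.
\<close>

definition affinely_independent :: "(nat \<Rightarrow> real ^ 'n) \<Rightarrow> bool" where
  "affinely_independent v \<longleftrightarrow> (\<forall>r. (\<Sum>i\<le>CARD('n). r i *\<^sub>R v i) = 0 \<longrightarrow> (\<Sum>i\<le>CARD('n). r i) = 0 \<longrightarrow>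
     (\<forall>i\<le>CARD('n). r i = 0))"

lemma sum_scaleR_Pair_1:
  "(\<Sum>i\<in>A. r i *\<^sub>R (v i, 1 :: real)) = ((\<Sum>i\<in>A. r i *\<^sub>R v i), (\<Sum>i\<in>A. r i))"
  by (simp add: prod_eq_iff fst_sum snd_sum)

text \<open>
  Appending the coordinate \<open>1\<close> turns affine independence into linear independence in dimension \<open>d + 1\<close>,
  where \<open>d + 1\<close> independent vectors form a basis.
\<close>

lemma affinely_independent_homogenized:
  fixes v :: "nat \<Rightarrow> real ^ 'n"
  assumes "affinely_independent v"
  shows "inj_on (\<lambda>i. (v i, 1 :: real)) {..CARD('n)}" "independent ((\<lambda>i. (v i, 1 :: real)) ` {..CARD('n)})"
    "span ((\<lambda>i. (v i, 1 :: real)) ` {..CARD('n)}) = UNIV"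
proof -
  let ?f = "\<lambda>i. (v i, 1 :: real)" and ?I = "{..CARD('n)}"
  have zero: "i \<le> CARD('n) \<Longrightarrow> r i = 0" if "(\<Sum>i\<in>?I. r i *\<^sub>R ?f i) = 0" for r i
    using assms that unfolding affinely_independent_def sum_scaleR_Pair_1 prod_eq_iff fst_conv snd_conv fst_zero snd_zero by blast
  show inj: "inj_on ?f ?I"
  proof (rule inj_onI, rule ccontr)
    fix i j assume ij: "i \<in> ?I" "j \<in> ?I" "?f i = ?f j" "i \<noteq> j"
    define f where "f = ?f"
    have "(\<Sum>l\<in>?I. ((if l = i then 1 else 0) - (if l = j then 1 else 0)) *\<^sub>R f l) =
        (\<Sum>l\<in>?I. (if l = i then f l else 0) - (if l = j then f l else 0))"
      by (rule sum.cong) auto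
    also have "\<dots> = f i - f j"
      using ij(1,2) by (simp add: sum_subtractf)
    finally have "(\<Sum>l\<in>?I. ((if l = i then 1 else 0) - (if l = j then 1 else 0)) *\<^sub>R ?f l) = ?f i - ?f j"
      unfolding f_def .
    from zero[OF this[unfolded ij(3) diff_self], of i] ij show False by auto
  qed
  show ind: "independent (?f ` ?I)"
  proof (subst independent_explicit, intro conjI allI impI ballI)
    fix u x assume u: "(\<Sum>y\<in>?f ` ?I. u y *\<^sub>R y) = 0" and "x \<in> ?f ` ?I"
    then obtain i where "i \<in> ?I" "x = ?f i" by blast
    moreover have "(\<Sum>i\<in>?I. u (?f i) *\<^sub>R ?f i) = 0"
      using u unfolding sum.reindex[OF inj] by (simp add: o_def)
    ultimately show "u x = 0" using zero[of "\<lambda>i. u (?f i)" i] by simp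
  qed simp
  have "card (?f ` ?I) = DIM((real ^ 'n) \<times> real)" by (simp add: card_image[OF inj])
  then show "span (?f ` ?I) = UNIV"
    using ind by (metis card_eq_dim dim_UNIV finite_atMost finite_imageI subset_UNIV top.extremum_uniqueI)
qed

lemma affine_coordinates_exist:
  fixes v :: "nat \<Rightarrow> real ^ 'n"
  assumes "affinely_independent v"
  obtains c where "(\<Sum>i\<le>CARD('n). c i *\<^sub>R v i) = x" "(\<Sum>i\<le>CARD('n). c i) = t"
proof -
  let ?f = "\<lambda>i. (v i, 1 :: real)" and ?I = "{..CARD('n)}"
  have "(x, t) \<in> span (?f ` ?I)" using affinely_independent_homogenized(3)[OF assms] by simp
  then obtain u where "(x, t) = (\<Sum>y\<in>?f ` ?I. u y *\<^sub>R y)" by (auto simp: span_finite)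
  also have "\<dots> = (\<Sum>i\<in>?I. u (?f i) *\<^sub>R ?f i)"
    unfolding sum.reindex[OF affinely_independent_homogenized(1)[OF assms]] by (simp add: o_def)
  finally have "(x, t) = ((\<Sum>i\<in>?I. u (?f i) *\<^sub>R v i), (\<Sum>i\<in>?I. u (?f i)))"
    by (simp only: sum_scaleR_Pair_1)
  then show ?thesis using that[of "\<lambda>i. u (?f i)"] by simp
qed

lemma affine_extension:
  fixes v :: "nat \<Rightarrow> real ^ 'n" and f :: "nat \<Rightarrow> 'b::real_vector"
  assumes "affinely_independent v"
  obtains F where "linear F" "\<And>r. F ((\<Sum>i\<le>CARD('n). r i *\<^sub>R v i), (\<Sum>i\<le>CARD('n). r i)) = (\<Sum>i\<le>CARD('n). r i *\<^sub>R f i)"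
proof -
  let ?g = "\<lambda>i. (v i, 1 :: real)" and ?I = "{..CARD('n)}"
  note inj = affinely_independent_homogenized(1)[OF assms]
  obtain F where F: "linear F" "\<forall>y\<in>?g ` ?I. F y = f (inv_into ?I ?g y)"
    using linear_independent_extend[OF affinely_independent_homogenized(2)[OF assms],
        of "\<lambda>y. f (inv_into ?I ?g y)"] by (elim exE conjE)
  have "F (?g i) = f i" if "i \<in> ?I" for i
    using F(2)[rule_format, of "?g i"] inv_into_f_f[OF inj that] that by (simp only: image_eqI)
  then have "F (\<Sum>i\<in>?I. r i *\<^sub>R ?g i) = (\<Sum>i\<in>?I. r i *\<^sub>R f i)" for r
    by (simp add: linear_sum[OF F(1)] linear_cmul[OF F(1)] del: scaleR_Pair)
  then show ?thesis using that[OF F(1)] by (simp only: sum_scaleR_Pair_1)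
qed

text \<open>
  An affine relation of \<open>v'\<close> may be scaled by any real number, so it yields a line in \<open>coeff_lattice v'\<close>.
  A line in \<open>coeff_lattice v\<close> is mapped to a line of lattice points, which must be constant, so the relation
  holds for \<open>v\<close> as well.
\<close>

lemma affinely_independent_if_coeff_lattice_subset:
  fixes v v' :: "nat \<Rightarrow> real ^ 'n"
  assumes "affinely_independent v" "coeff_lattice v' \<subseteq> coeff_lattice v"
  shows "affinely_independent v'"
  unfolding affinely_independent_def
proof (intro allI impI)
  fix r :: "nat \<Rightarrow> real" and i
  assume r: "(\<Sum>i\<le>CARD('n). r i *\<^sub>R v' i) = 0" "(\<Sum>i\<le>CARD('n). r i) = 0" and i: "i \<le> CARD('n)"
  have "(\<lambda>i. t * r i) \<in> coeff_lattice v'" for t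
    using r by (simp add: coeff_lattice_def int_lattice_0 flip: scaleR_scaleR scaleR_sum_right sum_distrib_left)
  then have "(\<lambda>i. t * r i) \<in> coeff_lattice v" for t using assms(2) by blast
  then have lat: "t *\<^sub>R (\<Sum>i\<le>CARD('n). r i *\<^sub>R v i) \<in> int_lattice" for t
    by (simp add: coeff_lattice_def flip: scaleR_scaleR scaleR_sum_right)
  have "(\<Sum>i\<le>CARD('n). r i *\<^sub>R v i) $ j = 0" for j
  proof (rule ccontr)
    let ?x = "(\<Sum>i\<le>CARD('n). r i *\<^sub>R v i) $ j"
    assume "?x \<noteq> 0"
    then have "(1 / (2 * ?x)) * ?x = 1 / 2" by simp
    moreover have "(1 / (2 * ?x)) * ?x \<in> \<int>"
      using int_lattice_nth[OF lat[of "1 / (2 * ?x)"], of j] by simp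
    moreover have "(1 / 2 :: real) \<notin> \<int>"
    proof
      assume "(1 / 2 :: real) \<in> \<int>"
      then obtain m :: int where "1 / 2 = real_of_int m" by (elim Ints_cases)
      then have "real_of_int (2 * m) = real_of_int 1" by simp
      then have "2 * m = 1" by linarith
      then show False by presburger
    qed
    ultimately show False by metis
  qed
  then have "(\<Sum>i\<le>CARD('n). r i *\<^sub>R v i) = 0" by (simp add: vec_eq_iff)
  then show "r i = 0" using assms(1) r(2) i unfolding affinely_independent_def by blast
qed

lemma convex_hull_image_atMost:
  "convex hull (v ` {..m::nat}) = {(\<Sum>i\<le>m. c i *\<^sub>R v i) | c. (\<forall>i\<le>m. 0 \<le> c i) \<and> (\<Sum>i\<le>m. c i) = (1::real)}"
proof (intro equalityI subsetI)
  fix x assume "x \<in> {(\<Sum>i\<le>m. c i *\<^sub>R v i) | c. (\<forall>i\<le>m. 0 \<le> c i) \<and> (\<Sum>i\<le>m. c i) = (1::real)}"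
  then obtain c where "x = (\<Sum>i\<le>m. c i *\<^sub>R v i)" "\<forall>i\<le>m. 0 \<le> c i" "(\<Sum>i\<le>m. c i) = 1" by blast
  then show "x \<in> convex hull (v ` {..m})"
    using convex_sum[of "{..m}" "convex hull (v ` {..m})" c v] by (auto intro: hull_inc)
next
  let ?S = "{(\<Sum>i\<le>m. c i *\<^sub>R v i) | c. (\<forall>i\<le>m. 0 \<le> c i) \<and> (\<Sum>i\<le>m. c i) = (1::real)}"
  fix x assume x: "x \<in> convex hull (v ` {..m})"
  have "convex ?S"
  proof (rule convexI)
    fix x y a b assume "x \<in> ?S" "y \<in> ?S" and ab: "0 \<le> a" "0 \<le> b" "a + b = (1::real)"
    then obtain c e where "x = (\<Sum>i\<le>m. c i *\<^sub>R v i)" "\<forall>i\<le>m. 0 \<le> c i" "(\<Sum>i\<le>m. c i) = 1"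
       "y = (\<Sum>i\<le>m. e i *\<^sub>R v i)" "\<forall>i\<le>m. 0 \<le> e i" "(\<Sum>i\<le>m. e i) = 1" by blast
    then show "a *\<^sub>R x + b *\<^sub>R y \<in> ?S" using ab
      by (intro CollectI exI[of _ "\<lambda>i. a * c i + b * e i"])
        (simp add: scaleR_left_distrib sum.distrib scaleR_sum_right flip: sum_distrib_left)
  qed
  moreover have "v j \<in> ?S" if "j \<le> m" for j
    using that by (intro CollectI exI[of _ "\<lambda>i. if i = j then 1 else 0"])
      (simp add: if_distrib[of "\<lambda>c. c *\<^sub>R _"] cong: if_cong)
  ultimately have "convex hull (v ` {..m}) \<subseteq> ?S" by (intro hull_minimal) auto
  then show "x \<in> ?S" using x by blast
qed

lemma convex_hull_affine_image:
  fixes F :: "real ^ 'n \<Rightarrow> real ^ 'n"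
  assumes "linear F"
  shows "(\<lambda>x. F x + w) ` (convex hull S) = convex hull ((\<lambda>x. F x + w) ` S)"
proof -
  have "(\<lambda>x. F x + w) ` T = (\<lambda>x. w + x) ` (F ` T)" for T by (simp add: image_image add.commute)
  then show ?thesis by (simp only: convex_hull_linear_image[OF assms] convex_hull_translation)
qed

text \<open>
  The linear map \<open>\<Psi>\<close> takes \<open>(v i, 1)\<close> to \<open>v' i\<close>. An integral vector \<open>(x, t)\<close> has its coefficients in
  \<open>coeff_lattice v = coeff_lattice v'\<close>, so its image is integral; the same argument in the other
  direction gives surjectivity on lattice points.
\<close>

lemma unimodular_equiv_if_coeff_lattice_eq:
  fixes v v' :: "nat \<Rightarrow> real ^ 'n"
  assumes ind: "affinely_independent v" and eq: "coeff_lattice v = coeff_lattice v'"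
  shows "unimodular_equiv (convex hull (v ` {..CARD('n)})) (convex hull (v' ` {..CARD('n)}))"
proof -
  have ind': "affinely_independent v'"
    using affinely_independent_if_coeff_lattice_subset[OF ind] eq by simp
  obtain \<Psi> where \<Psi>: "linear \<Psi>"
      "\<And>r. \<Psi> ((\<Sum>i\<le>CARD('n). r i *\<^sub>R v i), (\<Sum>i\<le>CARD('n). r i)) = (\<Sum>i\<le>CARD('n). r i *\<^sub>R v' i)"
    by (rule affine_extension[OF ind, of v']) (rule that, assumption+)
  have lattice: "\<Psi> (x, t) \<in> int_lattice" if "x \<in> int_lattice" "t \<in> \<int>" for x t
  proof -
    obtain c where c: "(\<Sum>i\<le>CARD('n). c i *\<^sub>R v i) = x" "(\<Sum>i\<le>CARD('n). c i) = t"
      using affine_coordinates_exist[OF ind] by metis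
    then have "c \<in> coeff_lattice v'" using that eq by (auto simp: coeff_lattice_def)
    then show ?thesis using \<Psi>(2)[of c] c by (simp add: coeff_lattice_def)
  qed
  define F where "F = (\<lambda>x. \<Psi> (x, 0))"
  define w where "w = \<Psi> (0, 1)"
  have split: "\<Psi> (x, 1) = F x + w" for x
    using linear_add[OF \<Psi>(1), of "(x, 0)" "(0, 1)"] by (simp add: F_def w_def)
  have lin: "linear F"
  proof (rule linearI)
    show "F (x + y) = F x + F y" for x y
      using linear_add[OF \<Psi>(1), of "(x, 0)" "(y, 0)"] by (simp add: F_def)
    show "F (c *\<^sub>R x) = c *\<^sub>R F x" for c x
      using linear_cmul[OF \<Psi>(1), of c "(x, 0)"] by (simp add: F_def)
  qed
  have "F ` int_lattice = int_lattice"
  proof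
    show "F ` int_lattice \<subseteq> int_lattice" using lattice by (auto simp: F_def)
    show "int_lattice \<subseteq> F ` int_lattice"
    proof
      fix y :: "real ^ 'n" assume y: "y \<in> int_lattice"
      obtain c where c: "(\<Sum>i\<le>CARD('n). c i *\<^sub>R v' i) = y" "(\<Sum>i\<le>CARD('n). c i) = 0"
        using affine_coordinates_exist[OF ind'] by metis
      then have "c \<in> coeff_lattice v" using y eq by (auto simp: coeff_lattice_def)
      moreover have "F (\<Sum>i\<le>CARD('n). c i *\<^sub>R v i) = y" using \<Psi>(2)[of c] c by (simp add: F_def)
      ultimately show "y \<in> F ` int_lattice" unfolding coeff_lattice_def by blast
    qed
  qed
  with lin have "lattice_automorphism F" by (simp add: lattice_automorphism_def)
  moreover have "w \<in> int_lattice" unfolding w_def by (rule lattice) (simp_all add: int_lattice_0)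
  ultimately have "unimodular_equiv (convex hull (v ` {..CARD('n)})) ((\<lambda>x. F x + w) ` (convex hull (v ` {..CARD('n)})))"
    by (rule lattice_automorphism_unimodular_equiv)
  moreover have "(\<lambda>x. F x + w) ` (convex hull (v ` {..CARD('n)})) = convex hull (v' ` {..CARD('n)})"
  proof -
    have "F (v i) + w = v' i" if "i \<le> CARD('n)" for i
      using \<Psi>(2)[of "\<lambda>l. if l = i then 1 else 0"] that split[of "v i"]
      by (simp add: if_distrib[of "\<lambda>c. c *\<^sub>R _"] cong: if_cong)
    then have "v' ` {..CARD('n)} = (\<lambda>x. F x + w) ` (v ` {..CARD('n)})"
      unfolding image_image by (intro image_cong) auto
    then show ?thesis by (simp add: convex_hull_affine_image[OF lin])
  qed
  ultimately show ?thesis by simp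
qed

section \<open>Integral coefficients and lattice pyramids\<close>

lemma affinely_independent_iff:
  fixes v :: "nat \<Rightarrow> real ^ 'n"
  shows "affinely_independent v \<longleftrightarrow> inj_on v {..CARD('n)} \<and> \<not> affine_dependent (v ` {..CARD('n)})"
proof
  assume ind: "affinely_independent v"
  have inj: "inj_on v {..CARD('n)}"
    using affinely_independent_homogenized(1)[OF ind] by (auto simp: inj_on_def)
  have "\<not> affine_dependent (v ` {..CARD('n)})"
  proof
    assume "affine_dependent (v ` {..CARD('n)})"
    then obtain u y where u: "sum u (v ` {..CARD('n)}) = 0" "y \<in> v ` {..CARD('n)}" "u y \<noteq> 0"
      "(\<Sum>x\<in>v ` {..CARD('n)}. u x *\<^sub>R x) = 0"
      by (auto simp: affine_dependent_explicit_finite)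
    then obtain i where i: "i \<le> CARD('n)" "y = v i" by blast
    have s: "(\<Sum>i\<le>CARD('n). u (v i) *\<^sub>R v i) = 0" "(\<Sum>i\<le>CARD('n). u (v i)) = 0"
      using u(1,4) by (simp_all add: sum.reindex[OF inj])
    have "u (v i) = 0"
      by (rule ind[unfolded affinely_independent_def, rule_format, of "\<lambda>i. u (v i)", OF s i(1)])
    then show False using u(3) i(2) by simp
  qed
  then show "inj_on v {..CARD('n)} \<and> \<not> affine_dependent (v ` {..CARD('n)})" using inj by blast
next
  assume asm: "inj_on v {..CARD('n)} \<and> \<not> affine_dependent (v ` {..CARD('n)})"
  then have inj: "inj_on v {..CARD('n)}" by blast
  show "affinely_independent v"
    unfolding affinely_independent_def
  proof (intro allI impI, rule ccontr)
    fix r :: "nat \<Rightarrow> real" and i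
    assume r: "(\<Sum>i\<le>CARD('n). r i *\<^sub>R v i) = 0" "(\<Sum>i\<le>CARD('n). r i) = 0" "i \<le> CARD('n)" "r i \<noteq> 0"
    let ?u = "\<lambda>x. r (inv_into {..CARD('n)} v x)"
    have u: "?u (v j) = r j" if "j \<le> CARD('n)" for j
      using inv_into_f_f[OF inj, of j] that by simp
    have "sum ?u (v ` {..CARD('n)}) = 0" "(\<Sum>x\<in>v ` {..CARD('n)}. ?u x *\<^sub>R x) = 0"
      using r(1,2) u by (simp_all add: sum.reindex[OF inj])
    moreover have "\<exists>x\<in>v ` {..CARD('n)}. ?u x \<noteq> 0" using u[OF r(3)] r(3,4) by (intro bexI[of _ "v i"]) auto
    ultimately have "affine_dependent (v ` {..CARD('n)})"
      by (subst affine_dependent_explicit_finite) (auto intro!: exI[of _ ?u])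
    then show False using asm by blast
  qed
qed

lemma linear_functional_eq_sum:
  fixes \<phi> :: "real ^ 'n \<Rightarrow> real"
  assumes "linear \<phi>"
  shows "\<phi> x = (\<Sum>i\<in>UNIV. x $ i * \<phi> (axis i 1))"
proof -
  have "\<phi> x = \<phi> (\<Sum>i\<in>UNIV. x $ i *\<^sub>R axis i 1)"
    by (simp add: basis_expansion scalar_mult_eq_scaleR [symmetric])
  then show ?thesis by (simp add: linear_sum[OF assms] linear_cmul[OF assms])
qed

text \<open>
  The range is a subspace that contains the standard basis, so the map is bijective.
\<close>

lemma lattice_automorphism_inverse:
  fixes F :: "real ^ 'n \<Rightarrow> real ^ 'n"
  assumes "lattice_automorphism F"
  obtains H where "lattice_automorphism H" "\<And>x. H (F x) = x" "\<And>x. F (H x) = x"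
proof -
  have lin: "linear F" and im: "F ` int_lattice = int_lattice"
    using assms by (auto simp: lattice_automorphism_def)
  have "x \<in> range F" for x
  proof -
    have "axis i 1 \<in> range F" for i
    proof -
      have "axis i 1 \<in> F ` int_lattice" by (simp add: im int_lattice_axis)
      then show ?thesis by blast
    qed
    moreover have "subspace (range F)" by (rule linear_subspace_image[OF lin subspace_UNIV])
    ultimately have "(\<Sum>i\<in>UNIV. x $ i *\<^sub>R axis i 1) \<in> range F"
      by (intro subspace_sum subspace_scale)
    then show ?thesis by (simp add: basis_expansion scalar_mult_eq_scaleR [symmetric])
  qed
  then have "surj F" by blast
  have "\<exists>H. linear H \<and> (\<forall>x. H (F x) = x) \<and> (\<forall>x. F (H x) = x)"
    by (rule linear_surjective_isomorphism[OF lin \<open>surj F\<close> refl])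
  then obtain H where H: "linear H" "\<forall>x. H (F x) = x" "\<forall>x. F (H x) = x" by blast
  have "H ` int_lattice = H ` (F ` int_lattice)" by (simp add: im)
  also have "\<dots> = int_lattice" using H(2) by (simp add: image_image)
  finally show ?thesis using that[of H] H by (simp add: lattice_automorphism_def)
qed

lemma lattice_automorphism_shear:
  assumes "i \<noteq> j" "s \<in> \<int>"
  shows "lattice_automorphism (\<lambda>x. x - (s * x $ i) *\<^sub>R axis j 1)"
proof (rule lattice_automorphismI)
  show "linear (\<lambda>x :: real ^ 'a. x - (s * x $ i) *\<^sub>R axis j 1)"
    by (rule linearI) (simp_all add: algebra_simps)
  show "x - (s * x $ i) *\<^sub>R axis j 1 \<in> int_lattice" if "x \<in> int_lattice" for x
    using that assms(2) by (intro int_lattice_diff int_lattice_scale int_lattice_axis Ints_mult) (auto intro: int_lattice_nth)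
  show "x + (s * x $ i) *\<^sub>R axis j 1 \<in> int_lattice" if "x \<in> int_lattice" for x
    using that assms(2) by (intro int_lattice_add int_lattice_scale int_lattice_axis Ints_mult) (auto intro: int_lattice_nth)
  show "(x + (s * x $ i) *\<^sub>R axis j 1) - (s * (x + (s * x $ i) *\<^sub>R axis j 1) $ i) *\<^sub>R axis j 1 = x" for x
    using assms(1) by (simp add: axis_def)
qed

text \<open>
  The Euclidean algorithm on the values of the functional at the standard basis vectors. As long as two values
  are nonzero, a shear subtracts (up to sign) the smaller one from the larger one, which decreases the sum of
  the absolute values.
\<close>

lemma integral_functional_normal_form:
  fixes \<phi> :: "real ^ 'n \<Rightarrow> real" and n :: 'n
  assumes "linear \<phi>" "\<And>x. x \<in> int_lattice \<Longrightarrow> \<phi> x \<in> \<int>"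
  shows "\<exists>F c. lattice_automorphism F \<and> (\<forall>x. \<phi> (F x) = c * x $ n)"
  using assms
proof (induction "\<Sum>i\<in>UNIV. nat \<lfloor>\<bar>\<phi> (axis i 1)\<bar>\<rfloor>" arbitrary: \<phi> rule: less_induct)
  case less
  show ?case
  proof (cases "\<exists>i j. i \<noteq> j \<and> \<phi> (axis i 1) \<noteq> 0 \<and> \<phi> (axis j 1) \<noteq> 0")
    case True
    then obtain i j where ij: "i \<noteq> j" "\<phi> (axis j 1) \<noteq> 0" "\<bar>\<phi> (axis j 1)\<bar> \<le> \<bar>\<phi> (axis i 1)\<bar>"
      by (metis linear)
    define s where "s = sgn (\<phi> (axis i 1)) * sgn (\<phi> (axis j 1))"
    define S where "S = (\<lambda>x :: real ^ 'n. x - (s * x $ i) *\<^sub>R axis j 1)"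
    have "s \<in> \<int>" by (auto simp: s_def sgn_if)
    then have S: "lattice_automorphism S" unfolding S_def using ij(1) by (intro lattice_automorphism_shear)
    then have lin: "linear (\<phi> \<circ> S)" and int: "\<And>x. x \<in> int_lattice \<Longrightarrow> (\<phi> \<circ> S) x \<in> \<int>"
      using less.prems by (auto simp: lattice_automorphism_def intro: linear_compose)
    have val: "(\<phi> \<circ> S) (axis l 1) = (if l = i then \<phi> (axis i 1) - s * \<phi> (axis j 1) else \<phi> (axis l 1))" for l
    proof -
      have "axis l (1 :: real) $ i = (if l = i then 1 else 0)" by (simp add: axis_def)
      then show ?thesis
        by (simp add: S_def linear_diff[OF less.prems(1)] linear_cmul[OF less.prems(1)])
    qed
    have "\<bar>\<phi> (axis i 1) - s * \<phi> (axis j 1)\<bar> = \<bar>\<phi> (axis i 1)\<bar> - \<bar>\<phi> (axis j 1)\<bar>"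
    proof -
      have "\<phi> (axis i 1) \<noteq> 0" using ij(2,3) by auto
      then show ?thesis using ij by (auto simp: s_def sgn_if abs_if)
    qed
    moreover obtain a b where ab: "\<phi> (axis i 1) = of_int a" "\<phi> (axis j 1) = of_int b"
      using less.prems(2) int_lattice_axis by (metis Ints_cases)
    ultimately have "nat \<lfloor>\<bar>\<phi> (axis i 1) - s * \<phi> (axis j 1)\<bar>\<rfloor> < nat \<lfloor>\<bar>\<phi> (axis i 1)\<bar>\<rfloor>"
      using ij(2,3) by (simp add: ab flip: of_int_abs of_int_diff)
    then have "(\<Sum>l\<in>UNIV. nat \<lfloor>\<bar>(\<phi> \<circ> S) (axis l 1)\<bar>\<rfloor>) < (\<Sum>l\<in>UNIV. nat \<lfloor>\<bar>\<phi> (axis l 1)\<bar>\<rfloor>)"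
      unfolding val by (intro sum_strict_mono_ex1) (auto intro!: exI[of _ i])
    from less.hyps[OF this lin int] obtain F c where F: "lattice_automorphism F" "\<forall>x. (\<phi> \<circ> S) (F x) = c * x $ n" by blast
    then show ?thesis by (intro exI[of _ "S \<circ> F"] exI[of _ c]) (simp add: lattice_automorphism_comp[OF S])
  next
    case False
    then obtain i where i: "\<And>l. l \<noteq> i \<Longrightarrow> \<phi> (axis l 1) = 0" by metis
    have \<phi>: "\<phi> x = \<phi> (axis i 1) * x $ i" for x
    proof -
      have "\<phi> x = (\<Sum>l\<in>UNIV. if l = i then x $ l * \<phi> (axis l 1) else 0)"
        unfolding linear_functional_eq_sum[OF less.prems(1), of x] by (intro sum.cong) (auto simp: i)
      then show ?thesis by simp
    qed
    let ?P = "\<lambda>x :: real ^ 'n. \<chi> l. x $ Transposition.transpose i n l"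
    have "lattice_automorphism ?P"
    proof (rule lattice_automorphismI)
      show "linear ?P" by (rule linearI) (simp_all add: vec_eq_iff)
      show "?P (?P x) = x" for x by (simp add: vec_eq_iff)
    qed (auto simp: int_lattice_def)
    moreover have "\<phi> (?P x) = \<phi> (axis i 1) * x $ n" for x by (subst \<phi>) simp
    ultimately show ?thesis by blast
  qed
qed

text \<open>
  In the normal form the constant \<open>c\<close> is \<open>\<plusminus>1\<close>, because it divides \<open>\<phi> a = 1\<close>. A lattice automorphism
  applied first corrects this sign and makes the composition take the \<open>n\<close>-th basis vector to \<open>a\<close>.
\<close>

lemma primitive_functional_coordinates:
  fixes \<phi> :: "real ^ 'n \<Rightarrow> real" and n :: 'n
  assumes "linear \<phi>" "\<And>x. x \<in> int_lattice \<Longrightarrow> \<phi> x \<in> \<int>" and a: "a \<in> int_lattice" "\<phi> a = 1"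
  obtains G where "lattice_automorphism G" "G (axis n 1) = a" "\<And>x. \<phi> (G x) = x $ n"
proof -
  obtain F c where F: "lattice_automorphism F" "\<And>x. \<phi> (F x) = c * x $ n"
    using integral_functional_normal_form[OF assms(1,2), of n] by blast
  then have lin: "linear F" and im: "F ` int_lattice = int_lattice" by (auto simp: lattice_automorphism_def)
  obtain b where b: "b \<in> int_lattice" "F b = a" using im a(1) by (metis imageE)
  have cb: "c * b $ n = 1" using F(2)[of b] b(2) a(2) by simp
  have "c = \<phi> (F (axis n 1))" by (simp add: F(2))
  moreover have "F (axis n 1) \<in> int_lattice" using im int_lattice_axis by blast
  ultimately have "c \<in> \<int>" using assms(2) by simp
  then obtain ci bi where ci: "c = of_int ci" "b $ n = of_int bi"
    using int_lattice_nth[OF b(1), of n] by (auto elim!: Ints_cases)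
  then have "real_of_int (ci * bi) = real_of_int 1" using cb by simp
  then have "ci * bi = 1" by (simp only: of_int_eq_iff)
  then have bc: "b $ n = c" "c * c = 1" using ci by (auto simp: zmult_eq_1_iff)
  have bc': "c * (c * y) = y" for y :: real using bc(2) by (simp flip: mult.assoc)
  \<comment> \<open>\<open>S\<close> maps the \<open>n\<close>-th basis vector to \<open>b\<close>; its inverse subtracts \<open>(c * x $ n) *\<^sub>R (b - axis n 1)\<close>\<close>
  define S where "S = (\<lambda>x :: real ^ 'n. x + x $ n *\<^sub>R (b - axis n 1))"
  have "lattice_automorphism S"
  proof (rule lattice_automorphismI)
    show "linear S" unfolding S_def by (rule linearI) (simp_all add: algebra_simps)
    show "S x \<in> int_lattice" if "x \<in> int_lattice" for x
      unfolding S_def using that b(1)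
      by (intro int_lattice_add int_lattice_scale int_lattice_diff int_lattice_axis) (auto intro: int_lattice_nth)
    show "x - (c * x $ n) *\<^sub>R (b - axis n 1) \<in> int_lattice" if "x \<in> int_lattice" for x
      using that b(1) \<open>c \<in> \<int>\<close>
      by (intro int_lattice_diff[of x] int_lattice_scale int_lattice_diff int_lattice_axis Ints_mult) (auto intro: int_lattice_nth)
    show "S (x - (c * x $ n) *\<^sub>R (b - axis n 1)) = x" for x
    proof -
      have "(x - (c * x $ n) *\<^sub>R (b - axis n 1)) $ n = c * x $ n"
        using bc(1) by (simp add: algebra_simps bc')
      then show ?thesis by (simp add: S_def)
    qed
  qed
  then have "lattice_automorphism (F \<circ> S)" by (rule lattice_automorphism_comp[OF F(1)])
  moreover have "(F \<circ> S) (axis n 1) = a" by (simp add: S_def b(2))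
  moreover have "\<phi> ((F \<circ> S) x) = x $ n" for x
  proof -
    have "S x $ n = c * x $ n" using bc(1) by (simp add: S_def algebra_simps)
    then show ?thesis by (simp add: F(2) bc')
  qed
  ultimately show ?thesis by (rule that)
qed

lemma sorted_list_UNIV_bij:
  "bij_betw (\<lambda>i. sorted_list_of_set (UNIV :: 'n::{finite,linorder} set) ! (i - 1)) {1..CARD('n)} UNIV"
proof -
  let ?l = "sorted_list_of_set (UNIV :: 'n set)"
  have "bij_betw (\<lambda>i. ?l ! i) {..<length ?l} (set ?l)" by (intro bij_betw_nth) simp_all
  moreover have "bij_betw (\<lambda>i. i - 1) {1..CARD('n)} {..<length ?l}"
    by (rule bij_betw_byWitness[where f' = Suc]) auto
  ultimately have "bij_betw ((\<lambda>i. ?l ! i) \<circ> (\<lambda>i. i - 1)) {1..CARD('n)} (set ?l)"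
    by (intro bij_betw_trans)
  then show ?thesis by (simp add: o_def)
qed

lemma coord_space_hyperplane:
  fixes x :: "real ^ 'n::{finite,linorder}"
  assumes "std_basis CARD('n) = axis n (1::real)" "x $ n = 0"
  shows "x \<in> coord_space (CARD('n) - 1)"
proof -
  have "x $ i *\<^sub>R axis i 1 \<in> coord_space (CARD('n) - 1)" for i
  proof (cases "i = n")
    case False
    obtain l where l: "l \<in> {1..CARD('n)}" "i = sorted_list_of_set (UNIV :: 'n set) ! (l - 1)"
      using bij_betw_imp_surj_on[OF sorted_list_UNIV_bij[where 'n = 'n]] by (metis (no_types, lifting) UNIV_I imageE)
    then have ax: "axis i (1::real) = std_basis l" by (simp add: std_basis_def)
    then have "l \<noteq> CARD('n)" using False assms(1) by (auto simp: axis_eq_axis)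
    then have "axis i (1::real) \<in> std_basis ` {1..CARD('n) - 1}" using l(1) ax by auto
    then show ?thesis unfolding coord_space_def by (intro span_scale span_base)
  qed (simp add: assms(2) coord_space_def span_zero)
  then have "(\<Sum>i\<in>UNIV. x $ i *\<^sub>R axis i 1) \<in> coord_space (CARD('n) - 1)"
    unfolding coord_space_def by (intro span_sum)
  then show ?thesis by (simp add: basis_expansion scalar_mult_eq_scaleR [symmetric])
qed

text \<open>
  If the \<open>i0\<close>-th coefficient is always integral, then the corresponding barycentric coordinate is an affine function
  that is integral on lattice points, \<open>1\<close> at the vertex \<open>v i0\<close> and \<open>0\<close> at all others. In lattice coordinates with
  this function as last coordinate and \<open>v i0\<close> as last basis vector, the simplex is the pyramid over the facet
  opposite to \<open>v i0\<close>.
\<close>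

lemma lattice_pyramid_if_integral_coefficient:
  fixes v :: "nat \<Rightarrow> real ^ 'n::{finite,linorder}"
  assumes ind: "affinely_independent v" and lat: "\<And>i. i \<le> CARD('n) \<Longrightarrow> v i \<in> int_lattice"
    and i0: "i0 \<le> CARD('n)" "\<And>r. r \<in> coeff_lattice v \<Longrightarrow> r i0 \<in> \<int>"
  shows "is_lattice_pyramid (convex hull (v ` {..CARD('n)}))"
proof -
  let ?d = "CARD('n)"
  have d: "?d > 0" by simp
  \<comment> \<open>any vertex of the opposite facet can serve as the new origin\<close>
  define j0 where "j0 = (if i0 = 0 then 1 else 0 :: nat)"
  have j0: "j0 \<le> ?d" "j0 \<noteq> i0" using d by (auto simp: j0_def Suc_le_eq)
  define f where "f = (\<lambda>i. if i = i0 then 1 else 0 :: real)"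
  obtain \<Psi> where \<Psi>: "linear \<Psi>"
      "\<And>r. \<Psi> ((\<Sum>i\<le>?d. r i *\<^sub>R v i), (\<Sum>i\<le>?d. r i)) = (\<Sum>i\<le>?d. r i *\<^sub>R f i)"
    by (rule affine_extension[OF ind, of f]) (rule that, assumption+)
  have sum_f: "(\<Sum>i\<le>?d. r i * f i) = r i0" for r
    using i0(1) by (simp add: f_def if_distrib[of "\<lambda>c. _ * c"] cong: if_cong)
  define \<phi> where "\<phi> = (\<lambda>x. \<Psi> (x, 0))"
  have lin: "linear \<phi>"
  proof (rule linearI)
    show "\<phi> (x + y) = \<phi> x + \<phi> y" for x y
      using linear_add[OF \<Psi>(1), of "(x, 0)" "(y, 0)"] by (simp add: \<phi>_def)
    show "\<phi> (c *\<^sub>R x) = c *\<^sub>R \<phi> x" for c x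
      using linear_cmul[OF \<Psi>(1), of c "(x, 0)"] by (simp add: \<phi>_def)
  qed
  have int: "\<phi> x \<in> \<int>" if x: "x \<in> int_lattice" for x
  proof -
    obtain c where c: "(\<Sum>i\<le>?d. c i *\<^sub>R v i) = x" "(\<Sum>i\<le>?d. c i) = 0"
      using affine_coordinates_exist[OF ind] by metis
    then have "c \<in> coeff_lattice v" using x by (simp add: coeff_lattice_def)
    then show ?thesis using i0(2) \<Psi>(2)[of c] c by (simp add: \<phi>_def sum_f)
  qed
  have \<phi>v: "\<phi> (v i - v j0) = f i" if "i \<le> ?d" for i
  proof -
    have at: "\<Psi> (v l, 1) = f l" if "l \<le> ?d" for l
      using \<Psi>(2)[of "\<lambda>m. if m = l then 1 else 0"] that
      by (simp add: if_distrib[of "\<lambda>c. c *\<^sub>R _"] sum_f cong: if_cong) (simp add: f_def)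
    have "\<phi> (v i - v j0) = \<Psi> (v i, 1) - \<Psi> (v j0, 1)"
      using linear_diff[OF \<Psi>(1), of "(v i, 1)" "(v j0, 1)"] by (simp add: \<phi>_def)
    then show ?thesis using at[OF that] at[OF j0(1)] j0(2) by (simp add: f_def)
  qed
  define n where "n = sorted_list_of_set (UNIV :: 'n set) ! (?d - 1)"
  have n: "std_basis ?d = axis n (1 :: real)" by (simp add: std_basis_def n_def)
  have a: "v i0 - v j0 \<in> int_lattice" "\<phi> (v i0 - v j0) = 1"
    using lat i0(1) j0(1) \<phi>v[OF i0(1)] by (auto intro: int_lattice_diff simp: f_def)
  obtain G where G: "lattice_automorphism G" "G (axis n 1) = v i0 - v j0" "\<And>x. \<phi> (G x) = x $ n"
    using primitive_functional_coordinates[OF lin int a, of n] by metis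
  obtain H where H: "lattice_automorphism H" "\<And>x. H (G x) = x" "\<And>x. G (H x) = x"
    using lattice_automorphism_inverse[OF G(1)] by metis
  have linH: "linear H" and imH: "H ` int_lattice = int_lattice" using H(1) by (auto simp: lattice_automorphism_def)
  define w where "w = (\<lambda>i. H (v i) + H (- v j0))"
  have w: "w i = H (v i - v j0)" for i
    using linear_add[OF linH, of "v i" "- v j0"] by (simp add: w_def)
  have w_i0: "w i0 = axis n 1" using H(2)[of "axis n 1"] by (simp add: w G(2))
  have w_n: "w i $ n = f i" if "i \<le> ?d" for i
    using G(3)[of "w i"] \<phi>v[OF that] by (simp add: w H(3))
  have w_lat: "w i \<in> int_lattice" if "i \<le> ?d" for i
    unfolding w using lat[OF that] lat[OF j0(1)] imH int_lattice_diff by blast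
  have w_ind: "affinely_independent w"
    unfolding affinely_independent_def
  proof (intro allI impI)
    fix r :: "nat \<Rightarrow> real" and i
    assume r: "(\<Sum>i\<le>?d. r i *\<^sub>R w i) = 0" "(\<Sum>i\<le>?d. r i) = 0" "i \<le> ?d"
    have "H (\<Sum>i\<le>?d. r i *\<^sub>R v i) = (\<Sum>i\<le>?d. r i *\<^sub>R H (v i))"
      by (simp add: linear_sum[OF linH] linear_cmul[OF linH])
    also have "\<dots> = (\<Sum>i\<le>?d. r i *\<^sub>R w i) - (\<Sum>i\<le>?d. r i) *\<^sub>R H (- v j0)"
      by (simp add: w_def scaleR_right_distrib sum.distrib scaleR_sum_left)
    finally have "H (\<Sum>i\<le>?d. r i *\<^sub>R v i) = 0" using r(1,2) by simp
    then have "(\<Sum>i\<le>?d. r i *\<^sub>R v i) = 0"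
      using H(3) G(1) by (metis lattice_automorphism_def linear_0)
    then show "r i = 0" using ind r(2,3) unfolding affinely_independent_def by blast
  qed
  let ?C = "w ` ({..?d} - {i0})"
  have indep: "\<not> affine_dependent ?C" and card: "card ?C = ?d"
  proof -
    have "inj_on w {..?d}" "\<not> affine_dependent (w ` {..?d})" using w_ind affinely_independent_iff by blast+
    then show "\<not> affine_dependent ?C" "card ?C = ?d"
      using i0(1) affine_independent_subset[of "w ` {..?d}" ?C]
      by (auto simp: card_image inj_on_subset[of w "{..?d}"])
  qed
  let ?Q = "convex hull ?C"
  have "?Q \<subseteq> coord_space (?d - 1)"
  proof (rule hull_minimal)
    show "?C \<subseteq> coord_space (?d - 1)"
    proof (intro subsetI, elim imageE)
      fix x i assume "x = w i" "i \<in> {..?d} - {i0}"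
      then show "x \<in> coord_space (?d - 1)"
        using w_n[of i] by (intro coord_space_hyperplane[OF n]) (auto simp: f_def)
    qed
    show "convex (coord_space (?d - 1))" unfolding coord_space_def by (intro subspace_imp_convex subspace_span)
  qed
  moreover have "lattice_simplex (?d - 1) ?Q"
    unfolding lattice_simplex_def lattice_polytope_def
  proof (intro conjI)
    show "int (?d - 1) simplex ?Q"
      unfolding simplex_def using indep card d by (intro exI[of _ ?C]) (simp add: of_nat_diff Suc_le_eq)
    show "polytope ?Q" by (intro polytope_convex_hull) simp
    show "vertices ?Q \<subseteq> int_lattice"
      using extreme_point_of_convex_hull w_lat unfolding vertices_def by blast
  qed
  moreover have "unimodular_equiv (convex hull (v ` {..?d})) (iterated_pyr (?d - 1) (?d - (?d - 1)) ?Q)"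
  proof -
    have "?d - (?d - 1) = Suc 0" using d by simp
    then have "iterated_pyr (?d - 1) (?d - (?d - 1)) ?Q = convex hull (?Q \<union> {std_basis ?d})"
      using d by (simp add: pyr_def)
    also have "\<dots> = convex hull (?C \<union> {w i0})" by (simp add: n w_i0 hull_Un_left[symmetric] del: Un_insert_right)
    also have "?C \<union> {w i0} = (\<lambda>x. H x + H (- v j0)) ` (v ` {..?d})"
      using i0(1) by (auto simp: w_def)
    also have "convex hull \<dots> = (\<lambda>x. H x + H (- v j0)) ` (convex hull (v ` {..?d}))"
      by (simp add: convex_hull_affine_image[OF linH])
    finally have eq: "iterated_pyr (?d - 1) (?d - (?d - 1)) ?Q = \<dots>" .
    have "H (- v j0) \<in> int_lattice"
      using lat[OF j0(1)] imH int_lattice_diff[OF int_lattice_0, of "v j0"] by auto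
    then show ?thesis unfolding eq by (rule lattice_automorphism_unimodular_equiv[OF H(1)])
  qed
  moreover have "?d - 1 < ?d" using d by simp
  ultimately show ?thesis unfolding is_lattice_pyramid_def by blast
qed

section \<open>Heights and the Ehrhart series of a simplex\<close>

lemma finite_bounded_int_lattice:
  fixes S :: "(real ^ 'n) set"
  assumes "bounded S" shows "finite (S \<inter> int_lattice)"
proof -
  obtain B where B: "\<And>x. x \<in> S \<Longrightarrow> norm x \<le> B" using assms by (auto simp: bounded_iff)
  let ?f = "\<lambda>x :: real ^ 'n. \<lambda>i. \<lfloor>x $ i\<rfloor>"
  have "?f ` (S \<inter> int_lattice) \<subseteq> PiE UNIV (\<lambda>_. {- \<lceil>B\<rceil>..\<lceil>B\<rceil>})"
  proof (intro subsetI, elim imageE, clarify)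
    fix x assume x: "x \<in> S" "x \<in> int_lattice"
    show "?f x \<in> PiE UNIV (\<lambda>_. {- \<lceil>B\<rceil>..\<lceil>B\<rceil>})"
    proof (intro PiE_I)
      fix i
      have "\<bar>x $ i\<bar> \<le> B" using B[OF x(1)] component_le_norm_cart[of x i] by linarith
      then show "\<lfloor>x $ i\<rfloor> \<in> {- \<lceil>B\<rceil>..\<lceil>B\<rceil>}" by (simp add: le_floor_iff floor_le_iff) linarith
    qed simp
  qed
  then have "finite (?f ` (S \<inter> int_lattice))" by (rule finite_subset) (intro finite_PiE; simp)
  moreover have "inj_on ?f (S \<inter> int_lattice)"
  proof (rule inj_onI)
    fix x y assume xy: "x \<in> S \<inter> int_lattice" "y \<in> S \<inter> int_lattice" "?f x = ?f y"
    have "x $ i = y $ i" for i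
      using fun_cong[OF xy(3), of i] int_lattice_nth[of x i] int_lattice_nth[of y i] xy(1,2)
      by (metis IntD2 of_int_floor_cancel Ints_cases floor_of_int)
    then show "x = y" by (simp add: vec_eq_iff)
  qed
  ultimately show ?thesis by (rule finite_imageD)
qed

text \<open>
  Vanishing beyond \<open>d\<close> makes a coefficient vector a unique representative, so that such vectors can be counted.
  The same holds for \<open>box_coeffs\<close>.
\<close>

definition dilate_coeffs :: "(nat \<Rightarrow> real ^ 'n) \<Rightarrow> nat \<Rightarrow> (nat \<Rightarrow> real) set" where
  "dilate_coeffs v n = {c \<in> coeff_lattice v. (\<forall>i\<le>CARD('n). 0 \<le> c i) \<and> (\<forall>i>CARD('n). c i = 0) \<and>
     (\<Sum>i\<le>CARD('n). c i) = real n}"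

definition box_coeffs :: "(nat \<Rightarrow> real ^ 'n) \<Rightarrow> (nat \<Rightarrow> real) set" where
  "box_coeffs v = {b \<in> coeff_lattice v. (\<forall>i\<le>CARD('n). 0 \<le> b i \<and> b i < 1) \<and> (\<forall>i>CARD('n). b i = 0)}"

definition box_height :: "nat \<Rightarrow> (nat \<Rightarrow> real) \<Rightarrow> nat" where
  "box_height d b = nat \<lfloor>\<Sum>i\<le>d. b i\<rfloor>"

lemma affinely_independentD:
  fixes v :: "nat \<Rightarrow> real ^ 'n"
  assumes "affinely_independent v" "(\<Sum>i\<le>CARD('n). c i *\<^sub>R v i) = (\<Sum>i\<le>CARD('n). e i *\<^sub>R v i)"
    "(\<Sum>i\<le>CARD('n). c i) = (\<Sum>i\<le>CARD('n). e i)" "i \<le> CARD('n)"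
  shows "c i = e i"
proof -
  have s: "(\<Sum>i\<le>CARD('n). (c i - e i) *\<^sub>R v i) = 0" "(\<Sum>i\<le>CARD('n). c i - e i) = 0"
    using assms(2,3) by (simp_all add: scaleR_diff_left sum_subtractf)
  have "c i - e i = 0"
    by (rule assms(1)[unfolded affinely_independent_def, rule_format, of "\<lambda>i. c i - e i", OF s assms(4)])
  then show ?thesis by simp
qed

lemma lattice_points_of_dilate:
  fixes v :: "nat \<Rightarrow> real ^ 'n"
  assumes ind: "affinely_independent v" and n: "n > 0"
  shows "bij_betw (\<lambda>c. \<Sum>i\<le>CARD('n). c i *\<^sub>R v i) (dilate_coeffs v n)
    ((\<lambda>x. real n *\<^sub>R x) ` (convex hull (v ` {..CARD('n)})) \<inter> int_lattice)"
proof (rule bij_betw_imageI)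
  show "inj_on (\<lambda>c. \<Sum>i\<le>CARD('n). c i *\<^sub>R v i) (dilate_coeffs v n)"
  proof (rule inj_onI)
    fix c e assume ce: "c \<in> dilate_coeffs v n" "e \<in> dilate_coeffs v n"
      "(\<Sum>i\<le>CARD('n). c i *\<^sub>R v i) = (\<Sum>i\<le>CARD('n). e i *\<^sub>R v i)"
    show "c = e"
    proof
      fix i show "c i = e i"
        using ce affinely_independentD[OF ind ce(3), of i] by (cases "i \<le> CARD('n)") (auto simp: dilate_coeffs_def)
    qed
  qed
  show "(\<lambda>c. \<Sum>i\<le>CARD('n). c i *\<^sub>R v i) ` dilate_coeffs v n =
      (\<lambda>x. real n *\<^sub>R x) ` (convex hull (v ` {..CARD('n)})) \<inter> int_lattice" (is "?L = ?R")
  proof (intro equalityI subsetI)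
    fix x assume "x \<in> ?L"
    then obtain c where c: "c \<in> dilate_coeffs v n" "x = (\<Sum>i\<le>CARD('n). c i *\<^sub>R v i)" by blast
    have "(\<Sum>i\<le>CARD('n). (c i / real n) *\<^sub>R v i) \<in> convex hull (v ` {..CARD('n)})"
      unfolding convex_hull_image_atMost using c(1) n
      by (intro CollectI exI[of _ "\<lambda>i. c i / real n"]) (auto simp: dilate_coeffs_def simp flip: sum_divide_distrib)
    moreover have "x = real n *\<^sub>R (\<Sum>i\<le>CARD('n). (c i / real n) *\<^sub>R v i)"
      using n by (simp add: c(2) scaleR_sum_right)
    moreover have "x \<in> int_lattice" using c by (simp add: dilate_coeffs_def coeff_lattice_def)
    ultimately show "x \<in> ?R" by blast
  next
    fix x assume x: "x \<in> ?R"
    then obtain c where c: "\<forall>i\<le>CARD('n). 0 \<le> c i" "(\<Sum>i\<le>CARD('n). c i) = 1"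
      "x = real n *\<^sub>R (\<Sum>i\<le>CARD('n). c i *\<^sub>R v i)"
      unfolding convex_hull_image_atMost by blast
    let ?e = "\<lambda>i. if i \<le> CARD('n) then real n * c i else 0"
    have s1: "(\<Sum>i\<le>CARD('n). ?e i *\<^sub>R v i) = x" by (simp add: c(3) scaleR_sum_right)
    have s2: "(\<Sum>i\<le>CARD('n). ?e i) = real n" using c(2) by (simp flip: sum_distrib_left)
    have "?e \<in> dilate_coeffs v n"
      using x c(1) s1 s2 by (simp add: dilate_coeffs_def coeff_lattice_def)
    then show "x \<in> ?L" by (intro image_eqI[where x = "?e"]) (simp_all only: s1)
  qed
qed

lemma dilate_coeffs_0:
  fixes v :: "nat \<Rightarrow> real ^ 'n"
  shows "dilate_coeffs v 0 = {\<lambda>_. 0}"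
proof (intro equalityI subsetI)
  fix c :: "nat \<Rightarrow> real" assume c: "c \<in> dilate_coeffs v 0"
  have "c i = 0" for i
    using c sum_nonneg_eq_0_iff[of "{..CARD('n)}" c] by (cases "i \<le> CARD('n)") (auto simp: dilate_coeffs_def)
  then show "c \<in> {\<lambda>_. 0}" by auto
qed (auto simp: dilate_coeffs_def coeff_lattice_def int_lattice_0)

lemma finite_dilate_coeffs:
  fixes v :: "nat \<Rightarrow> real ^ 'n"
  assumes "affinely_independent v"
  shows "finite (dilate_coeffs v n)"
proof (cases "n = 0")
  case False
  have "bounded ((\<lambda>x. real n *\<^sub>R x) ` (convex hull (v ` {..CARD('n)})))"
    by (intro bounded_scaling bounded_convex_hull finite_imp_bounded) simp
  then have "finite ((\<lambda>x. real n *\<^sub>R x) ` (convex hull (v ` {..CARD('n)})) \<inter> int_lattice)"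
    by (rule finite_bounded_int_lattice)
  then show ?thesis using lattice_points_of_dilate[OF assms] False bij_betw_finite by blast
qed (simp add: dilate_coeffs_0)

lemma box_height_real:
  fixes v :: "nat \<Rightarrow> real ^ 'n"
  assumes "b \<in> box_coeffs v" shows "real (box_height CARD('n) b) = (\<Sum>i\<le>CARD('n). b i)"
proof -
  have "(\<Sum>i\<le>CARD('n). b i) \<ge> 0" using assms by (intro sum_nonneg) (auto simp: box_coeffs_def)
  moreover have "(\<Sum>i\<le>CARD('n). b i) \<in> \<int>" using assms by (simp add: box_coeffs_def coeff_lattice_def)
  ultimately show ?thesis unfolding box_height_def by (metis of_int_floor_cancel Ints_cases floor_of_int of_nat_nat zero_le_floor)
qed

lemma finite_box_coeffs:
  fixes v :: "nat \<Rightarrow> real ^ 'n"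
  assumes "affinely_independent v"
  shows "finite (box_coeffs v)"
proof (rule finite_subset)
  show "box_coeffs v \<subseteq> (\<Union>h\<le>CARD('n) + 1. dilate_coeffs v h)"
  proof
    fix b assume b: "b \<in> box_coeffs v"
    have "(\<Sum>i\<le>CARD('n). b i) \<le> (\<Sum>i\<le>CARD('n). 1)"
      using b by (intro sum_mono) (auto simp: box_coeffs_def less_imp_le)
    then have "real (box_height CARD('n) b) \<le> real (CARD('n) + 1)" by (simp add: box_height_real[OF b])
    then have "box_height CARD('n) b \<le> CARD('n) + 1" by (simp only: of_nat_le_iff)
    moreover have "b \<in> dilate_coeffs v (box_height CARD('n) b)"
      using b box_height_real[OF b] by (auto simp: dilate_coeffs_def box_coeffs_def)
    ultimately show "b \<in> (\<Union>h\<le>CARD('n) + 1. dilate_coeffs v h)" by blast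
  qed
qed (simp add: finite_dilate_coeffs[OF assms])

lemma coeff_lattice_add_int:
  fixes v :: "nat \<Rightarrow> real ^ 'n"
  assumes "\<And>i. i \<le> CARD('n) \<Longrightarrow> v i \<in> int_lattice" "r \<in> coeff_lattice v"
    "\<And>i. i \<le> CARD('n) \<Longrightarrow> s i - r i \<in> \<int>"
  shows "s \<in> coeff_lattice v"
proof -
  have "(\<Sum>i\<le>CARD('n). s i *\<^sub>R v i) = (\<Sum>i\<le>CARD('n). r i *\<^sub>R v i) + (\<Sum>i\<le>CARD('n). (s i - r i) *\<^sub>R v i)"
    by (simp flip: sum.distrib scaleR_left_distrib)
  moreover have "(\<Sum>i\<le>CARD('n). (s i - r i) *\<^sub>R v i) \<in> int_lattice"
    using assms by (intro int_lattice_sum int_lattice_scale) auto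
  moreover have "(\<Sum>i\<le>CARD('n). s i) = (\<Sum>i\<le>CARD('n). r i) + (\<Sum>i\<le>CARD('n). s i - r i)"
    by (simp flip: sum.distrib)
  moreover have "(\<Sum>i\<le>CARD('n). s i - r i) \<in> \<int>" using assms(3) by (intro Ints_sum) auto
  ultimately show ?thesis using assms(2) by (simp add: coeff_lattice_def int_lattice_add)
qed

text \<open>
  Fractional parts give an element \<open>b\<close> of the box, and integral parts a list of \<open>d + 1\<close> natural numbers whose
  sum is what the height of \<open>b\<close> leaves of \<open>n\<close>.
\<close>

lemma card_dilate_coeffs:
  fixes v :: "nat \<Rightarrow> real ^ 'n"
  assumes ind: "affinely_independent v" and lat: "\<And>i. i \<le> CARD('n) \<Longrightarrow> v i \<in> int_lattice"
  shows "card (dilate_coeffs v n) = (\<Sum>b\<in>{b \<in> box_coeffs v. box_height CARD('n) b \<le> n}.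
    card (natpermute (n - box_height CARD('n) b) (CARD('n) + 1)))"
proof -
  let ?d = "CARD('n)"
  let ?S = "SIGMA b:{b \<in> box_coeffs v. box_height ?d b \<le> n}. natpermute (n - box_height ?d b) (?d + 1)"
  let ?f = "\<lambda>(b, l). \<lambda>i. if i \<le> ?d then b i + real (l ! i) else 0"
  have "bij_betw ?f ?S (dilate_coeffs v n)"
  proof (rule bij_betw_imageI)
    show "inj_on ?f ?S"
    proof (rule inj_onI, clarify)
      fix b l b' l'
      assume b: "b \<in> box_coeffs v" "b' \<in> box_coeffs v"
        and l: "l \<in> natpermute (n - box_height ?d b) (?d + 1)" "l' \<in> natpermute (n - box_height ?d b') (?d + 1)"
        and eq: "(\<lambda>i. if i \<le> ?d then b i + real (l ! i) else 0) = (\<lambda>i. if i \<le> ?d then b' i + real (l' ! i) else 0)"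
      have both: "b i = b' i \<and> l ! i = l' ! i" if i: "i \<le> ?d" for i
      proof -
        have e: "b i + real (l ! i) = b' i + real (l' ! i)" using fun_cong[OF eq, of i] i by simp
        have "0 \<le> b i" "b i < 1" "0 \<le> b' i" "b' i < 1" using b i by (auto simp: box_coeffs_def)
        then have "\<bar>real (l ! i) - real (l' ! i)\<bar> < 1" using e by linarith
        then have "l ! i = l' ! i" by linarith
        then show ?thesis using e by simp
      qed
      have "b = b'"
      proof
        fix i show "b i = b' i" using both[of i] b by (cases "i \<le> ?d") (auto simp: box_coeffs_def)
      qed
      moreover have "l = l'" using both l by (intro nth_equalityI) (auto simp: natpermute_def)
      ultimately show "b = b' \<and> l = l'" by simp
    qed
    show "?f ` ?S = dilate_coeffs v n"
    proof (intro equalityI subsetI)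
      fix c assume "c \<in> ?f ` ?S"
      then obtain b l where b: "b \<in> box_coeffs v" "box_height ?d b \<le> n"
        and l: "l \<in> natpermute (n - box_height ?d b) (?d + 1)"
        and c: "c = (\<lambda>i. if i \<le> ?d then b i + real (l ! i) else 0)" by auto
      have "(\<Sum>i\<le>?d. c i) = (\<Sum>i\<le>?d. b i) + real (\<Sum>i\<le>?d. l ! i)"
        by (simp add: c sum.distrib)
      also have "(\<Sum>i\<le>?d. l ! i) = n - box_height ?d b"
        using l by (auto simp: natpermute_def sum_list_sum_nth atLeast0LessThan simp flip: lessThan_Suc_atMost)
      finally have "(\<Sum>i\<le>?d. c i) = real n" using b(2) by (simp add: box_height_real[OF b(1), symmetric])
      moreover have "c \<in> coeff_lattice v"
        by (rule coeff_lattice_add_int[where r = b, OF lat]) (use b(1) in \<open>auto simp: c box_coeffs_def\<close>)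
      ultimately show "c \<in> dilate_coeffs v n"
        using b(1) by (auto simp: dilate_coeffs_def box_coeffs_def c)
    next
      fix c assume c: "c \<in> dilate_coeffs v n"
      define b where "b = (\<lambda>i. if i \<le> ?d then frac (c i) else 0)"
      define l where "l = map (\<lambda>i. nat \<lfloor>c i\<rfloor>) [0..<?d + 1]"
      have cb: "c i = b i + real (l ! i)" if "i \<le> ?d" for i
        using that c by (simp add: b_def l_def frac_def dilate_coeffs_def nth_append del: upt_Suc)
      have "b \<in> coeff_lattice v"
        by (rule coeff_lattice_add_int[where r = c, OF lat]) (use c in \<open>auto simp: b_def frac_def dilate_coeffs_def\<close>)
      then have bb: "b \<in> box_coeffs v" by (auto simp: box_coeffs_def b_def frac_lt_1)
      have "real (\<Sum>i\<le>?d. l ! i) + real (box_height ?d b) = real n"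
        using c cb by (simp add: box_height_real[OF bb] dilate_coeffs_def flip: sum.distrib) (metis (no_types, lifting) add.commute atMost_iff sum.cong)
      then have s: "(\<Sum>i\<le>?d. l ! i) + box_height ?d b = n" by (simp only: of_nat_add [symmetric] of_nat_eq_iff)
      have "length l = ?d + 1" by (simp add: l_def)
      then have "l \<in> natpermute (n - box_height ?d b) (?d + 1)"
        using s by (auto simp: natpermute_def sum_list_sum_nth atLeast0LessThan simp flip: lessThan_Suc_atMost)
      moreover have "c = ?f (b, l)" using cb c by (auto simp: dilate_coeffs_def fun_eq_iff)
      ultimately show "c \<in> ?f ` ?S" using bb s by (intro image_eqI[of _ _ "(b, l)"]) auto
    qed
  qed
  then have "card (dilate_coeffs v n) = card ?S" by (simp add: bij_betw_same_card)
  also have "\<dots> = (\<Sum>b\<in>{b \<in> box_coeffs v. box_height ?d b \<le> n}. card (natpermute (n - box_height ?d b) (?d + 1)))"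
    using finite_box_coeffs[OF ind] by (intro card_SigmaI) (auto simp: natpermute_finite)
  finally show ?thesis .
qed

text \<open>
  \<open>natpermute n m\<close> is the set of lists of \<open>m\<close> natural numbers with sum \<open>n\<close>, so the numbers of integral parts
  are the coefficients of a power of the geometric series.
\<close>

lemma geometric_fps_power_nth:
  "fps_nth (Abs_fps (\<lambda>_. 1 :: int) ^ Suc m) n = int (card (natpermute n (Suc m)))"
  by (simp add: fps_power_nth del: power_Suc)

lemma one_minus_X_mult_geometric: "(1 - fps_X) * Abs_fps (\<lambda>_. 1 :: int) = 1"
  by (rule fps_ext) (simp add: left_diff_distrib)

text \<open>
  The box contains one representative of each element of \<open>\<Lambda>\<close>, and the integral parts contribute
  \<open>1 / (1 - t) ^ (d + 1)\<close>.
\<close>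

theorem delta_series_simplex:
  fixes v :: "nat \<Rightarrow> real ^ 'n"
  assumes ind: "affinely_independent v" and lat: "\<And>i. i \<le> CARD('n) \<Longrightarrow> v i \<in> int_lattice"
  shows "delta_series (convex hull (v ` {..CARD('n)})) = (\<Sum>b\<in>box_coeffs v. fps_X ^ box_height CARD('n) b)"
proof -
  let ?d = "CARD('n)" and ?G = "Abs_fps (\<lambda>_. 1 :: int)"
  let ?P = "convex hull (v ` {..?d})"
  have "Abs_fps (\<lambda>n. if n = 0 then 1 else int (card ((\<lambda>x. real n *\<^sub>R x) ` ?P \<inter> int_lattice)))
     = (\<Sum>b\<in>box_coeffs v. fps_X ^ box_height ?d b) * ?G ^ (?d + 1)"
  proof (rule fps_ext)
    fix n
    have "(if n = 0 then 1 else int (card ((\<lambda>x. real n *\<^sub>R x) ` ?P \<inter> int_lattice))) = int (card (dilate_coeffs v n))"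
      using bij_betw_same_card[OF lattice_points_of_dilate[OF ind, of n]] by (simp add: dilate_coeffs_0)
    also have "\<dots> = (\<Sum>b\<in>{b \<in> box_coeffs v. box_height ?d b \<le> n}. int (card (natpermute (n - box_height ?d b) (?d + 1))))"
      by (simp add: card_dilate_coeffs[OF ind lat])
    also have "\<dots> = (\<Sum>b\<in>box_coeffs v. fps_nth (fps_X ^ box_height ?d b * ?G ^ (?d + 1)) n)"
      using finite_box_coeffs[OF ind]
      by (intro sum.mono_neutral_cong_left)
        (auto simp: fps_X_power_mult_nth geometric_fps_power_nth simp del: power_Suc)
    also have "\<dots> = fps_nth ((\<Sum>b\<in>box_coeffs v. fps_X ^ box_height ?d b) * ?G ^ (?d + 1)) n"
      by (simp add: sum_distrib_right fps_sum_nth)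
    finally show "fps_nth (Abs_fps (\<lambda>n. if n = 0 then 1 else int (card ((\<lambda>x. real n *\<^sub>R x) ` ?P \<inter> int_lattice)))) n =
      fps_nth ((\<Sum>b\<in>box_coeffs v. fps_X ^ box_height ?d b) * ?G ^ (?d + 1)) n" by simp
  qed
  then have "delta_series ?P = (\<Sum>b\<in>box_coeffs v. fps_X ^ box_height ?d b) * ((1 - fps_X) * ?G) ^ (?d + 1)"
    unfolding delta_series_def by (simp only: power_mult_distrib mult_ac)
  then show ?thesis by (simp add: one_minus_X_mult_geometric)
qed

lemma card_box_coeffs_of_height:
  fixes v :: "nat \<Rightarrow> real ^ 'n"
  assumes ind: "affinely_independent v" and lat: "\<And>i. i \<le> CARD('n) \<Longrightarrow> v i \<in> int_lattice"
    and \<delta>: "is_delta_poly (convex hull (v ` {..CARD('n)})) f"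
  shows "int (card {b \<in> box_coeffs v. box_height CARD('n) b = n}) = coeff f n"
proof -
  have "coeff f n = fps_nth (\<Sum>b\<in>box_coeffs v. fps_X ^ box_height CARD('n) b) n"
    using \<delta> delta_series_simplex[OF ind lat] unfolding is_delta_poly_def by (metis fps_of_poly_nth)
  also have "\<dots> = (\<Sum>b\<in>box_coeffs v. if box_height CARD('n) b = n then 1 else 0)"
    by (simp add: fps_sum_nth fps_X_power_iff eq_commute)
  also have "\<dots> = int (card {b \<in> box_coeffs v. box_height CARD('n) b = n})"
    using finite_box_coeffs[OF ind] by (simp add: sum.If_cases Int_def)
  finally show ?thesis ..
qed

lemma height_graded_coeff_lattice:
  fixes v :: "nat \<Rightarrow> real ^ 'n"
  assumes ind: "affinely_independent v" and lat: "\<And>i. i \<le> CARD('n) \<Longrightarrow> v i \<in> int_lattice"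
    and \<delta>: "is_delta_poly (convex hull (v ` {..CARD('n)})) (\<Sum>j<N. monom 1 (j * k))" and k: "k > 0"
  shows "height_graded CARD('n) N k (coeff_lattice v)"
proof
  let ?d = "CARD('n)"
  let ?box = "\<lambda>r i. if i \<le> ?d then frac (r i) else 0"
  have card: "int (card {b \<in> box_coeffs v. box_height ?d b = n}) = (\<Sum>j<N. if j * k = n then 1 else 0)" for n
    using card_box_coeffs_of_height[OF ind lat \<delta>, of n] by (simp add: coeff_sum)
  have card1: "card {b \<in> box_coeffs v. box_height ?d b = j * k} = 1" if "j < N" for j
  proof -
    have "(\<Sum>l<N. if l * k = j * k then 1 else 0 :: int) = (\<Sum>l<N. if l = j then 1 else 0)"
      using k by (intro sum.cong) auto
    then have "int (card {b \<in> box_coeffs v. box_height ?d b = j * k}) = 1" using card[of "j * k"] that by simp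
    then show ?thesis by simp
  qed
  have box: "?box r \<in> box_coeffs v" "real (box_height ?d (?box r)) = frac_height ?d r" if "r \<in> coeff_lattice v" for r
  proof -
    have "?box r \<in> coeff_lattice v"
      by (rule coeff_lattice_add_int[OF lat that]) (auto simp: frac_def)
    then show mem: "?box r \<in> box_coeffs v" by (auto simp: box_coeffs_def frac_lt_1)
    show "real (box_height ?d (?box r)) = frac_height ?d r"
      using box_height_real[OF mem] by (simp add: frac_height_def)
  qed
  have height: "frac_height ?d b = real (box_height ?d b)" if "b \<in> box_coeffs v" for b
    unfolding box_height_real[OF that] frac_height_def
    using that by (intro sum.cong) (auto simp: box_coeffs_def frac_eq)
  have val: "\<exists>j<N. box_height ?d b = j * k" if b: "b \<in> box_coeffs v" for b
  proof (rule ccontr)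
    assume neg: "\<not> (\<exists>j<N. box_height ?d b = j * k)"
    have "(\<Sum>j<N. if j * k = box_height ?d b then 1 else 0 :: int) = 0"
      using neg by (intro sum.neutral) auto
    then have "card {b' \<in> box_coeffs v. box_height ?d b' = box_height ?d b} = 0" using card[of "box_height ?d b"] by simp
    then show False using b finite_box_coeffs[OF ind] by auto
  qed
  show "k > 0" by (rule k)
  show "r \<in> coeff_lattice v" if "\<And>i. i \<le> ?d \<Longrightarrow> r i \<in> \<int>" for r
    by (rule coeff_lattice_add_int[where r = "\<lambda>_. 0"]) (use lat that in \<open>auto simp: coeff_lattice_def int_lattice_0\<close>)
  show "(\<lambda>i. r i - s i) \<in> coeff_lattice v" if "r \<in> coeff_lattice v" "s \<in> coeff_lattice v" for r s
    using that by (simp add: coeff_lattice_def scaleR_diff_left sum_subtractf int_lattice_diff)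
  show "\<exists>j<N. frac_height ?d r = real (j * k)" if "r \<in> coeff_lattice v" for r
    using val[OF box(1)[OF that]] box(2)[OF that] by metis
  show "\<exists>r\<in>coeff_lattice v. frac_height ?d r = real (j * k)" if jN: "j < N" for j
  proof -
    obtain b where "b \<in> box_coeffs v" "box_height ?d b = j * k"
      using card1[OF jN] by (metis (mono_tags, lifting) card_1_singletonE mem_Collect_eq singletonI)
    then show ?thesis using height[of b] by (intro bexI[of _ b]) (auto simp: box_coeffs_def)
  qed
  show "r i - s i \<in> \<int>"
    if rs: "r \<in> coeff_lattice v" "s \<in> coeff_lattice v" "frac_height ?d r = frac_height ?d s" and i: "i \<le> ?d" for r s i
  proof -
    obtain j where j: "j < N" "box_height ?d (?box r) = j * k" using val[OF box(1)[OF rs(1)]] by blast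
    have "box_height ?d (?box s) = j * k" using j(2) box(2)[OF rs(1)] box(2)[OF rs(2)] rs(3) by (metis of_nat_eq_iff)
    then have "?box r \<in> {b \<in> box_coeffs v. box_height ?d b = j * k}" "?box s \<in> {b \<in> box_coeffs v. box_height ?d b = j * k}"
      using box(1)[OF rs(1)] box(1)[OF rs(2)] j(2) by blast+
    moreover obtain b0 where "{b \<in> box_coeffs v. box_height ?d b = j * k} = {b0}"
      using card1[OF j(1)] by (rule card_1_singletonE)
    ultimately have "?box r = ?box s" by simp
    then have "frac (r i) = frac (s i)" using fun_cong[of "?box r" "?box s" i] i by simp
    then have "r i - s i = of_int (\<lfloor>r i\<rfloor> - \<lfloor>s i\<rfloor>)" by (simp add: frac_def)
    then show ?thesis by (simp only: Ints_of_int)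
  qed
qed

section \<open>Recognising the model simplices\<close>

text \<open>
  Generators with equal multisets of coordinates differ by a permutation of the coordinates, and
  renumbering the vertices of the second simplex by it makes the coefficient lattices equal.
\<close>

lemma unimodular_equiv_if_cyclic:
  fixes v v' :: "nat \<Rightarrow> real ^ 'n"
  assumes ind: "affinely_independent v"
    and v: "coeff_lattice v = cyclic_mod_int CARD('n) g" and v': "coeff_lattice v' = cyclic_mod_int CARD('n) g'"
    and eq: "image_mset g (mset_set {..CARD('n)}) = image_mset g' (mset_set {..CARD('n)})"
  shows "unimodular_equiv (convex hull (v ` {..CARD('n)})) (convex hull (v' ` {..CARD('n)}))"
proof -
  let ?d = "CARD('n)"
  have "mset (map g [0..<?d + 1]) = mset (map g' [0..<?d + 1])"
    using eq by (simp add: atLeast0LessThan lessThan_Suc_atMost del: upt_Suc)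
  then obtain \<sigma> where \<sigma>: "\<sigma> permutes {..<length (map g' [0..<?d + 1])}"
    "permute_list \<sigma> (map g' [0..<?d + 1]) = map g [0..<?d + 1]"
    by (rule mset_eq_permutation)
  then have perm: "\<sigma> permutes {..?d}" by (simp add: lessThan_Suc_atMost)
  have g: "g i = g' (\<sigma> i)" if "i \<le> ?d" for i
  proof -
    have "\<sigma> i \<le> ?d" using permutes_in_image[OF perm, of i] that by simp
    moreover have "map g [0..<?d + 1] ! i = map g' [0..<?d + 1] ! \<sigma> i"
      unfolding \<sigma>(2)[symmetric] using that by (intro permute_list_nth[OF \<sigma>(1)]) simp
    ultimately show ?thesis using that by (simp del: upt_Suc)
  qed
  define \<tau> where "\<tau> = inv_into UNIV \<sigma>"
  note inverses = permutes_inverses[OF perm, folded \<tau>_def]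
  have "coeff_lattice (v' \<circ> \<sigma>) = coeff_lattice v"
  proof -
    have "r \<in> coeff_lattice (v' \<circ> \<sigma>) \<longleftrightarrow> r \<in> coeff_lattice v" for r :: "nat \<Rightarrow> real"
    proof -
      have s: "(\<Sum>i\<le>?d. r i *\<^sub>R (v' \<circ> \<sigma>) i) = (\<Sum>j\<le>?d. r (\<tau> j) *\<^sub>R v' j)"
        "(\<Sum>i\<le>?d. r i) = (\<Sum>j\<le>?d. r (\<tau> j))"
        using sum.permute[OF perm, of "\<lambda>j. r (\<tau> j) *\<^sub>R v' j"] sum.permute[OF perm, of "\<lambda>j. r (\<tau> j)"]
        by (simp_all add: o_def inverses)
      have "r \<in> coeff_lattice (v' \<circ> \<sigma>) \<longleftrightarrow> (\<lambda>j. r (\<tau> j)) \<in> coeff_lattice v'"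
        unfolding coeff_lattice_def by (simp only: s mem_Collect_eq)
      also have "\<dots> \<longleftrightarrow> (\<exists>m::int. \<forall>j\<le>?d. r (\<tau> j) - of_int m * g' j \<in> \<int>)"
        by (simp add: v' cyclic_mod_int_def)
      also have "\<dots> \<longleftrightarrow> (\<exists>m::int. \<forall>i\<le>?d. r i - of_int m * g i \<in> \<int>)"
      proof (intro ex_cong1 iffI allI impI)
        fix m :: int and i assume "\<forall>j\<le>?d. r (\<tau> j) - of_int m * g' j \<in> \<int>" "i \<le> ?d"
        then show "r i - of_int m * g i \<in> \<int>"
          using permutes_in_image[OF perm, of i] g[of i] by (auto simp: inverses dest: spec[of _ "\<sigma> i"])
      next
        fix m :: int and j assume *: "\<forall>i\<le>?d. r i - of_int m * g i \<in> \<int>" "j \<le> ?d"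
        have "\<tau> j \<le> ?d" using permutes_in_image[OF permutes_inv[OF perm, folded \<tau>_def], of j] *(2) by simp
        then show "r (\<tau> j) - of_int m * g' j \<in> \<int>"
          using *(1) g[of "\<tau> j"] by (auto simp: inverses dest: spec[of _ "\<tau> j"])
      qed
      also have "\<dots> \<longleftrightarrow> r \<in> coeff_lattice v" by (simp add: v cyclic_mod_int_def)
      finally show ?thesis .
    qed
    then show ?thesis by blast
  qed
  then have "unimodular_equiv (convex hull (v ` {..?d})) (convex hull ((v' \<circ> \<sigma>) ` {..?d}))"
    using unimodular_equiv_if_coeff_lattice_eq[OF ind] by metis
  also have "(v' \<circ> \<sigma>) ` {..?d} = v' ` {..?d}" by (simp only: image_comp[symmetric] permutes_image[OF perm])
  finally show ?thesis .
qed

lemma std_basis_combination_in_int_lattice: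
  "(\<Sum>i\<in>{1..CARD('n)}. m i *\<^sub>R (std_basis i :: real ^ 'n::{finite,linorder})) \<in> int_lattice \<longleftrightarrow> (\<forall>i\<in>{1..CARD('n)}. m i \<in> \<int>)"
proof -
  let ?e = "\<lambda>i. sorted_list_of_set (UNIV :: 'n set) ! (i - 1)"
  note bij = sorted_list_UNIV_bij[where 'n = 'n]
  have nth: "(\<Sum>i\<in>{1..CARD('n)}. m i *\<^sub>R (std_basis i :: (real, 'n) vec)) $ ?e j = m j" if j: "j \<in> {1..CARD('n)}" for j
  proof -
    have "(\<Sum>i\<in>{1..CARD('n)}. m i *\<^sub>R (std_basis i :: (real, 'n) vec)) $ ?e j = (\<Sum>i\<in>{1..CARD('n)}. if i = j then m i else 0)"
      unfolding sum_component
    proof (rule sum.cong)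
      fix i assume i: "i \<in> {1..CARD('n)}"
      have "?e i = ?e j \<longleftrightarrow> i = j" using inj_on_eq_iff[OF bij_betw_imp_inj_on[OF bij] i j] .
      then show "(m i *\<^sub>R (std_basis i :: (real, 'n) vec)) $ ?e j = (if i = j then m i else 0)"
        by (auto simp: std_basis_def axis_def)
    qed simp
    then show ?thesis using j by simp
  qed
  have "(\<forall>l\<in>?e ` {1..CARD('n)}. (\<Sum>i\<in>{1..CARD('n)}. m i *\<^sub>R (std_basis i :: (real, 'n) vec)) $ l \<in> \<int>) \<longleftrightarrow>
      (\<forall>j\<in>{1..CARD('n)}. (\<Sum>i\<in>{1..CARD('n)}. m i *\<^sub>R (std_basis i :: (real, 'n) vec)) $ ?e j \<in> \<int>)"
    by blast
  also have "\<dots> \<longleftrightarrow> (\<forall>j\<in>{1..CARD('n)}. m j \<in> \<int>)" using nth by (intro ball_cong) simp_all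
  finally show ?thesis
    unfolding bij_betw_imp_surj_on[OF bij] int_lattice_def by simp
qed

text \<open>
  The coordinates of \<open>seq_vertex A\<close>, numbered from \<open>1\<close>.
\<close>

definition seq_coord :: "int list \<Rightarrow> nat \<Rightarrow> int" where
  "seq_coord A i = (if i < length A then last A - A ! (i - 1) else if i = length A then last A else 0)"

lemma seq_vertex_eq_sum:
  assumes "0 < length A" "length A \<le> CARD('n)"
  shows "(seq_vertex A :: real ^ 'n::{finite,linorder}) = (\<Sum>i\<in>{1..CARD('n)}. of_int (seq_coord A i) *\<^sub>R std_basis i)"
proof -
  let ?f = "\<lambda>i. of_int (seq_coord A i) *\<^sub>R (std_basis i :: (real, 'n) vec)"
  have "(\<Sum>i\<in>{1..CARD('n)}. ?f i) = (\<Sum>i\<in>{1..length A}. ?f i)"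
    using assms(2) by (intro sum.mono_neutral_right) (auto simp: seq_coord_def)
  also have "{1..length A} = insert (length A) {1..<length A}" using assms(1) by (auto simp: Suc_le_eq)
  also have "(\<Sum>i\<in>\<dots>. ?f i) = ?f (length A) + (\<Sum>i\<in>{1..<length A}. ?f i)" by simp
  also have "(\<Sum>i\<in>{1..<length A}. ?f i) = (\<Sum>i = 1..<length A. real_of_int (last A - A ! (i - 1)) *\<^sub>R std_basis i)"
    by (intro sum.cong) (auto simp: seq_coord_def)
  finally show ?thesis by (simp add: seq_vertex_def seq_coord_def)
qed

definition simplex_A_vertex :: "int list \<Rightarrow> nat \<Rightarrow> real ^ 'n::{finite,linorder}" where
  "simplex_A_vertex A i = (if i = 0 then 0 else if i < CARD('n) then std_basis i else seq_vertex A)"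

definition simplex_BC_vertex :: "int list \<Rightarrow> int list \<Rightarrow> nat \<Rightarrow> real ^ 'n::{finite,linorder}" where
  "simplex_BC_vertex B C i = (if i = 0 then 0 else if i = length B then seq_vertex B
     else if i < CARD('n) then std_basis i else seq_vertex C)"

lemma simplex_A_eq: "simplex_A A = convex hull (simplex_A_vertex A ` {..CARD('n)} :: (real ^ 'n::{finite,linorder}) set)"
proof -
  have "{..CARD('n)} = {0} \<union> {1..CARD('n) - 1} \<union> {CARD('n)}" by auto
  then have "simplex_A_vertex A ` {..CARD('n)} = 
      simplex_A_vertex A ` {0} \<union> simplex_A_vertex A ` {1..CARD('n) - 1} \<union> (simplex_A_vertex A ` {CARD('n)} :: ((real, 'n) vec) set)"
    by (metis image_Un)
  moreover have "simplex_A_vertex A ` {1..CARD('n) - 1} = (std_basis ` {1..CARD('n) - 1} :: ((real, 'n) vec) set)"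
    by (intro image_cong) (auto simp: simplex_A_vertex_def)
  moreover have "simplex_A_vertex A ` {0} = {0 :: (real, 'n) vec}"
    "simplex_A_vertex A ` {CARD('n)} = {seq_vertex A :: (real, 'n) vec}"
    by (simp_all add: simplex_A_vertex_def)
  ultimately show ?thesis unfolding simplex_A_def by (simp only:)
qed

lemma simplex_BC_eq:
  assumes "0 < length B" "length B < CARD('n)"
  shows "simplex_BC B C = convex hull (simplex_BC_vertex B C ` {..CARD('n)} :: (real ^ 'n::{finite,linorder}) set)"
proof -
  let ?v = "simplex_BC_vertex B C :: nat \<Rightarrow> (real, 'n) vec"
  have "{..CARD('n)} = {0} \<union> ({1..CARD('n) - 1} - {length B}) \<union> {length B, CARD('n)}" using assms by auto
  then have "?v ` {..CARD('n)} = ?v ` {0} \<union> ?v ` ({1..CARD('n) - 1} - {length B}) \<union> ?v ` {length B, CARD('n)}"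
    by (metis image_Un)
  moreover have "?v ` ({1..CARD('n) - 1} - {length B}) = std_basis ` ({1..CARD('n) - 1} - {length B})"
    by (intro image_cong) (auto simp: simplex_BC_vertex_def)
  moreover have "?v ` {length B, CARD('n)} = {seq_vertex B, seq_vertex C}"
    using assms by (auto simp: simplex_BC_vertex_def)
  moreover have "?v ` {0} = {0}" by (simp add: simplex_BC_vertex_def)
  ultimately show ?thesis unfolding simplex_BC_def by (simp only:)
qed

lemma sum_atMost_eq_first_plus: "(\<Sum>i\<le>d. f i) = f 0 + (\<Sum>i\<in>{1..d}. f i :: 'a::comm_monoid_add)" for d :: nat
  by (simp add: atMost_atLeast0 sum.atLeast_Suc_atMost)

lemma coeff_lattice_simplex_A:
  fixes A :: "int list" and r :: "nat \<Rightarrow> real"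
  assumes "length A = CARD('n::{finite,linorder})"
  shows "r \<in> coeff_lattice (simplex_A_vertex A :: nat \<Rightarrow> (real, 'n) vec) \<longleftrightarrow>
    (\<forall>i\<in>{1..<CARD('n)}. r i + r CARD('n) * of_int (last A - A ! (i - 1)) \<in> \<int>) \<and>
    r CARD('n) * of_int (last A) \<in> \<int> \<and> (\<Sum>i\<le>CARD('n). r i) \<in> \<int>"
proof -
  let ?d = "CARD('n)" and ?v = "simplex_A_vertex A :: nat \<Rightarrow> (real, 'n) vec"
  define m where "m i = (if i < ?d then r i else 0) + r ?d * of_int (seq_coord A i)" for i
  have d: "?d > 0" by simp
  have "(\<Sum>i\<le>?d. r i *\<^sub>R ?v i) = (\<Sum>i\<in>{1..?d}. r i *\<^sub>R ?v i)"
    unfolding sum_atMost_eq_first_plus by (simp add: simplex_A_vertex_def)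
  also have "\<dots> = (\<Sum>i\<in>{1..?d}. (if i < ?d then r i else 0) *\<^sub>R std_basis i + (if i = ?d then r ?d *\<^sub>R seq_vertex A else 0))"
    by (intro sum.cong) (auto simp: simplex_A_vertex_def)
  also have "\<dots> = (\<Sum>i\<in>{1..?d}. (if i < ?d then r i else 0) *\<^sub>R std_basis i) + r ?d *\<^sub>R seq_vertex A"
    using d by (simp add: sum.distrib Suc_le_eq)
  also have "\<dots> = (\<Sum>i\<in>{1..?d}. m i *\<^sub>R std_basis i)"
    using d assms by (simp add: seq_vertex_eq_sum m_def scaleR_sum_right scaleR_left_distrib sum.distrib)
  finally have "r \<in> coeff_lattice ?v \<longleftrightarrow> (\<forall>i\<in>{1..?d}. m i \<in> \<int>) \<and> (\<Sum>i\<le>?d. r i) \<in> \<int>"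
    by (simp only: coeff_lattice_def mem_Collect_eq std_basis_combination_in_int_lattice)
  moreover have "{1..?d} = insert ?d {1..<?d}" using d by auto
  moreover have "m ?d = r ?d * of_int (last A)" by (simp add: m_def seq_coord_def assms)
  moreover have "m i = r i + r ?d * of_int (last A - A ! (i - 1))" if "i \<in> {1..<?d}" for i
    using that by (simp add: m_def seq_coord_def assms)
  ultimately show ?thesis by auto
qed

lemma coeff_lattice_simplex_BC:
  fixes B C :: "int list" and r :: "nat \<Rightarrow> real"
  assumes len: "0 < length B" "length B < CARD('n::{finite,linorder})" "length C = CARD('n)"
  shows "r \<in> coeff_lattice (simplex_BC_vertex B C :: nat \<Rightarrow> (real, 'n) vec) \<longleftrightarrow>
    (\<forall>i\<in>{1..CARD('n)}. (if i = length B \<or> i = CARD('n) then 0 else r i) + r (length B) * of_int (seq_coord B i)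
       + r CARD('n) * of_int (seq_coord C i) \<in> \<int>) \<and> (\<Sum>i\<le>CARD('n). r i) \<in> \<int>"
proof -
  let ?d = "CARD('n)" and ?s = "length B" and ?v = "simplex_BC_vertex B C :: nat \<Rightarrow> (real, 'n) vec"
  let ?r = "\<lambda>i. if i = ?s \<or> i = ?d then 0 else r i"
  define m where "m i = ?r i + r ?s * of_int (seq_coord B i) + r ?d * of_int (seq_coord C i)" for i
  have "(\<Sum>i\<le>?d. r i *\<^sub>R ?v i) = (\<Sum>i\<in>{1..?d}. r i *\<^sub>R ?v i)"
    unfolding sum_atMost_eq_first_plus by (simp add: simplex_BC_vertex_def)
  also have "\<dots> = (\<Sum>i\<in>{1..?d}. ?r i *\<^sub>R std_basis i + (if i = ?s then r ?s *\<^sub>R seq_vertex B else 0)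
      + (if i = ?d then r ?d *\<^sub>R seq_vertex C else 0))"
    using len by (intro sum.cong) (auto simp: simplex_BC_vertex_def)
  also have "\<dots> = (\<Sum>i\<in>{1..?d}. ?r i *\<^sub>R std_basis i) + r ?s *\<^sub>R seq_vertex B + r ?d *\<^sub>R seq_vertex C"
    using len by (simp add: sum.distrib Suc_le_eq)
  also have "\<dots> = (\<Sum>i\<in>{1..?d}. m i *\<^sub>R std_basis i)"
    using len by (simp add: seq_vertex_eq_sum m_def scaleR_sum_right scaleR_left_distrib sum.distrib)
  finally show ?thesis
    by (simp only: coeff_lattice_def mem_Collect_eq std_basis_combination_in_int_lattice m_def)
qed

text \<open>
  The coefficient of the vertex \<open>0\<close> enters only through the coefficient sum, so its congruence
  follows from the others.
\<close>

lemma sum_cyclic_first_coordinate: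
  fixes r g :: "nat \<Rightarrow> real"
  assumes "(\<Sum>i\<le>d. r i) \<in> \<int>" "(\<Sum>i\<le>d. g i) \<in> \<int>" "\<And>i. i \<in> {1..d} \<Longrightarrow> r i - of_int j * g i \<in> \<int>"
  shows "r 0 - of_int j * g 0 \<in> \<int>"
proof -
  have "(\<Sum>i\<le>d. r i) - of_int j * (\<Sum>i\<le>d. g i) - (\<Sum>i\<in>{1..d}. r i - of_int j * g i) = r 0 - of_int j * g 0"
    by (simp add: sum_atMost_eq_first_plus sum_subtractf sum_distrib_left algebra_simps)
  moreover have "(\<Sum>i\<in>{1..d}. r i - of_int j * g i) \<in> \<int>" using assms(3) by (intro Ints_sum)
  ultimately show ?thesis using assms(1,2) by (metis Ints_diff Ints_mult Ints_of_int)
qed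

lemma sum_cyclic_in_Ints:
  fixes r g :: "nat \<Rightarrow> real"
  assumes "(\<Sum>i\<le>d. g i) \<in> \<int>" "\<And>i. i \<le> d \<Longrightarrow> r i - of_int j * g i \<in> \<int>"
  shows "(\<Sum>i\<le>d. r i) \<in> \<int>"
proof -
  have "(\<Sum>i\<le>d. r i) = (\<Sum>i\<le>d. r i - of_int j * g i) + of_int j * (\<Sum>i\<le>d. g i)"
    by (simp add: sum_subtractf sum_distrib_left)
  moreover have "(\<Sum>i\<le>d. r i - of_int j * g i) \<in> \<int>" using assms(2) by (intro Ints_sum) auto
  ultimately show ?thesis using assms(1) by simp
qed

text \<open>
  Integrality forces \<open>r d\<close> to be \<open>j / a\<close> for an integer \<open>j\<close>, and then every \<open>r i\<close> is congruent to
  \<open>j * A ! (i - 1) / a\<close>.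
\<close>

lemma coeff_lattice_simplex_A_cyclic:
  fixes A :: "int list"
  assumes len: "length A = CARD('n::{finite,linorder})" and a: "last A = a" "a \<noteq> 0"
    and g: "\<And>i. i \<in> {1..<CARD('n)} \<Longrightarrow> g i = of_int (A ! (i - 1)) / of_int a" "g CARD('n) = 1 / of_int a"
    and sum: "(\<Sum>i\<le>CARD('n). g i) \<in> \<int>"
  shows "coeff_lattice (simplex_A_vertex A :: nat \<Rightarrow> (real, 'n) vec) = cyclic_mod_int CARD('n) g"
proof (intro equalityI subsetI)
  let ?d = "CARD('n)" and ?L = "coeff_lattice (simplex_A_vertex A :: nat \<Rightarrow> (real, 'n) vec)"
  have d: "?d > 0" by simp
  fix r :: "nat \<Rightarrow> real"
  {
    assume "r \<in> ?L"
    then have r: "\<And>i. i \<in> {1..<?d} \<Longrightarrow> r i + r ?d * of_int (a - A ! (i - 1)) \<in> \<int>"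
      "r ?d * of_int a \<in> \<int>" "(\<Sum>i\<le>?d. r i) \<in> \<int>"
      unfolding coeff_lattice_simplex_A[OF len] a(1) by blast+
    from r(2) obtain j where j: "r ?d * of_int a = of_int j" by (elim Ints_cases)
    then have rd: "r ?d = of_int j / of_int a" using a(2) by (simp add: field_simps)
    have pos: "r i - of_int j * g i \<in> \<int>" if "i \<in> {1..?d}" for i
    proof (cases "i = ?d")
      case False
      then have i: "i \<in> {1..<?d}" using that by auto
      have eq: "r i - of_int j * g i = (r i + r ?d * of_int (a - A ! (i - 1))) - of_int j"
        using a(2) by (simp add: g(1)[OF i] rd field_simps)
      show ?thesis unfolding eq by (rule Ints_diff[OF r(1)[OF i] Ints_of_int])
    qed (simp add: g(2) rd)
    show "r \<in> cyclic_mod_int ?d g"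
    proof (rule cyclic_mod_intI)
      fix i assume "i \<le> ?d"
      then show "r i - of_int j * g i \<in> \<int>"
        using pos[of i] sum_cyclic_first_coordinate[OF r(3) sum pos] by (cases "i = 0") auto
    qed
  next
    assume "r \<in> cyclic_mod_int ?d g"
    then obtain j where j: "\<And>i. i \<le> ?d \<Longrightarrow> r i - of_int j * g i \<in> \<int>" unfolding cyclic_mod_int_def by blast
    obtain n where n: "r ?d - of_int j * g ?d = of_int n" using j[of ?d] by (auto elim: Ints_cases)
    then have rd: "r ?d = of_int j / of_int a + of_int n" by (simp add: g(2))
    have "r i + r ?d * of_int (a - A ! (i - 1)) \<in> \<int>" if i: "i \<in> {1..<?d}" for i
    proof -
      have eq: "r i + r ?d * of_int (a - A ! (i - 1)) = (r i - of_int j * g i) + of_int (j + n * (a - A ! (i - 1)))"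
        using a(2) by (simp add: g(1)[OF i] rd field_simps)
      show ?thesis unfolding eq using i by (intro Ints_add[OF j Ints_of_int]) simp
    qed
    moreover have "r ?d * of_int a = of_int (j + n * a)" using a(2) by (simp add: rd field_simps)
    ultimately show "r \<in> ?L"
      unfolding coeff_lattice_simplex_A[OF len] a(1) using sum_cyclic_in_Ints[OF sum j] by (metis Ints_of_int)
  }
qed

text \<open>
  The leading entries \<open>c\<close> of \<open>C\<close> make the first \<open>s\<close> coordinates of the last vertex vanish, so the conditions on
  the coefficients \<open>1, \<dots>, s\<close> and on the remaining ones decouple. They give residues \<open>x\<close> modulo \<open>b\<close> and \<open>y\<close>
  modulo \<open>c\<close>, which are joined by the Chinese remainder theorem.
\<close>

lemma coeff_lattice_simplex_BC_cyclic:
  fixes B C :: "int list" and b c s :: nat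
  assumes B: "B = replicate (s - 1) 1 @ [int b]" and C: "C = replicate s (int c) @ replicate (CARD('n::{finite,linorder}) - s - 1) 1 @ [int c]"
    and s: "0 < s" "s < CARD('n)" and bc: "coprime b c" "b > 0" "c > 0"
    and g: "\<And>i. g i = (if i \<in> {1..s} then 1 / real b else 1 / real c)"
    and sum: "(\<Sum>i\<le>CARD('n). g i) \<in> \<int>"
  shows "coeff_lattice (simplex_BC_vertex B C :: nat \<Rightarrow> (real, 'n) vec) = cyclic_mod_int CARD('n) g"
proof (intro equalityI subsetI)
  let ?d = "CARD('n)" and ?L = "coeff_lattice (simplex_BC_vertex B C :: nat \<Rightarrow> (real, 'n) vec)"
  have lenB: "length B = s" and lenC: "length C = ?d" using s by (simp_all add: B C)
  have coordB: "seq_coord B i = (if i < s then int b - 1 else if i = s then int b else 0)" if "i \<ge> 1" for i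
    using that s by (auto simp: seq_coord_def B nth_append)
  have coordC: "seq_coord C i = (if i \<le> s then 0 else if i < ?d then int c - 1 else int c)" if "i \<in> {1..?d}" for i
    using that s by (auto simp: seq_coord_def C nth_append)
  have mem: "r \<in> ?L \<longleftrightarrow> (\<forall>i\<in>{1..<s}. r i + r s * (real b - 1) \<in> \<int>) \<and> r s * real b \<in> \<int> \<and>
      (\<forall>i\<in>{s<..<?d}. r i + r ?d * (real c - 1) \<in> \<int>) \<and> r ?d * real c \<in> \<int> \<and> (\<Sum>i\<le>?d. r i) \<in> \<int>" for r
  proof -
    have "{1..?d} = {1..<s} \<union> {s} \<union> {s<..<?d} \<union> {?d}" using s by auto
    then show ?thesis
      unfolding coeff_lattice_simplex_BC[of B C r, where 'n = 'n, unfolded lenB lenC, OF s refl]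
      using s by (simp add: ball_Un coordB coordC) auto
  qed
  fix r :: "nat \<Rightarrow> real"
  {
    assume "r \<in> ?L"
    then have r: "\<And>i. i \<in> {1..<s} \<Longrightarrow> r i + r s * (real b - 1) \<in> \<int>" "r s * real b \<in> \<int>"
      "\<And>i. i \<in> {s<..<?d} \<Longrightarrow> r i + r ?d * (real c - 1) \<in> \<int>" "r ?d * real c \<in> \<int>" "(\<Sum>i\<le>?d. r i) \<in> \<int>"
      unfolding mem by blast+
    obtain x y where x: "r s * real b = of_int x" and y: "r ?d * real c = of_int y"
      using r(2,4) by (auto elim!: Ints_cases)
    have "coprime (int b) (int c)" using bc(1) by simp
    then obtain j where "[j = x] (mod int b)" "[j = y] (mod int c)"
      using binary_chinese_remainder_int by blast
    then obtain u w where u: "j - x = int b * u" and w: "j - y = int c * w"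
      by (auto simp: cong_iff_dvd_diff elim!: dvdE)
    have "r s = (of_int j - of_int (j - x)) / real b" using x bc(2) by (simp add: field_simps)
    then have rs: "r s = of_int j / real b - of_int u" using bc(2) by (simp add: u field_simps)
    have "r ?d = (of_int j - of_int (j - y)) / real c" using y bc(3) by (simp add: field_simps)
    then have rd: "r ?d = of_int j / real c - of_int w" using bc(3) by (simp add: w field_simps)
    have pos: "r i - of_int j * g i \<in> \<int>" if i: "i \<in> {1..?d}" for i
    proof -
      consider "i \<in> {1..<s}" | "i = s" | "i \<in> {s<..<?d}" | "i = ?d" using i s by force
      then show ?thesis
      proof cases
        case 1
        have eq: "r i - of_int j * g i = (r i + r s * (real b - 1)) - of_int x - of_int u"
          using 1 bc(2) by (simp add: g rs x[symmetric] field_simps)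
        show ?thesis unfolding eq by (rule Ints_diff[OF Ints_diff[OF r(1)[OF 1] Ints_of_int] Ints_of_int])
      next
        case 3
        have eq: "r i - of_int j * g i = (r i + r ?d * (real c - 1)) - of_int y - of_int w"
          using 3 bc(3) by (simp add: g rd y[symmetric] field_simps)
        show ?thesis unfolding eq by (rule Ints_diff[OF Ints_diff[OF r(3)[OF 3] Ints_of_int] Ints_of_int])
      qed (use s in \<open>simp_all add: g rs rd\<close>)
    qed
    show "r \<in> cyclic_mod_int ?d g"
    proof (rule cyclic_mod_intI)
      fix i assume "i \<le> ?d"
      then show "r i - of_int j * g i \<in> \<int>"
        using pos[of i] sum_cyclic_first_coordinate[OF r(5) sum pos] by (cases "i = 0") auto
    qed
  next
    assume "r \<in> cyclic_mod_int ?d g"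
    then obtain j where j: "\<And>i. i \<le> ?d \<Longrightarrow> r i - of_int j * g i \<in> \<int>" unfolding cyclic_mod_int_def by blast
    obtain n m where "r s - of_int j * g s = of_int n" "r ?d - of_int j * g ?d = of_int m"
      using j[of ?d] j[of s] s(2) by (auto elim!: Ints_cases)
    then have rs: "r s = of_int j / real b + of_int n" and rd: "r ?d = of_int j / real c + of_int m"
      using s by (auto simp: g)
    have "r i + r s * (real b - 1) \<in> \<int>" if i: "i \<in> {1..<s}" for i
    proof -
      have eq: "r i + r s * (real b - 1) = (r i - of_int j * g i) + of_int (j + n * (int b - 1))"
        using bc(2) i by (simp add: g rs field_simps)
      show ?thesis unfolding eq using i s by (intro Ints_add[OF j Ints_of_int]) simp
    qed
    moreover have "r i + r ?d * (real c - 1) \<in> \<int>" if i: "i \<in> {s<..<?d}" for i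
    proof -
      have eq: "r i + r ?d * (real c - 1) = (r i - of_int j * g i) + of_int (j + m * (int c - 1))"
        using bc(3) i by (simp add: g rd field_simps)
      show ?thesis unfolding eq using i s by (intro Ints_add[OF j Ints_of_int]) simp
    qed
    moreover have "r s * real b = of_int (j + n * int b)" "r ?d * real c = of_int (j + m * int c)"
      using bc by (simp_all add: rs rd field_simps)
    ultimately show "r \<in> ?L"
      unfolding mem using sum_cyclic_in_Ints[OF sum j] by (metis Ints_of_int)
  }
qed

lemma sum_eq_of_image_mset:
  "(\<Sum>i\<le>d. g i) = sum_mset (image_mset g (mset_set {..d}))" for d :: nat
  by (simp add: sum_unfold_sum_mset)

lemma simplex_A_if_all_unit_fractions:
  fixes v :: "nat \<Rightarrow> real ^ 'n::{finite,linorder}" and N k :: nat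
  assumes ind: "affinely_independent v" and v: "coeff_lattice v = cyclic_mod_int CARD('n) g"
    and M: "image_mset g (mset_set {..CARD('n)}) = replicate_mset (N * k) (1 / real N)" and N: "N * k \<ge> 2"
  shows "CARD('n) = N * k - 1" "length (replicate (N * k - 2) 1 @ [int N]) = CARD('n)"
    "unimodular_equiv (convex hull (v ` {..CARD('n)})) (simplex_A (replicate (N * k - 2) 1 @ [int N]))"
proof -
  let ?A = "replicate (N * k - 2) 1 @ [int N]"
  have "size (image_mset g (mset_set {..CARD('n)})) = N * k" unfolding M by simp
  then show d: "CARD('n) = N * k - 1" by simp
  then show "length ?A = CARD('n)" using N by simp
  have N0: "N > 0" using N by (cases N) auto
  define g' where "g' = (\<lambda>_::nat. 1 / real N)"
  have M': "image_mset g' (mset_set {..CARD('n)}) = replicate_mset (N * k) (1 / real N)"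
  proof -
    have "Suc CARD('n) = N * k" using d N by simp
    then show ?thesis by (simp add: g'_def image_mset_const_eq)
  qed
  have "(\<Sum>i\<le>CARD('n). g' i) = of_int (int k)"
    unfolding sum_eq_of_image_mset M' using N0 by (simp add: sum_mset_replicate_mset)
  then have sum: "(\<Sum>i\<le>CARD('n). g' i) \<in> \<int>" by (simp only: Ints_of_int)
  have "coeff_lattice (simplex_A_vertex ?A :: nat \<Rightarrow> (real, 'n) vec) = cyclic_mod_int CARD('n) g'"
    by (rule coeff_lattice_simplex_A_cyclic[where a = "int N"]) (use d N N0 sum in \<open>auto simp: g'_def nth_append\<close>)
  from unimodular_equiv_if_cyclic[OF ind v this] show "unimodular_equiv (convex hull (v ` {..CARD('n)})) (simplex_A ?A)"
    unfolding simplex_A_eq M M' by simp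
qed

text \<open>
  The generator of the model has \<open>1 / (p q)\<close> at the vertices \<open>1, \<dots>, p k - 1\<close> and \<open>d\<close>, and \<open>1 / q\<close> at the others,
  including the origin.
\<close>

lemma simplex_A_if_mixed_unit_fractions:
  fixes v :: "nat \<Rightarrow> real ^ 'n::{finite,linorder}" and p q k :: nat
  assumes ind: "affinely_independent v" and v: "coeff_lattice v = cyclic_mod_int CARD('n) g"
    and M: "image_mset g (mset_set {..CARD('n)}) =
      replicate_mset (p * k) (1 / (real p * real q)) + replicate_mset ((p * q - 1) * k) (1 / real q)"
    and pq: "p > 1" "q > 1" "k > 0"
  shows "CARD('n) = p * k + (p * q - 1) * k - 1"
    "length (replicate (p * k - 1) 1 @ replicate ((p * q - 1) * k - 1) (int p) @ [int (p * q)]) = CARD('n)"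
    "unimodular_equiv (convex hull (v ` {..CARD('n)}))
      (simplex_A (replicate (p * k - 1) 1 @ replicate ((p * q - 1) * k - 1) (int p) @ [int (p * q)]))"
proof -
  let ?A = "replicate (p * k - 1) 1 @ replicate ((p * q - 1) * k - 1) (int p) @ [int (p * q)]"
  have "size (image_mset g (mset_set {..CARD('n)})) = p * k + (p * q - 1) * k" unfolding M by simp
  then show d: "CARD('n) = p * k + (p * q - 1) * k - 1" by simp
  have pk: "p * k \<ge> 2" using pq by (metis Suc_leI mult_le_mono nat_mult_1_right numeral_2_eq_2 One_nat_def)
  have "p * q > 1" using pq by (metis less_1_mult)
  then have pqk: "(p * q - 1) * k \<ge> 1" using pq by simp
  show len: "length ?A = CARD('n)" using d pk pqk by simp
  define S where "S = insert CARD('n) {1..<p * k}"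
  define g' where "g' i = (if i \<in> S then 1 / (real p * real q) else 1 / real q)" for i
  have "CARD('n) \<ge> p * k" using d pqk by linarith
  then have "CARD('n) \<notin> {1..<p * k}" by simp
  then have S: "S \<subseteq> {..CARD('n)}" "card S = p * k" using d pk pqk by (auto simp: S_def)
  have M': "image_mset g' (mset_set {..CARD('n)}) =
      replicate_mset (p * k) (1 / (real p * real q)) + replicate_mset ((p * q - 1) * k) (1 / real q)"
    using image_mset_two_values[OF S(1), of g' "1 / (real p * real q)" "1 / real q"] S(2) d pk by (simp add: g'_def)
  have "(\<Sum>i\<le>CARD('n). g' i) = of_int (int (p * k))"
  proof -
    have "real ((p * q - 1) * k) = (real p * real q - 1) * real k"
    proof -
      have "real (p * q - 1) = real p * real q - 1"
        using \<open>p * q > 1\<close> pq by (subst of_nat_diff) (simp_all add: Suc_le_eq)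
      then show ?thesis by simp
    qed
    then show ?thesis
      unfolding sum_eq_of_image_mset M' using pq by (simp add: sum_mset_replicate_mset field_simps del: of_nat_mult) (simp add: field_simps)
  qed
  then have sum: "(\<Sum>i\<le>CARD('n). g' i) \<in> \<int>" by (simp only: Ints_of_int)
  have "coeff_lattice (simplex_A_vertex ?A :: nat \<Rightarrow> (real, 'n) vec) = cyclic_mod_int CARD('n) g'"
  proof (rule coeff_lattice_simplex_A_cyclic[where a = "int (p * q)"])
    show "length ?A = CARD('n)" by (rule len)
    show "g' i = of_int (?A ! (i - 1)) / of_int (int (p * q))" if i: "i \<in> {1..<CARD('n)}" for i
    proof (cases "i < p * k")
      case True
      then have "i - 1 < p * k - 1" using i by auto
      then have "?A ! (i - 1) = 1" by (simp add: nth_append)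
      then show ?thesis using i True by (simp add: g'_def S_def)
    next
      case False
      then have "?A ! (i - 1) = int p" using i d pk pqk by (auto simp: nth_append)
      then show ?thesis using i False pq by (simp add: g'_def S_def)
    qed
  qed (use pq sum in \<open>auto simp: g'_def S_def\<close>)
  from unimodular_equiv_if_cyclic[OF ind v this] show "unimodular_equiv (convex hull (v ` {..CARD('n)})) (simplex_A ?A)"
    unfolding simplex_A_eq M M' by simp
qed

lemma simplex_BC_if_two_unit_fractions:
  fixes v :: "nat \<Rightarrow> real ^ 'n::{finite,linorder}" and p q k :: nat
  assumes ind: "affinely_independent v" and v: "coeff_lattice v = cyclic_mod_int CARD('n) g"
    and M: "image_mset g (mset_set {..CARD('n)}) =
      replicate_mset (p * k) (1 / real p) + replicate_mset (p * q * k) (1 / real q)"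
    and pq: "coprime p q" "p > 1" "q > 1" "k > 0"
  shows "CARD('n) = p * k + p * q * k - 1"
    "length (replicate (p * k) (int q) @ replicate (p * q * k - 2) 1 @ [int q]) = CARD('n)"
    "unimodular_equiv (convex hull (v ` {..CARD('n)}))
      (simplex_BC (replicate (p * k - 1) 1 @ [int p]) (replicate (p * k) (int q) @ replicate (p * q * k - 2) 1 @ [int q]))"
proof -
  let ?B = "replicate (p * k - 1) 1 @ [int p]" and ?C = "replicate (p * k) (int q) @ replicate (p * q * k - 2) 1 @ [int q]"
  have "size (image_mset g (mset_set {..CARD('n)})) = p * k + p * q * k" unfolding M by simp
  then show d: "CARD('n) = p * k + p * q * k - 1" by simp
  have pk: "p * k \<ge> 2" using pq by (metis Suc_leI mult_le_mono nat_mult_1_right numeral_2_eq_2 One_nat_def)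
  have "p * k * 1 \<le> p * k * q" using pq by (intro mult_le_mono2) simp
  also have "p * k * q = p * q * k" by simp
  finally have pqk: "p * q * k \<ge> 2" using pk by linarith
  define g' where "g' i = (if i \<in> {1..p * k} then 1 / real p else 1 / real q)" for i
  have S: "{1..p * k} \<subseteq> {..CARD('n)}" using d pqk by auto
  have M': "image_mset g' (mset_set {..CARD('n)}) = replicate_mset (p * k) (1 / real p) + replicate_mset (p * q * k) (1 / real q)"
  proof -
    have "image_mset g' (mset_set {..CARD('n)}) = replicate_mset (card {1..p * k}) (1 / real p)
        + replicate_mset (CARD('n) + 1 - card {1..p * k}) (1 / real q)"
      by (rule image_mset_two_values[OF S]) (auto simp: g'_def)
    moreover have "CARD('n) + 1 - p * k = p * q * k" using d pk by simp
    ultimately show ?thesis by simp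
  qed
  have "(\<Sum>i\<le>CARD('n). g' i) = of_int (int (k + p * k))"
    unfolding sum_eq_of_image_mset M' using pq by (simp add: sum_mset_replicate_mset field_simps)
  then have sum: "(\<Sum>i\<le>CARD('n). g' i) \<in> \<int>" by (simp only: Ints_of_int)
  have len: "0 < length ?B" "length ?B < CARD('n)" "length ?C = CARD('n)" using d pk pqk by auto
  show "length ?C = CARD('n)" by (rule len(3))
  have "CARD('n) - p * k - 1 = p * q * k - 2" using d by simp
  then have "coeff_lattice (simplex_BC_vertex ?B ?C :: nat \<Rightarrow> (real, 'n) vec) = cyclic_mod_int CARD('n) g'"
    by (intro coeff_lattice_simplex_BC_cyclic[where s = "p * k" and b = p and c = q])
      (use pq pk pqk d sum in \<open>auto simp: g'_def\<close>)
  from unimodular_equiv_if_cyclic[OF ind v this] show "unimodular_equiv (convex hull (v ` {..CARD('n)})) (simplex_BC ?B ?C)"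
    unfolding simplex_BC_eq[OF len(1,2)] M M' by simp
qed

section \<open>The group of a simplex\<close>

text \<open>
  The element of \<open>\<Lambda>\<close> represented by a coefficient vector, in the list form used by \<open>Lambda_group\<close>.
\<close>

definition residue_list :: "nat \<Rightarrow> (nat \<Rightarrow> real) \<Rightarrow> real_mod_int list" where
  "residue_list d r = map (\<lambda>i. residue_class (r i)) [0..<d + 1]"

lemma residue_class_simps:
  "residue_class x + residue_class y = residue_class (x + y)"
  "- residue_class x = residue_class (- x)" "residue_class 0 = 0"
  by (transfer; simp)+

lemma residue_class_eqI: "x - y \<in> \<int> \<Longrightarrow> residue_class x = residue_class y"
  by transfer

lemma residue_list_nth: "i \<le> d \<Longrightarrow> residue_list d r ! i = residue_class (r i)"
  by (simp add: residue_list_def nth_append del: upt_Suc)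

lemma length_residue_list: "length (residue_list d r) = d + 1"
  by (simp add: residue_list_def)

lemma residue_list_eqI: "(\<And>i. i \<le> d \<Longrightarrow> r i - s i \<in> \<int>) \<Longrightarrow> residue_list d r = residue_list d s"
  by (simp add: residue_list_def residue_class_eqI)

lemma residue_list_add: "map2 (+) (residue_list d r) (residue_list d s) = residue_list d (\<lambda>i. r i + s i)"
  by (rule nth_equalityI) (simp_all add: length_residue_list residue_list_nth residue_class_simps)

lemma residue_list_0: "residue_list d (\<lambda>_. 0) = replicate (d + 1) 0"
  by (rule nth_equalityI) (simp_all add: length_residue_list residue_list_nth residue_class_simps del: replicate_Suc)

lemma carrier_Lambda_group:
  fixes v :: "nat \<Rightarrow> real ^ 'n"
  shows "carrier (Lambda_group v) = residue_list CARD('n) ` coeff_lattice v"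
proof (intro equalityI subsetI)
  fix xs assume "xs \<in> carrier (Lambda_group v)"
  then have "length xs = CARD('n) + 1 \<and> (\<exists>r. (\<forall>i\<le>CARD('n). xs ! i = residue_class (r i)) \<and>
      (\<Sum>i\<le>CARD('n). r i *\<^sub>R (v i, 1 :: real)) \<in> int_lattice \<times> \<int>)"
    unfolding Lambda_group_def by (simp only: partial_object.simps mem_Collect_eq)
  then obtain r where r: "length xs = CARD('n) + 1" "\<forall>i\<le>CARD('n). xs ! i = residue_class (r i)"
    "(\<Sum>i\<le>CARD('n). r i *\<^sub>R (v i, 1 :: real)) \<in> int_lattice \<times> \<int>"
    by (elim conjE exE)
  have "xs = residue_list CARD('n) r"
    using r(1,2) by (intro nth_equalityI) (auto simp: length_residue_list residue_list_nth)
  moreover have "r \<in> coeff_lattice v" using r(3) by (simp add: coeff_lattice_def sum_scaleR_Pair_1 del: scaleR_Pair)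
  ultimately show "xs \<in> residue_list CARD('n) ` coeff_lattice v" by blast
next
  fix xs assume "xs \<in> residue_list CARD('n) ` coeff_lattice v"
  then obtain r where r: "r \<in> coeff_lattice v" "xs = residue_list CARD('n) r" by blast
  have "(\<Sum>i\<le>CARD('n). r i *\<^sub>R (v i, 1 :: real)) \<in> int_lattice \<times> \<int>"
    using r(1) by (simp add: coeff_lattice_def sum_scaleR_Pair_1 del: scaleR_Pair)
  moreover have "length xs = CARD('n) + 1" "\<forall>i\<le>CARD('n). xs ! i = residue_class (r i)"
    by (simp_all add: r(2) length_residue_list residue_list_nth)
  ultimately show "xs \<in> carrier (Lambda_group v)"
    unfolding Lambda_group_def partial_object.simps mem_Collect_eq by (intro conjI exI[of _ r])
qed

lemma coeff_lattice_add: "r \<in> coeff_lattice v \<Longrightarrow> s \<in> coeff_lattice v \<Longrightarrow> (\<lambda>i. r i + s i) \<in> coeff_lattice v"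
  and coeff_lattice_minus: "r \<in> coeff_lattice v \<Longrightarrow> (\<lambda>i. - r i) \<in> coeff_lattice v"
  and coeff_lattice_0: "(\<lambda>_. 0) \<in> coeff_lattice v"
  using int_lattice_diff[OF int_lattice_0]
  by (auto simp: coeff_lattice_def scaleR_left_distrib sum.distrib sum_negf int_lattice_add int_lattice_0)

lemma mult_Lambda_group:
  fixes v :: "nat \<Rightarrow> real ^ 'n"
  shows "residue_list CARD('n) r \<otimes>\<^bsub>Lambda_group v\<^esub> residue_list CARD('n) s = residue_list CARD('n) (\<lambda>i. r i + s i)"
  by (simp add: Lambda_group_def residue_list_add)

lemma one_Lambda_group:
  fixes v :: "nat \<Rightarrow> real ^ 'n"
  shows "\<one>\<^bsub>Lambda_group v\<^esub> = residue_list CARD('n) (\<lambda>_. 0)"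
  by (simp add: Lambda_group_def residue_list_0)

lemma group_Lambda_group:
  fixes v :: "nat \<Rightarrow> real ^ 'n"
  shows "group (Lambda_group v)"
proof (rule groupI)
  fix x y z assume xyz: "x \<in> carrier (Lambda_group v)" "y \<in> carrier (Lambda_group v)" "z \<in> carrier (Lambda_group v)"
  then obtain r s t where "r \<in> coeff_lattice v" "s \<in> coeff_lattice v" 
    "x = residue_list CARD('n) r" "y = residue_list CARD('n) s" "z = residue_list CARD('n) t"
    unfolding carrier_Lambda_group by blast
  then show "x \<otimes>\<^bsub>Lambda_group v\<^esub> y \<otimes>\<^bsub>Lambda_group v\<^esub> z = x \<otimes>\<^bsub>Lambda_group v\<^esub> (y \<otimes>\<^bsub>Lambda_group v\<^esub> z)"
    by (simp add: mult_Lambda_group add.assoc)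
next
  fix x y assume "x \<in> carrier (Lambda_group v)" "y \<in> carrier (Lambda_group v)"
  then obtain r s where "r \<in> coeff_lattice v" "s \<in> coeff_lattice v" 
    "x = residue_list CARD('n) r" "y = residue_list CARD('n) s"
    unfolding carrier_Lambda_group by blast
  then show "x \<otimes>\<^bsub>Lambda_group v\<^esub> y \<in> carrier (Lambda_group v)"
    by (simp add: mult_Lambda_group carrier_Lambda_group coeff_lattice_add)
next
  show "\<one>\<^bsub>Lambda_group v\<^esub> \<in> carrier (Lambda_group v)"
    by (simp add: one_Lambda_group carrier_Lambda_group coeff_lattice_0)
next
  fix x assume "x \<in> carrier (Lambda_group v)"
  then obtain r where r: "r \<in> coeff_lattice v" "x = residue_list CARD('n) r"
    unfolding carrier_Lambda_group by blast
  then show "\<one>\<^bsub>Lambda_group v\<^esub> \<otimes>\<^bsub>Lambda_group v\<^esub> x = x"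
    by (simp add: one_Lambda_group mult_Lambda_group)
  have "residue_list CARD('n) (\<lambda>i. - r i) \<in> carrier (Lambda_group v)"
    using coeff_lattice_minus[OF r(1)] by (simp add: carrier_Lambda_group)
  moreover have "residue_list CARD('n) (\<lambda>i. - r i) \<otimes>\<^bsub>Lambda_group v\<^esub> x = \<one>\<^bsub>Lambda_group v\<^esub>"
    by (simp add: r(2) one_Lambda_group mult_Lambda_group)
  ultimately show "\<exists>y\<in>carrier (Lambda_group v). y \<otimes>\<^bsub>Lambda_group v\<^esub> x = \<one>\<^bsub>Lambda_group v\<^esub>" by blast
qed

lemma generate_Lambda_group:
  fixes v :: "nat \<Rightarrow> real ^ 'n"
  assumes L: "coeff_lattice v = cyclic_mod_int CARD('n) g"
  shows "residue_list CARD('n) g \<in> carrier (Lambda_group v)"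
    "generate (Lambda_group v) {residue_list CARD('n) g} = carrier (Lambda_group v)"
proof -
  interpret group "Lambda_group v" by (rule group_Lambda_group)
  let ?G = "Lambda_group v" and ?g = "residue_list CARD('n) g"
  have g: "g \<in> coeff_lattice v" unfolding L by (rule cyclic_mod_intI[of _ _ 1]) simp
  then show mem: "?g \<in> carrier ?G" by (simp add: carrier_Lambda_group)
  have pow: "residue_list CARD('n) (\<lambda>i. real m * g i) \<in> generate ?G {?g}" for m
  proof (induction m)
    case 0
    then show ?case using generate.one[of ?G "{?g}"] by (simp add: one_Lambda_group)
  next
    case (Suc m)
    have "residue_list CARD('n) (\<lambda>i. real m * g i) \<otimes>\<^bsub>?G\<^esub> ?g \<in> generate ?G {?g}"
      by (intro generate.eng[OF Suc] generate.incl) simp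
    then show ?case by (simp add: mult_Lambda_group algebra_simps)
  qed
  have neg: "residue_list CARD('n) (\<lambda>i. - (real m * g i)) \<in> generate ?G {?g}" for m
  proof -
    have "residue_list CARD('n) (\<lambda>i. real m * g i) \<in> carrier ?G"
      using generate_incl[of "{?g}"] mem pow[of m] by blast
    moreover have "residue_list CARD('n) (\<lambda>i. - (real m * g i)) \<in> carrier ?G"
    proof -
      have "(\<lambda>i. - (real m * g i)) \<in> coeff_lattice v"
        unfolding L by (rule cyclic_mod_intI[of _ _ "- int m"]) simp
      then show ?thesis by (simp add: carrier_Lambda_group)
    qed
    ultimately have "inv\<^bsub>?G\<^esub> residue_list CARD('n) (\<lambda>i. real m * g i) = residue_list CARD('n) (\<lambda>i. - (real m * g i))"
      by (intro inv_equality) (simp_all add: mult_Lambda_group one_Lambda_group)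
    then show ?thesis using generate_m_inv_closed[of "{?g}", OF _ pow[of m]] mem by simp
  qed
  show "generate ?G {?g} = carrier ?G"
  proof
    show "generate ?G {?g} \<subseteq> carrier ?G" using generate_incl[of "{?g}"] mem by blast
    show "carrier ?G \<subseteq> generate ?G {?g}"
    proof
      fix x assume "x \<in> carrier ?G"
      then obtain r where r: "r \<in> cyclic_mod_int CARD('n) g" "x = residue_list CARD('n) r"
        unfolding carrier_Lambda_group L by blast
      then obtain j :: int where "\<forall>i\<le>CARD('n). r i - of_int j * g i \<in> \<int>" unfolding cyclic_mod_int_def by blast
      then have x: "x = residue_list CARD('n) (\<lambda>i. of_int j * g i)"
        unfolding r(2) by (intro residue_list_eqI) simp
      show "x \<in> generate ?G {?g}"
      proof (cases "j \<ge> 0")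
        case True
        then show ?thesis using pow[of "nat j"] by (simp add: x)
      next
        case False
        then show ?thesis using neg[of "nat (- j)"] by (simp add: x)
      qed
    qed
  qed
qed

lemma Lambda_generated_if_cyclic:
  fixes v :: "nat \<Rightarrow> real ^ 'n"
  assumes L: "coeff_lattice v = cyclic_mod_int CARD('n) g"
    and M: "image_mset residue_class (image_mset g (mset_set {..CARD('n)})) = mset l"
  shows "Lambda_generated_up_to_perm v l"
proof -
  have "mset (residue_list CARD('n) g) = mset l"
    unfolding M[symmetric] residue_list_def
    by (simp add: atLeast0LessThan lessThan_Suc_atMost image_mset.compositionality o_def del: upt_Suc)
  then show ?thesis
    unfolding Lambda_generated_up_to_perm_def using generate_Lambda_group[OF L] by blast
qed

lemma lattice_simplex_vertices:
  fixes v :: "nat \<Rightarrow> real ^ 'n"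
  assumes "lattice_simplex CARD('n) \<Delta>" "bij_betw v {0..CARD('n)} (vertices \<Delta>)"
  shows "\<Delta> = convex hull (v ` {..CARD('n)})" "affinely_independent v" "i \<le> CARD('n) \<Longrightarrow> v i \<in> int_lattice"
proof -
  obtain C where C: "\<not> affine_dependent C" "\<Delta> = convex hull C"
    using assms(1) unfolding lattice_simplex_def simplex_def by blast
  have "vertices \<Delta> = C"
    unfolding vertices_def C(2) using extreme_point_of_convex_hull_affine_independent[OF C(1)] by blast
  then have v: "inj_on v {..CARD('n)}" "v ` {..CARD('n)} = C"
    using assms(2) unfolding bij_betw_def atLeast0AtMost by simp_all
  show "\<Delta> = convex hull (v ` {..CARD('n)})" "affinely_independent v"
    using C v by (simp_all add: affinely_independent_iff)
  show "v i \<in> int_lattice" if "i \<le> CARD('n)"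
    using assms(1) \<open>vertices \<Delta> = C\<close> v(2) that unfolding lattice_simplex_def lattice_polytope_def by blast
qed

section \<open>The classification\<close>

theorem theorem3p8:
  fixes p q k :: nat
    and \<Delta> :: "(real ^ 'n::{finite,linorder}) set"
    and v :: "nat \<Rightarrow> real ^ 'n::{finite,linorder}"
  assumes "prime p" and "prime q" and "p \<noteq> q" and "k > 0"
    and "lattice_simplex CARD('n) \<Delta>"
    and "bij_betw v {0..CARD('n)} (vertices \<Delta>)"
    and "gorenstein \<Delta>"
    and "is_delta_poly \<Delta> (\<Sum>j<p * q. monom 1 (j * k))"
    and "\<not> is_lattice_pyramid \<Delta>"
  shows
    "(CARD('n) = p * q * k - 1 \<and>
        Lambda_generated_up_to_perm v
          (replicate (p * q * k) (residue_class (1 / (real p * real q))))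
      \<or> CARD('n) = p * q * k + p * k - 1 \<and>
        Lambda_generated_up_to_perm v
          (replicate (p * k) (residue_class (1 / real p)) @
           replicate (p * q * k) (residue_class (1 / real q)))
      \<or> CARD('n) = p * q * k + q * k - 1 \<and>
        Lambda_generated_up_to_perm v
          (replicate (q * k) (residue_class (1 / real q)) @
           replicate (p * q * k) (residue_class (1 / real p)))
      \<or> CARD('n) = p * q * k + (p - 1) * k - 1 \<and>
        Lambda_generated_up_to_perm v
          (replicate ((p * q - 1) * k) (residue_class (1 / real q)) @
           replicate (p * k) (residue_class (1 / (real p * real q))))
      \<or> CARD('n) = p * q * k + (q - 1) * k - 1 \<and>
        Lambda_generated_up_to_perm v
          (replicate ((p * q - 1) * k) (residue_class (1 / real p)) @
           replicate (q * k) (residue_class (1 / (real p * real q)))))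
     \<and>
     (let A1 = replicate (p * q * k - 2) 1 @ [int (p * q)];
          A2 = replicate (p * k - 1) 1 @ replicate ((p * q - 1) * k - 1) (int p) @ [int (p * q)];
          A3 = replicate (q * k - 1) 1 @ replicate ((p * q - 1) * k - 1) (int q) @ [int (p * q)];
          B1 = replicate (p * k - 1) 1 @ [int p];
          C1 = replicate (p * k) (int q) @ replicate (p * q * k - 2) 1 @ [int q];
          B2 = replicate (q * k - 1) 1 @ [int q];
          C2 = replicate (q * k) (int p) @ replicate (p * q * k - 2) 1 @ [int p]
      in length A1 = CARD('n) \<and> unimodular_equiv \<Delta> (simplex_A A1)
       \<or> length A2 = CARD('n) \<and> unimodular_equiv \<Delta> (simplex_A A2)
       \<or> length A3 = CARD('n) \<and> unimodular_equiv \<Delta> (simplex_A A3)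
       \<or> length C1 = CARD('n) \<and> unimodular_equiv \<Delta> (simplex_BC B1 C1)
       \<or> length C2 = CARD('n) \<and> unimodular_equiv \<Delta> (simplex_BC B2 C2))"
proof -
  note \<Delta> = lattice_simplex_vertices[OF assms(5,6)]
  have p1: "p > 1" and q1: "q > 1" using assms(1,2) prime_gt_1_nat by blast+
  have cop: "coprime p q" "coprime q p" using assms(1-3) primes_coprime by blast+
  have "1 < p * q" using p1 q1 by (rule less_1_mult)
  have "2 * 1 \<le> p * q * k" using \<open>1 < p * q\<close> assms(4) by (intro mult_le_mono) auto
  then have pqk: "2 \<le> p * q * k" by simp
  have graded: "height_graded CARD('n) (p * q) k (coeff_lattice v)"
    by (rule height_graded_coeff_lattice[OF \<Delta>(2,3)]) (use assms(4,8) \<Delta>(1) in auto)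
  have full: "\<exists>r\<in>coeff_lattice v. r i \<notin> \<int>" if "i \<le> CARD('n)" for i
    using lattice_pyramid_if_integral_coefficient[OF \<Delta>(2,3) that] assms(9) \<Delta>(1) by blast
  obtain g where g: "coeff_lattice v = cyclic_mod_int CARD('n) g"
    and M: "image_mset g (mset_set {..CARD('n)}) = replicate_mset (p * q * k) (1 / (real p * real q)) \<or>
     image_mset g (mset_set {..CARD('n)}) = replicate_mset (p * k) (1 / real p) + replicate_mset (p * q * k) (1 / real q) \<or>
     image_mset g (mset_set {..CARD('n)}) = replicate_mset (q * k) (1 / real q) + replicate_mset (p * q * k) (1 / real p) \<or>
     image_mset g (mset_set {..CARD('n)}) = replicate_mset (p * k) (1 / (real p * real q)) + replicate_mset ((p * q - 1) * k) (1 / real q) \<or>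
     image_mset g (mset_set {..CARD('n)}) = replicate_mset (q * k) (1 / (real p * real q)) + replicate_mset ((p * q - 1) * k) (1 / real p)"
    by (rule height_graded.generator_classification[OF graded assms(1-3) refl full])
  note A = simplex_A_if_all_unit_fractions[OF \<Delta>(2) g]
    and A' = simplex_A_if_mixed_unit_fractions[OF \<Delta>(2) g]
    and BC = simplex_BC_if_two_unit_fractions[OF \<Delta>(2) g]
  have dim: "m * k + (p * q - 1) * k - 1 = p * q * k + (m - 1) * k - 1" if "m > 1" for m
  proof -
    have "1 * k \<le> p * q * k" "1 * k \<le> m * k"
      by (rule mult_le_mono1[OF less_imp_le[OF \<open>1 < p * q\<close>]], rule mult_le_mono1[OF less_imp_le[OF that]])
    then show ?thesis by (simp add: diff_mult_distrib)
  qed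
  from M show ?thesis
  proof (elim disjE)
    assume M: "image_mset g (mset_set {..CARD('n)}) = replicate_mset (p * q * k) (1 / (real p * real q))"
    have "Lambda_generated_up_to_perm v (replicate (p * q * k) (residue_class (1 / (real p * real q))))"
      by (rule Lambda_generated_if_cyclic[OF g]) (simp add: M)
    moreover have M': "image_mset g (mset_set {..CARD('n)}) = replicate_mset (p * q * k) (1 / real (p * q))"
      using M by simp
    ultimately show ?thesis
      unfolding Let_def using A[OF M' pqk, folded \<Delta>(1)] by blast
  next
    assume M: "image_mset g (mset_set {..CARD('n)}) = replicate_mset (p * k) (1 / real p) + replicate_mset (p * q * k) (1 / real q)"
    have "Lambda_generated_up_to_perm v
          (replicate (p * k) (residue_class (1 / real p)) @ replicate (p * q * k) (residue_class (1 / real q)))"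
      by (rule Lambda_generated_if_cyclic[OF g]) (simp add: M)
    then show ?thesis
      unfolding Let_def using BC[OF M cop(1) p1 q1 assms(4), folded \<Delta>(1), unfolded add.commute[of "p * k"]] by blast
  next
    assume M: "image_mset g (mset_set {..CARD('n)}) = replicate_mset (q * k) (1 / real q) + replicate_mset (p * q * k) (1 / real p)"
    have "Lambda_generated_up_to_perm v
          (replicate (q * k) (residue_class (1 / real q)) @ replicate (p * q * k) (residue_class (1 / real p)))"
      by (rule Lambda_generated_if_cyclic[OF g]) (simp add: M)
    moreover have M': "image_mset g (mset_set {..CARD('n)}) = replicate_mset (q * k) (1 / real q) + replicate_mset (q * p * k) (1 / real p)"
      by (simp only: M mult.commute[of q p])
    ultimately show ?thesis
      unfolding Let_def
      using BC[OF M' cop(2) q1 p1 assms(4), folded \<Delta>(1), unfolded mult.commute[of q p] add.commute[of "q * k"]] by blast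
  next
    assume M: "image_mset g (mset_set {..CARD('n)}) =
      replicate_mset (p * k) (1 / (real p * real q)) + replicate_mset ((p * q - 1) * k) (1 / real q)"
    have "Lambda_generated_up_to_perm v
          (replicate ((p * q - 1) * k) (residue_class (1 / real q)) @
           replicate (p * k) (residue_class (1 / (real p * real q))))"
      by (rule Lambda_generated_if_cyclic[OF g]) (simp add: M add.commute)
    then show ?thesis
      unfolding Let_def using A'[OF M p1 q1 assms(4), folded \<Delta>(1), unfolded dim[OF p1]] by blast
  next
    assume M: "image_mset g (mset_set {..CARD('n)}) =
      replicate_mset (q * k) (1 / (real p * real q)) + replicate_mset ((p * q - 1) * k) (1 / real p)"
    have "Lambda_generated_up_to_perm v
          (replicate ((p * q - 1) * k) (residue_class (1 / real p)) @
           replicate (q * k) (residue_class (1 / (real p * real q))))"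
      by (rule Lambda_generated_if_cyclic[OF g]) (simp add: M add.commute)
    moreover have M': "image_mset g (mset_set {..CARD('n)}) =
      replicate_mset (q * k) (1 / (real q * real p)) + replicate_mset ((q * p - 1) * k) (1 / real p)"
      by (simp only: M mult.commute[of q p] mult.commute[of "real q" "real p"])
    ultimately show ?thesis
      unfolding Let_def
      using A'[OF M' q1 p1 assms(4), folded \<Delta>(1), unfolded mult.commute[of q p] dim[OF q1]] by blast
  qed
qed

end
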